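(* Let $k\geq2$ and $w=g_1g_2\cdots g_k$, so that $\sigma_n=s_1(n)s_2(n)\cdots s_k(n)$. Suppose that $k>2$ or $A_1\cup A_2\nsubseteq\{1,2\}$. Then, as $n$ goes to infinity, for all $l\geq1$, the law of $(N_1(\sigma_n),\ldots,N_l(\sigma_n))$ converges weakly to $$\operatorname{Poisson}(1/1)\otimes\cdots\otimes\operatorname{Poisson}(1/l).$$
   Context: Notation: $[n]=\{1,\ldots,n\}$; $\mathfrak{S}_n$ is the group of permutations of $[n]$; for a set $A$ of positive integers, $\mathfrak{S}_n(A)$ is the set of permutations of $[n]$ all of whose cycles have length in $A$; for a permutation $\sigma$ and $l\ge 1$, $N_l(\sigma)$ is the number of cycles of length $l$ of $\sigma$ (fixed points are cycles of length 1). $\operatorname{Poisson}(\lambda)$ is the Poisson distribution with parameter $\lambda$. Random permutations. $A_1,\ldots,A_k$ are nonempty sets of positive integers, none of them equal to $\{1\}$, such that each $A_i$ is either finite or satisfies $\sum_{j\geq1,\,j\notin A_i}\frac1j<\infty$. Only integers $n$ such that $\mathfrak{S}_n(A_1),\ldots,\mathfrak{S}_n(A_k)$ are all nonempty are considered, and limits as $n\to\infty$ are along such $n$. For such $n$, $s_1(n),\ldots,s_k(n)$ are independent random permutations, $s_i(n)$ being uniformly distributed on $\mathfrak{S}_n(A_i)$. *)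

theory Defs
  imports "HOL-Probability.Probability" "HOL-Combinatorics.Orbits"
begin

text \<open>
  A permutation of $[n]$ is a function \<open>p :: nat \<Rightarrow> nat\<close> with \<open>p permutes {1..n}\<close>.
  A cycle is represented by its support, i.e. by an orbit of \<open>p\<close> on $[n]$, so that its
  length is the cardinality of that orbit; fixed points give singletons.
\<close>

definition cycles_of_perm :: "nat \<Rightarrow> (nat \<Rightarrow> nat) \<Rightarrow> nat set set" where
  "cycles_of_perm n p = orbit p ` {1..n}"

definition num_cycles :: "nat \<Rightarrow> nat \<Rightarrow> (nat \<Rightarrow> nat) \<Rightarrow> nat" where
  "num_cycles n l p = card {C \<in> cycles_of_perm n p. card C = l}"

definition perms_with_cycles :: "nat \<Rightarrow> nat set \<Rightarrow> (nat \<Rightarrow> nat) set" where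
  "perms_with_cycles n A = {p. p permutes {1..n} \<and> (\<forall>C\<in>cycles_of_perm n p. card C \<in> A)}"

text \<open>
  The product $s_1 s_2 \cdots s_k$ with the usual convention $s_1 s_2 = s_1 \circ s_2$.
\<close>

definition perm_product :: "nat \<Rightarrow> (nat \<Rightarrow> nat \<Rightarrow> nat) \<Rightarrow> nat \<Rightarrow> nat" where
  "perm_product k s = foldr (\<circ>) (map s [1..<Suc k]) id"

text \<open>
  Weak convergence along a filter, for measures on the Borel sets of an arbitrary topological
  space (\<open>weak_conv_m\<close> of the library only covers measures on the reals).
\<close>

definition weakly_converges ::
  "'a topology \<Rightarrow> ('b \<Rightarrow> 'a measure) \<Rightarrow> 'a measure \<Rightarrow> 'b filter \<Rightarrow> bool" where
  "weakly_converges X \<mu> \<nu> F \<longleftrightarrow>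
     (\<forall>f :: 'a \<Rightarrow> real. continuous_map X euclideanreal f \<and> bounded (f ` topspace X) \<longrightarrow>
        ((\<lambda>n. \<integral>x. f x \<partial>\<mu> n) \<longlongrightarrow> (\<integral>x. f x \<partial>\<nu>)) F)"

text \<open>
  The law of $(N_1, \ldots, N_l)$ lives on $\mathbb{N}^l$, modelled as the extensional functions
  on \<open>{1..l}\<close>. Each factor carries the discrete topology, which is the Euclidean one on
  \<open>nat\<close>.
\<close>

definition cycle_count_law ::
  "'w measure \<Rightarrow> nat \<Rightarrow> nat \<Rightarrow> ('w \<Rightarrow> nat \<Rightarrow> nat) \<Rightarrow> (nat \<Rightarrow> nat) measure" where
  "cycle_count_law M n l \<sigma> =
     distr M (\<Pi>\<^sub>M j\<in>{1..l}. count_space UNIV) (\<lambda>\<omega>. \<lambda>j\<in>{1..l}. num_cycles n j (\<sigma> \<omega>))"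

definition poisson_product :: "nat \<Rightarrow> (nat \<Rightarrow> nat) measure" where
  "poisson_product l = (\<Pi>\<^sub>M j\<in>{1..l}. measure_pmf (poisson_pmf (1 / real j)))"

definition admissible :: "nat \<Rightarrow> (nat \<Rightarrow> nat set) \<Rightarrow> nat set" where
  "admissible k A = {n. \<forall>i\<in>{1..k}. perms_with_cycles n (A i) \<noteq> {}}"

end

theory Submission
  imports Defs "HOL-Real_Asymp.Real_Asymp"
begin

text \<open>
  Put \<open>c = s\<^sub>1\<close> and \<open>d = s\<^sub>2 \<cdots> s\<^sub>k\<close>, so that \<open>\<sigma> = c \<circ> d\<close>. A family of distinct cycles of \<open>\<sigma>\<close> of
  prescribed lengths, with a starting point marked on each of them, is the same thing as an
  injective map \<open>x\<close> from a finite set \<open>V\<close> into $[n]$ such that \<open>\<sigma> (x v) = x (\<pi> v)\<close> for all \<open>v\<close>,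
  where the permutation \<open>\<pi>\<close> of \<open>V\<close> rotates blocks of the prescribed sizes. Up to explicit factors,
  the joint factorial moments of the cycle counts are therefore expected numbers of such maps
  (\<open>card_cycle_embeddings_binomial\<close>), and the limiting Poisson moments say precisely that all these
  expectations tend to 1.

  To compute them, use that the laws of \<open>c\<close> and \<open>d\<close> are invariant under conjugation: replace \<open>d\<close>
  by \<open>g \<circ> d \<circ> g\<^sup>-\<^sup>1\<close> with \<open>g\<close> uniform on all permutations, and write \<open>x = g \<circ> z\<close>. The condition becomes
  a prescription of \<open>g\<close> on the points \<open>z i\<close> and \<open>d (z i)\<close>. It can be met if and only if the set \<open>E\<close> of the
  coincidences \<open>d (z i) = z j\<close> equals the set of the coincidences \<open>c (x j) = x (\<pi> i)\<close>, and then
  exactly $(n - 2m + |E|)!$ permutations \<open>g\<close> meet it, with $m = |V|$. So the expectation is a finite sum over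
  patterns \<open>E\<close> of (solutions for \<open>d\<close>) times (solutions for \<open>c\<close>) times $(n-2m+|E|)!/n!$
  (\<open>sum_conjugates_by_pattern\<close>). The empty pattern contributes the limit 1.

  For the other patterns the point is that an edge of \<open>E\<close> costs each of the two counts a factor
  of order at least $\sqrt n$. In a path, each edge even costs a factor $n$; in a cycle of length $l \ge 2$, the $l$ edges
  cost $n^{l-1} \ge n^{l/2}$; a loop costs $\sqrt n$ when there are $O(\sqrt n)$ fixed points. Thus a pattern
  contributes $O(1)$ (\<open>card_embeddings_bound\<close>). Equality in these estimates is caused only by fixed points
  and by cycles of length 2, so if \<open>c\<close> or \<open>d\<close> has $o(\sqrt n)$ fixed points and $o(n)$ cycles of length 2, all
  nonempty patterns vanish in the limit (\<open>card_embeddings_gain\<close>, \<open>mean_product_embeddings_tendsto_1\<close>).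

  Such smallness is available. If $r \in A$, closing up groups of $r$ fixed points to cycles of
  length $r$ does not leave $\mathfrak{S}_n(A)$ and is injective on marked configurations
  (\<open>sum_embeddings_exchange\<close>). This bounds the mean factorial moment of order $qr$ of the number of fixed
  points by $n^q$, so that number has order at most $n^{1/r}$. Every $A_i$ has an element $r \ge 2$, which gives
  $O(\sqrt n)$; if it has an element $r \ge 3$, there are $o(\sqrt n)$ fixed points and, by a similar exchange, at most
  $O(n^{2/3})$ cycles of length 2. For $k = 2$ this happens for $A_1$ or $A_2$. If $k > 2$, the permutation \<open>d\<close> is
  itself a product of at least two factors, and the pattern formula bounds its factorial
  moments, so it has few fixed points and 2-cycles whatever the sets $A_i$ are
  (\<open>mean_product_scarce\<close>).

  Convergence of joint factorial moments to those of independent Poisson variables gives convergence of the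
  probabilities of single points by the Bonferroni inequalities, applied in one coordinate after the
  other (\<open>joint_poisson_from_factorial_moments\<close>). As the limit is a probability measure, no mass escapes, and
  the integrals of all bounded functions converge (\<open>bounded_mean_limit\<close>).
\<close>

section \<open>Cycles of a permutation\<close>

definition period_points :: "nat \<Rightarrow> nat \<Rightarrow> (nat \<Rightarrow> nat) \<Rightarrow> nat set" where
  "period_points n j p = {i \<in> {1..n}. card (orbit p i) = j}"

lemma finite_period_points [simp]: "finite (period_points n j p)"
  by (simp add: period_points_def)

lemma card_period_points_le: "card (period_points n j p) \<le> n"
proof -
  have "card (period_points n j p) \<le> card {1..n}"
    by (rule card_mono) (auto simp: period_points_def)
  then show ?thesis by simp
qed

lemma permutation_of_permutes: "p permutes {1..n::nat} \<Longrightarrow> permutation p"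
  by (auto simp: permutation_permutes)

lemma permutes_closed: "p permutes S \<Longrightarrow> x \<in> S \<Longrightarrow> p x \<in> S"
  by (simp add: permutes_in_image)

lemma orbit_of_cycle:
  fixes b j :: nat
  assumes "\<And>b. b < j \<Longrightarrow> c (y b) = y ((b + 1) mod j)" and "b < j"
  shows "orbit c (y b) = y ` {..<j}"
proof -
  have pw: "(c ^^ i) (y b) = y ((b + i) mod j)" for i
  proof (induction i)
    case (Suc i)
    have "c (y ((b + i) mod j)) = y (((b + i) mod j + 1) mod j)"
      by (rule assms(1)) (use assms(2) in auto)
    with Suc show ?case by (simp add: mod_Suc_eq)
  qed (use assms(2) in auto)
  have "orbit c (y b) = {(c ^^ m) (y b) | m. m < j}"
    by (rule orbit_altdef_bounded) (use assms(2) pw in auto)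
  also have "\<dots> = y ` {..<j}"
  proof (intro equalityI subsetI)
    fix u assume "u \<in> y ` {..<j}"
    then obtain i where i: "i < j" "u = y i" by auto
    define m where "m = (if b \<le> i then i - b else i + j - b)"
    have "m < j" "(b + m) mod j = i" using i assms(2) by (auto simp: m_def)
    then show "u \<in> {(c ^^ m) (y b) | m. m < j}" using i pw[of m] by (auto intro!: exI[of _ m])
  qed (use assms(2) pw in auto)
  finally show ?thesis .
qed

lemma funpow_orbit:
  assumes "p permutes {1..n::nat}" and "card (orbit p u) = j"
  shows "(p ^^ j) u = u" "inj_on (\<lambda>b. (p ^^ b) u) {..<j}"
proof -
  have self: "u \<in> orbit p u"
    by (rule permutation_self_in_orbit[OF permutation_of_permutes[OF assms(1)]])
  define d where "d = funpow_dist1 p u u"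
  have 1: "orbit p u = (\<lambda>b. (p ^^ b) u) ` {0..<d}"
    unfolding d_def by (rule orbit_conv_funpow_dist1[OF self])
  have 2: "inj_on (\<lambda>b. (p ^^ b) u) {0..<d}"
    unfolding d_def by (rule inj_on_funpow_dist1[OF self])
  have "(p ^^ d) u = u" unfolding d_def by (rule funpow_dist1_prop[OF self])
  moreover have "d = j" using 1 2 assms(2) by (simp add: card_image)
  ultimately show "(p ^^ j) u = u" "inj_on (\<lambda>b. (p ^^ b) u) {..<j}"
    using 2 by (simp_all add: lessThan_atLeast0)
qed

lemma card_period_points:
  assumes p: "p permutes {1..n}"
  shows "card (period_points n j p) = j * num_cycles n j p"
proof -
  have fin: "finite (cycles_of_perm n p)" by (simp add: cycles_of_perm_def)
  let ?C = "{C \<in> cycles_of_perm n p. card C = j}"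
  have cyc: "cyclic_on p (orbit p i)" for i by (rule cyclic_on_orbit[OF p]) auto
  have un: "\<Union>?C = period_points n j p"
  proof (intro equalityI subsetI)
    fix u assume "u \<in> \<Union>?C"
    then obtain i where i: "i \<in> {1..n}" "u \<in> orbit p i" "card (orbit p i) = j"
      by (auto simp: cycles_of_perm_def)
    with cyc[of i] have "orbit p u = orbit p i" by (metis orbit_cyclic_eq3)
    moreover have "u \<in> {1..n}" using permutes_orbit_subset[OF p i(1)] i(2) by auto
    ultimately show "u \<in> period_points n j p" using i by (simp add: period_points_def)
  next
    fix u assume "u \<in> period_points n j p"
    then show "u \<in> \<Union>?C"
      using permutation_self_in_orbit[OF permutation_of_permutes[OF p], of u]
      by (auto simp: cycles_of_perm_def period_points_def)
  qed
  have "j * card ?C = card (\<Union>?C)"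
  proof (rule card_partition)
    show "finite (\<Union>?C)" unfolding un by simp
    fix c1 c2 assume "c1 \<in> ?C" "c2 \<in> ?C" "c1 \<noteq> c2"
    then show "c1 \<inter> c2 = {}"
      using cyc by (auto simp: cycles_of_perm_def) (metis orbit_cyclic_eq3)+
  qed (use fin in auto)
  then show ?thesis by (simp add: un num_cycles_def)
qed

section \<open>Injective solutions of a system of equations $c(x_u) = x_v$\<close>

text \<open>
  The maps are extensional, so that for finite \<open>V\<close> there are finitely many and they can be counted.
  The relation \<open>E\<close> is a graph with vertex set \<open>V\<close>; its edges are the equations.
\<close>

definition embeddings :: "nat \<Rightarrow> (nat \<Rightarrow> nat) \<Rightarrow> 'v set \<Rightarrow> ('v \<times> 'v) set \<Rightarrow> ('v \<Rightarrow> nat) set" where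
  "embeddings n c V E =
     {x \<in> V \<rightarrow>\<^sub>E {1..n}. inj_on x V \<and> (\<forall>(u, v) \<in> E. c (x u) = x v)}"

abbreviation graph_on :: "'v set \<Rightarrow> ('v \<Rightarrow> 'v) \<Rightarrow> ('v \<times> 'v) set" where
  "graph_on V f \<equiv> (\<lambda>v. (v, f v)) ` V"

lemma finite_embeddings [simp]: "finite V \<Longrightarrow> finite (embeddings n c V E)"
  by (rule finite_subset[of _ "V \<rightarrow>\<^sub>E {1..n}"]) (auto simp: embeddings_def intro: finite_PiE)

lemma card_embeddings_le:
  assumes "finite V" shows "card (embeddings n c V E) \<le> n ^ card V"
proof -
  have "card (embeddings n c V E) \<le> card (V \<rightarrow>\<^sub>E {1..n})"
    by (rule card_mono) (auto simp: embeddings_def assms intro: finite_PiE)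
  also have "\<dots> = n ^ card V" by (simp add: card_PiE assms)
  finally show ?thesis .
qed

lemma embeddings_iff:
  "x \<in> embeddings n c V E \<longleftrightarrow>
     x \<in> extensional V \<and> x ` V \<subseteq> {1..n} \<and> inj_on x V \<and> (\<forall>u v. (u, v) \<in> E \<longrightarrow> c (x u) = x v)"
  unfolding embeddings_def PiE_def Pi_def by auto

lemma embeddings_graph_iff:
  "x \<in> embeddings n c V (graph_on V f) \<longleftrightarrow>
     x \<in> extensional V \<and> x ` V \<subseteq> {1..n} \<and> inj_on x V \<and> (\<forall>v\<in>V. c (x v) = x (f v))"
  unfolding embeddings_iff by blast

lemma map_prod_graph_on: "map_prod h h ` graph_on V f = (\<lambda>v. (h v, h (f v))) ` V"
  by (simp add: image_image)

text \<open>
  Renaming or dropping unknowns turns solutions into solutions. Reindexing (\<open>h\<close> bijective) and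
  restriction to a smaller system (\<open>h\<close> the identity) are both instances.
\<close>

lemma embeddings_pullback:
  assumes x: "x \<in> embeddings n c W F" and h: "inj_on h V" "h ` V \<subseteq> W"
    and E: "E \<subseteq> V \<times> V" "map_prod h h ` E \<subseteq> F"
  shows "(\<lambda>v\<in>V. x (h v)) \<in> embeddings n c V E"
  unfolding embeddings_iff
proof (intro conjI allI impI)
  show "(\<lambda>v\<in>V. x (h v)) ` V \<subseteq> {1..n}" using x h(2) by (simp add: embeddings_iff image_subset_iff)
  have "inj_on (x \<circ> h) V"
    using x h by (intro comp_inj_on) (auto simp only: embeddings_iff intro: inj_on_subset)
  then show "inj_on (\<lambda>v\<in>V. x (h v)) V" by (simp add: inj_on_def)
  fix u v assume uv: "(u, v) \<in> E"
  then have "(h u, h v) \<in> F" using E(2) by (force simp: image_subset_iff)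
  then show "c ((\<lambda>v\<in>V. x (h v)) u) = (\<lambda>v\<in>V. x (h v)) v"
    using x uv E(1) by (auto simp: embeddings_iff)
qed simp

lemma card_embeddings_reindex:
  assumes inj: "inj_on h V" and E: "E \<subseteq> V \<times> V"
  shows "card (embeddings n c (h ` V) (map_prod h h ` E)) = card (embeddings n c V E)"
proof (rule bij_betw_same_card[of "\<lambda>x. \<lambda>v\<in>V. x (h v)"])
  let ?k = "inv_into V h"
  have inv: "?k (h v) = v" if "v \<in> V" for v using inj that by simp
  show "bij_betw (\<lambda>x. \<lambda>v\<in>V. x (h v)) (embeddings n c (h ` V) (map_prod h h ` E)) (embeddings n c V E)"
  proof (rule bij_betwI[where g = "\<lambda>y. \<lambda>w\<in>h ` V. y (?k w)"])
    show "(\<lambda>x. \<lambda>v\<in>V. x (h v)) \<in> embeddings n c (h ` V) (map_prod h h ` E) \<rightarrow> embeddings n c V E"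
      using embeddings_pullback[of _ n c "h ` V" "map_prod h h ` E" h V E] inj E by blast
    have 1: "map_prod ?k ?k ` map_prod h h ` E \<subseteq> E"
      using E inv by (auto simp: subset_iff)
    have 2: "map_prod h h ` E \<subseteq> h ` V \<times> h ` V" using E by auto
    have 3: "inj_on ?k (h ` V)" "?k ` h ` V \<subseteq> V"
      using inv by (auto simp: inj_on_def)
    show "(\<lambda>y. \<lambda>w\<in>h ` V. y (?k w)) \<in> embeddings n c V E \<rightarrow> embeddings n c (h ` V) (map_prod h h ` E)"
      using embeddings_pullback[OF _ 3 2 1] by blast
  next
    fix x assume "x \<in> embeddings n c (h ` V) (map_prod h h ` E)"
    then have x: "x \<in> extensional (h ` V)" by (simp add: embeddings_iff)
    show "(\<lambda>w\<in>h ` V. (\<lambda>v\<in>V. x (h v)) (?k w)) = x"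
      by (rule extensionalityI[OF _ x]) (use inv in auto)
  next
    fix y assume "y \<in> embeddings n c V E"
    then have y: "y \<in> extensional V" by (simp add: embeddings_iff)
    show "(\<lambda>v\<in>V. (\<lambda>w\<in>h ` V. y (?k w)) (h v)) = y"
      by (rule extensionalityI[OF _ y]) (use inv in auto)
  qed
qed

section \<open>Counting families of distinct cycles\<close>

text \<open>
  A list \<open>js\<close> of cycle lengths is turned into an index set with one block of size \<open>js ! a\<close> for each
  position \<open>a\<close>, and \<open>rotation\<close> turns every block by one step. The solutions of the system given by
  its graph are the families of distinct cycles of lengths \<open>js\<close> with a marked point on each.
\<close>

definition cycle_index :: "nat list \<Rightarrow> (nat \<times> nat) set" where
  "cycle_index js = {(a, b). a < length js \<and> b < js ! a}"

definition rotation :: "nat list \<Rightarrow> nat \<times> nat \<Rightarrow> nat \<times> nat" where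
  "rotation js = (\<lambda>(a, b). (a, (b + 1) mod js ! a))"

abbreviation cycle_embeddings :: "nat \<Rightarrow> (nat \<Rightarrow> nat) \<Rightarrow> nat list \<Rightarrow> (nat \<times> nat \<Rightarrow> nat) set" where
  "cycle_embeddings n c js \<equiv>
     embeddings n c (cycle_index js) (graph_on (cycle_index js) (rotation js))"

lemma cycle_index_alt: "cycle_index js = (SIGMA a:{..<length js}. {..<js ! a})"
  by (auto simp: cycle_index_def)

lemma finite_cycle_index [simp]: "finite (cycle_index js)"
  by (simp add: cycle_index_alt)

lemma bij_betw_rotation: "bij_betw (rotation js) (cycle_index js) (cycle_index js)"
proof -
  have "inj_on (rotation js) (cycle_index js)"
    by (auto simp: rotation_def cycle_index_def inj_on_def mod_Suc split: if_splits)
  moreover have "rotation js ` cycle_index js \<subseteq> cycle_index js"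
    by (auto simp: rotation_def cycle_index_def)
  ultimately show ?thesis
    by (simp add: bij_betw_def endo_inj_surj)
qed

lemma cycle_embeddings_iff:
  "x \<in> cycle_embeddings n c js \<longleftrightarrow>
     x \<in> extensional (cycle_index js) \<and> x ` cycle_index js \<subseteq> {1..n} \<and> inj_on x (cycle_index js) \<and>
     (\<forall>a b. a < length js \<and> b < js ! a \<longrightarrow> c (x (a, b)) = x (a, (b + 1) mod js ! a))"
  unfolding embeddings_iff by (auto simp: cycle_index_def rotation_def image_iff)

lemma cycle_embedding_orbit:
  assumes "x \<in> cycle_embeddings n c js" "a < length js" "b < js ! a"
  shows "orbit c (x (a, b)) = (\<lambda>b. x (a, b)) ` {..<js ! a}" "card (orbit c (x (a, b))) = js ! a"
proof -
  show 1: "orbit c (x (a, b)) = (\<lambda>b. x (a, b)) ` {..<js ! a}"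
    using orbit_of_cycle[of "js ! a" c "\<lambda>b. x (a, b)" b] assms by (simp add: cycle_embeddings_iff)
  have "inj_on (\<lambda>b. x (a, b)) {..<js ! a}"
  proof (rule inj_onI)
    fix b b' assume "b \<in> {..<js ! a}" "b' \<in> {..<js ! a}" "x (a, b) = x (a, b')"
    moreover have "inj_on x (cycle_index js)" using assms(1) by (simp add: cycle_embeddings_iff)
    ultimately show "b = b'" using assms(2) by (auto dest!: inj_onD simp: cycle_index_def)
  qed
  with 1 show "card (orbit c (x (a, b))) = js ! a" by (simp add: card_image)
qed

lemma card_points_of_cycle_embedding:
  assumes "x \<in> cycle_embeddings n c js" "j > 0"
  shows "card (x ` cycle_index js \<inter> period_points n j c) = j * count_list js j"
proof -
  have eq: "x ` cycle_index js \<inter> period_points n j c =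
      x ` (SIGMA a:{a. a < length js \<and> js ! a = j}. {..<j})"
  proof -
    have "x (a, b) \<in> {1..n}" if "(a, b) \<in> cycle_index js" for a b
      using assms(1) that unfolding cycle_embeddings_iff by blast
    with cycle_embedding_orbit(2)[OF assms(1)] show ?thesis
      by (auto simp: period_points_def cycle_index_def)
  qed
  have "inj_on x (SIGMA a:{a. a < length js \<and> js ! a = j}. {..<j})"
  proof (rule inj_on_subset[of x "cycle_index js"])
    show "inj_on x (cycle_index js)" using assms(1) unfolding cycle_embeddings_iff by blast
  qed (auto simp: cycle_index_def)
  then have "card (x ` cycle_index js \<inter> period_points n j c) =
      card (SIGMA a:{a. a < length js \<and> js ! a = j}. {..<j})"
    unfolding eq by (rule card_image)
  also have "\<dots> = j * card {a. a < length js \<and> js ! a = j}" by simp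
  also have "card {a. a < length js \<and> js ! a = j} = count_list js j"
    by (simp add: count_list_eq_length_filter length_filter_conv_card eq_commute)
  finally show "card (x ` cycle_index js \<inter> period_points n j c) = j * count_list js j" .
qed

lemma cycle_embeddings_Nil: "cycle_embeddings n c [] = {\<lambda>_. undefined}"
  by (auto simp: embeddings_def cycle_index_def)

lemma cycle_index_snoc:
  "cycle_index (js @ [j]) = cycle_index js \<union> {length js} \<times> {..<j}"
  by (auto simp: cycle_index_def nth_append less_Suc_eq split: if_splits)

text \<open>
  One more cycle of length \<open>j\<close> is determined by its marked point, which may be any point on a cycle of
  length \<open>j\<close> that the family does not yet contain. The cycles chosen so far occupy
  \<open>j * count_list js j\<close> of these points, whichever they are; hence the count is multiplicative.
\<close>

lemma card_cycle_embeddings_snoc: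
  assumes c: "c permutes {1..n}" and j: "j > 0"
  shows "card (cycle_embeddings n c (js @ [j])) =
     card (cycle_embeddings n c js) * (card (period_points n j c) - j * count_list js j)"
proof -
  let ?m = "length js" and ?V = "cycle_index js" and ?W = "cycle_index (js @ [j])"
  let ?P = "period_points n j c"
  let ?S = "SIGMA x:cycle_embeddings n c js. ?P - x ` ?V"
  let ?g = "\<lambda>(x, u). \<lambda>(a, b)\<in>?W. if a < ?m then x (a, b) else (c ^^ b) u"
  have VW: "?V \<subseteq> ?W" "{?m} \<times> {..<j} \<subseteq> ?W" unfolding cycle_index_snoc by auto
  have m0: "(?m, 0) \<in> ?W" "(?m, 0) \<notin> ?V" using j by (auto simp: cycle_index_def)
  have pw: "y (?m, b) = (c ^^ b) (y (?m, 0))" if y: "y \<in> cycle_embeddings n c (js @ [j])" and "b < j" for y b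
    using that(2)
  proof (induction b)
    case (Suc b)
    have H: "\<forall>a b. a < length (js @ [j]) \<and> b < (js @ [j]) ! a \<longrightarrow>
        c (y (a, b)) = y (a, (b + 1) mod (js @ [j]) ! a)"
      using y unfolding cycle_embeddings_iff by blast
    have "c (y (?m, b)) = y (?m, Suc b mod j)"
      using H[rule_format, of ?m b] Suc.prems by simp
    with Suc show ?case by simp
  qed simp
  \<comment> \<open>The inverse map continues the marked point \<open>u\<close> along its cycle.\<close>
  have "bij_betw (\<lambda>y. (restrict y ?V, y (?m, 0))) (cycle_embeddings n c (js @ [j])) ?S"
  proof (rule bij_betwI[where g = ?g])
    show "(\<lambda>y. (restrict y ?V, y (?m, 0))) \<in> cycle_embeddings n c (js @ [j]) \<rightarrow> ?S"
    proof
      fix y assume y: "y \<in> cycle_embeddings n c (js @ [j])"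
      have yW: "y ` ?W \<subseteq> {1..n}" "inj_on y ?W" using y by (simp_all add: cycle_embeddings_iff)
      have "restrict y ?V \<in> cycle_embeddings n c js"
        unfolding cycle_embeddings_iff
      proof (intro conjI allI impI)
        show "restrict y ?V ` ?V \<subseteq> {1..n}" using yW VW by auto
        show "inj_on (restrict y ?V) ?V" by (simp only: inj_on_restrict_eq inj_on_subset[OF yW(2) VW(1)])
        fix a b assume ab: "a < length js \<and> b < js ! a"
        then have "(a, b) \<in> ?V" "(a, (b + 1) mod js ! a) \<in> ?V" by (auto simp: cycle_index_def)
        moreover have "c (y (a, b)) = y (a, (b + 1) mod js ! a)"
          using y ab unfolding cycle_embeddings_iff by (auto simp: nth_append)
        ultimately show "c (restrict y ?V (a, b)) = restrict y ?V (a, (b + 1) mod js ! a)" by simp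
      qed simp
      moreover have "card (orbit c (y (?m, 0))) = j"
        using cycle_embedding_orbit(2)[OF y, of ?m 0] j by simp
      then have "y (?m, 0) \<in> ?P" using yW m0 by (auto simp: period_points_def)
      moreover have "y (?m, 0) \<notin> y ` ?V"
        using inj_on_image_mem_iff[OF yW(2) m0(1) VW(1)] m0(2) by simp
      ultimately show "(restrict y ?V, y (?m, 0)) \<in> ?S" by simp
    qed
    show "?g \<in> ?S \<rightarrow> cycle_embeddings n c (js @ [j])"
    proof (intro funcsetI, elim SigmaE, hypsubst)
      fix x u assume x: "x \<in> cycle_embeddings n c js" and u: "u \<in> ?P - x ` ?V"
      have uj: "card (orbit c u) = j" and un: "u \<in> {1..n}" using u by (auto simp: period_points_def)
      note fo = funpow_orbit[OF c uj]
      have disj: "(c ^^ b) u \<noteq> x (a', b')" if "(a', b') \<in> ?V" for b a' b'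
      proof
        assume eq: "(c ^^ b) u = x (a', b')"
        have "orbit c (x (a', b')) = orbit c u"
          using cyclic_on_orbit[OF c, of u] permutation_self_in_orbit[OF permutation_of_permutes[OF c], of u]
          unfolding eq[symmetric] by (intro orbit_cyclic_eq3) (auto intro: funpow_in_orbit)
        then have "u \<in> orbit c (x (a', b'))"
          using permutation_self_in_orbit[OF permutation_of_permutes[OF c], of u] by simp
        then have "u \<in> x ` ?V"
          using cycle_embedding_orbit(1)[OF x, of a' b'] that by (auto simp: cycle_index_def)
        then show False using u by simp
      qed
      show "?g (x, u) \<in> cycle_embeddings n c (js @ [j])"
        unfolding cycle_embeddings_iff
      proof (intro conjI allI impI)
        have "(c ^^ b) u \<in> {1..n}" for b
          using permutes_orbit_subset[OF c un] 
            funpow_in_orbit[OF permutation_self_in_orbit[OF permutation_of_permutes[OF c]]] by blast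
        moreover have "x ` ?V \<subseteq> {1..n}" using x by (simp add: cycle_embeddings_iff)
        ultimately show "?g (x, u) ` ?W \<subseteq> {1..n}"
          unfolding cycle_index_snoc by (auto simp: cycle_index_def)
        have "inj_on x ?V" using x by (simp add: cycle_embeddings_iff)
        then show "inj_on (?g (x, u)) ?W"
          using disj fo(2) disj[THEN not_sym] unfolding cycle_index_snoc
          by (auto simp: inj_on_def cycle_index_def)
        fix a b assume ab: "a < length (js @ [j]) \<and> b < (js @ [j]) ! a"
        then have "(a, b) \<in> ?W" "(a, (b + 1) mod (js @ [j]) ! a) \<in> ?W" by (auto simp: cycle_index_def)
        moreover have "c (x (a, b)) = x (a, (b + 1) mod js ! a)" if "a < ?m"
          using x ab that unfolding cycle_embeddings_iff by (auto simp: nth_append)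
        moreover have "c ((c ^^ b) u) = (c ^^ ((b + 1) mod j)) u" if "a = ?m"
        proof (cases "Suc b = j")
          case True
          then have "c ((c ^^ b) u) = (c ^^ j) u" by auto
          with True fo(1) show ?thesis by simp
        qed (use ab that in auto)
        ultimately show "c (?g (x, u) (a, b)) = ?g (x, u) (a, (b + 1) mod (js @ [j]) ! a)"
          using ab by (auto simp: nth_append less_Suc_eq)
      qed simp
    qed
  next
    fix y assume y: "y \<in> cycle_embeddings n c (js @ [j])"
    show "?g (restrict y ?V, y (?m, 0)) = y"
    proof (rule extensionalityI[where A = ?W])
      fix v assume "v \<in> ?W"
      then show "?g (restrict y ?V, y (?m, 0)) v = y v"
        using pw[OF y, symmetric] unfolding cycle_index_snoc by (auto simp: cycle_index_def)
    qed (use y in \<open>simp_all add: cycle_embeddings_iff\<close>)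
  next
    fix s assume "s \<in> ?S"
    then obtain x u where s: "s = (x, u)" and x: "x \<in> cycle_embeddings n c js" by auto
    have "restrict (?g (x, u)) ?V = x"
    proof (rule extensionalityI[where A = ?V])
      fix v assume "v \<in> ?V"
      then show "restrict (?g (x, u)) ?V v = x v"
        unfolding cycle_index_snoc by (auto simp: cycle_index_def)
    next
      show "x \<in> extensional ?V" using x unfolding cycle_embeddings_iff by blast
    qed (rule restrict_extensional)
    then show "(restrict (?g s) ?V, ?g s (?m, 0)) = s"
      unfolding s using m0 by (auto simp: cycle_index_def)
  qed
  then have "card (cycle_embeddings n c (js @ [j])) = card ?S" by (rule bij_betw_same_card)
  also have "\<dots> = (\<Sum>x\<in>cycle_embeddings n c js. card (?P - x ` ?V))"
    by (rule card_SigmaI) simp_all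
  also have "\<dots> = (\<Sum>x\<in>cycle_embeddings n c js. card ?P - j * count_list js j)"
  proof (rule sum.cong[OF refl])
    fix x assume "x \<in> cycle_embeddings n c js"
    then show "card (?P - x ` ?V) = card ?P - j * count_list js j"
      using card_points_of_cycle_embedding[of x n c js j] j by (simp add: card_Diff_subset_Int Int_commute)
  qed
  finally show ?thesis by simp
qed

lemma card_cycle_embeddings:
  assumes c: "c permutes {1..n}" and "set js \<subseteq> {1..l}"
  shows "card (cycle_embeddings n c js) =
    (\<Prod>j\<in>{1..l}. \<Prod>a<count_list js j. j * num_cycles n j c - j * a)"
  using assms(2)
proof (induction js rule: rev_induct)
  case Nil
  then show ?case by (simp add: cycle_embeddings_Nil)
next
  case (snoc j js)
  have "count_list (js @ [j]) i = (if i = j then Suc (count_list js i) else count_list js i)" for i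
    by simp
  then have "(\<Prod>i\<in>{1..l}. \<Prod>a<count_list (js @ [j]) i. i * num_cycles n i c - i * a) =
    (\<Prod>i\<in>{1..l}. (\<Prod>a<count_list js i. i * num_cycles n i c - i * a) *
       (if i = j then j * num_cycles n j c - j * count_list js j else 1))"
    by (intro prod.cong) auto
  also have "\<dots> = (\<Prod>i\<in>{1..l}. \<Prod>a<count_list js i. i * num_cycles n i c - i * a) *
      (j * num_cycles n j c - j * count_list js j)"
    using snoc.prems by (simp add: prod.distrib prod.delta)
  finally show ?case
    using snoc card_cycle_embeddings_snoc[OF c, of j js] by (simp add: card_period_points[OF c])
qed

lemma prod_falling_factorial: "(\<Prod>a<r. j * N - j * a) = j ^ r * (fact r * (N choose r))" for j N r :: nat
proof (induction r)
  case (Suc r)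
  have "(N choose r) * (N - r) = Suc r * (N choose Suc r)"
    using binomial_absorb_comp[of N r] binomial_absorption[of r "N"] by (simp add: mult.commute)
  have "j ^ r * (fact r * (N choose r)) * (j * (N - r)) =
      j ^ Suc r * (fact r * ((N choose r) * (N - r)))" by (simp only: power_Suc ac_simps)
  also have "\<dots> = j ^ Suc r * (fact (Suc r) * (N choose Suc r))"
    by (simp only: \<open>_ = Suc r * (N choose Suc r)\<close> fact_Suc of_nat_id ac_simps)
  finally have "j ^ r * (fact r * (N choose r)) * (j * (N - r)) =
      j ^ Suc r * (fact (Suc r) * (N choose Suc r))" .
  with Suc show ?case by (simp add: diff_mult_distrib2)
qed simp

lemma card_cycle_embeddings_binomial:
  assumes c: "c permutes {1..n}" and "set js \<subseteq> {1..l}"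
  shows "card (cycle_embeddings n c js) =
    (\<Prod>j\<in>{1..l}. j ^ count_list js j * (fact (count_list js j) * (num_cycles n j c choose count_list js j)))"
  by (simp add: card_cycle_embeddings[OF assms] prod_falling_factorial)

lemma card_cycle_embeddings_le:
  assumes c: "c permutes {1..n}" and "0 \<notin> set js"
  shows "card (cycle_embeddings n c js) \<le> n ^ length js"
  using assms(2)
proof (induction js rule: rev_induct)
  case Nil
  then show ?case by (simp add: cycle_embeddings_Nil)
next
  case (snoc j js)
  then show ?case
    using card_cycle_embeddings_snoc[OF c, of j js] card_period_points_le[of n j c]
    by (auto simp: mult.commute intro!: mult_mono)
qed

section \<open>Exchanging cycle structures in permutations with restricted cycle lengths\<close>

lemma finite_perms_with_cycles [simp]: "finite (perms_with_cycles n A)"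
  by (rule finite_subset[OF _ finite_permutations[of "{1..n}"]]) (auto simp: perms_with_cycles_def)

lemma perms_with_cyclesD:
  assumes "c \<in> perms_with_cycles n A"
  shows "c permutes {1..n}" "u \<in> {1..n} \<Longrightarrow> card (orbit c u) \<in> A"
  using assms by (auto simp: perms_with_cycles_def cycles_of_perm_def)

text \<open>
  Suppose that \<open>c\<close> acts on the image of \<open>x\<close> by some permutation \<open>\<pi>\<close> of the indices. Leaving \<open>c\<close> alone elsewhere and
  letting it act on the image by the rotation instead keeps the other cycles and creates
  only cycles whose lengths are listed in \<open>js\<close>.
\<close>

lemma exchange_cycles:
  fixes js :: "nat list"
  defines "V \<equiv> cycle_index js"
  assumes c: "c \<in> perms_with_cycles n A" and js: "set js \<subseteq> A" and \<pi>: "bij_betw \<pi> V V"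
    and x: "x \<in> embeddings n c V (graph_on V \<pi>)"
  defines "c' \<equiv> \<lambda>u. if u \<in> x ` V then x (rotation js (inv_into V x u)) else c u"
  shows "c' \<in> perms_with_cycles n A" "x \<in> cycle_embeddings n c' js"
proof -
  let ?X = "x ` V"
  note cp = perms_with_cyclesD[OF c]
  have xV: "?X \<subseteq> {1..n}" "inj_on x V" and cx: "\<And>v. v \<in> V \<Longrightarrow> c (x v) = x (\<pi> v)"
    using x unfolding embeddings_graph_iff by blast+
  have rot: "bij_betw (rotation js) V V" unfolding V_def by (rule bij_betw_rotation)
  have c'x: "c' (x v) = x (rotation js v)" if "v \<in> V" for v
    using that xV(2) by (simp add: c'_def)
  have xb: "bij_betw x V ?X" using xV(2) by (simp add: bij_betw_def)
  have "c ` ?X = ?X"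
    using cx \<pi> unfolding bij_betw_def by (metis (no_types, lifting) image_cong image_image)
  then have cX: "bij_betw c ?X ?X"
    using permutes_inj[OF cp(1)] by (auto simp: bij_betw_def inj_on_def inj_def)
  have "bij_betw c ({1..n} - ?X) ({1..n} - ?X)"
    by (rule bij_betw_DiffI[OF permutes_imp_bij[OF cp(1)] cX xV(1) xV(1)])
  then have b1: "bij_betw c' ({1..n} - ?X) ({1..n} - ?X)"
    by (rule bij_betw_cong[THEN iffD1, rotated]) (simp add: c'_def)
  have "c' ` ?X = x ` rotation js ` V" using c'x by (auto simp: image_image)
  then have im: "c' ` ?X = ?X" using rot by (simp add: bij_betw_def)
  then have b2: "bij_betw c' ?X ?X"
    using eq_card_imp_inj_on[of ?X c'] by (simp add: V_def bij_betw_def)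
  have "bij_betw c' (({1..n} - ?X) \<union> ?X) (({1..n} - ?X) \<union> ?X)"
    by (rule bij_betw_combine[OF b1 b2]) auto
  moreover have "({1..n} - ?X) \<union> ?X = {1..n}" using xV(1) by blast
  ultimately have "bij_betw c' {1..n} {1..n}" by simp
  moreover have "c' u = u" if "u \<notin> {1..n}" for u
    using that xV(1) cp(1) by (auto simp: c'_def permutes_def)
  ultimately have c'p: "c' permutes {1..n}" by (rule bij_imp_permutes)
  show x': "x \<in> cycle_embeddings n c' js"
    using x c'x unfolding V_def embeddings_iff by auto
  have "card (orbit c' u) \<in> A" if u: "u \<in> {1..n}" for u
  proof (cases "u \<in> ?X")
    case True
    then show ?thesis
      using cycle_embedding_orbit(2)[OF x'] js by (auto simp: V_def cycle_index_def)
  next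
    case False
    have "orbit c u = orbit c' u"
    proof (rule orbit_cong0)
      show "c \<in> {1..n} - ?X \<rightarrow> {1..n} - ?X"
        using \<open>bij_betw c ({1..n} - ?X) ({1..n} - ?X)\<close> by (auto simp: bij_betw_def)
    qed (use u False in \<open>auto simp: c'_def\<close>)
    with cp(2)[OF u] show ?thesis by simp
  qed
  with c'p show "c' \<in> perms_with_cycles n A"
    by (auto simp: perms_with_cycles_def cycles_of_perm_def)
qed

text \<open>
  Given the new permutation and \<open>x\<close>, the old one is recovered from \<open>\<pi>\<close>; so the exchange
  is injective on pairs.
\<close>

lemma sum_embeddings_exchange:
  fixes js :: "nat list"
  defines "V \<equiv> cycle_index js"
  assumes js: "set js \<subseteq> A" and \<pi>: "bij_betw \<pi> V V"
  shows "(\<Sum>c\<in>perms_with_cycles n A. card (embeddings n c V (graph_on V \<pi>)))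
    \<le> (\<Sum>c\<in>perms_with_cycles n A. card (cycle_embeddings n c js))"
proof -
  let ?S = "SIGMA c:perms_with_cycles n A. embeddings n c V (graph_on V \<pi>)"
  let ?T = "SIGMA c:perms_with_cycles n A. cycle_embeddings n c js"
  define ex where "ex = (\<lambda>(c :: nat \<Rightarrow> nat, x).
     (\<lambda>u. if u \<in> x ` V then x (rotation js (inv_into V x u)) else c u, x))"
  have [simp]: "finite V" by (simp add: V_def)
  have "card ?S \<le> card ?T"
  proof (rule card_inj_on_le[of ex])
    show "inj_on ex ?S"
    proof (rule inj_onI)
      fix s t assume s: "s \<in> ?S" and t: "t \<in> ?S" and eq: "ex s = ex t"
      obtain c x where sc: "s = (c, x)" "x \<in> embeddings n c V (graph_on V \<pi>)" using s by auto
      obtain d where td: "t = (d, x)" "x \<in> embeddings n d V (graph_on V \<pi>)"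
        using t eq sc by (auto simp: ex_def)
      have "c u = d u" for u
      proof (cases "u \<in> x ` V")
        case True
        with sc(2) td(2) show ?thesis unfolding embeddings_graph_iff by auto
      next
        case False
        with eq sc(1) td(1) show ?thesis by (auto simp: ex_def dest!: fun_cong[of _ _ u])
      qed
      then show "s = t" using sc td by auto
    qed
    show "ex ` ?S \<subseteq> ?T"
      using exchange_cycles[OF _ js \<pi>[unfolded V_def]] unfolding ex_def V_def by auto
  qed (auto intro!: finite_SigmaI)
  then show ?thesis by (simp add: card_SigmaI)
qed

lemma count_list_replicate: "count_list (replicate m x) y = (if x = y then m else 0)"
  by (induction m) auto

lemma card_fixed_embeddings:
  assumes c: "c permutes {1..n}" and V: "finite V"
  shows "card (embeddings n c V (graph_on V (\<lambda>v. v))) = fact (card V) * (num_cycles n 1 c choose card V)"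
proof -
  define m where "m = card V"
  let ?W = "cycle_index (replicate m 1)"
  have "card V = card ?W" by (simp add: cycle_index_alt m_def)
  then obtain h where h: "bij_betw h V ?W"
    using finite_same_card_bij[of V ?W] V by auto
  then have inj: "inj_on h V" and im: "h ` V = ?W" by (auto simp: bij_betw_def)
  have "map_prod h h ` graph_on V (\<lambda>v. v) = graph_on (h ` V) (\<lambda>v. v)"
    unfolding map_prod_graph_on by (simp only: image_image)
  also have "\<dots> = graph_on ?W (rotation (replicate m 1))"
    unfolding im by (rule image_cong) (auto simp: rotation_def cycle_index_def)
  finally have gr: "map_prod h h ` graph_on V (\<lambda>v. v) = graph_on ?W (rotation (replicate m 1))" .
  have "graph_on V (\<lambda>v. v) \<subseteq> V \<times> V" by auto
  from card_embeddings_reindex[OF inj this]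
  have "card (embeddings n c V (graph_on V (\<lambda>v. v))) = card (cycle_embeddings n c (replicate m 1))"
    unfolding im gr by (rule sym)
  then show ?thesis
    using card_cycle_embeddings_binomial[OF c, of "replicate m 1" 1]
    by (simp add: count_list_replicate set_replicate_conv_if m_def)
qed

text \<open>
  The \<open>q * d\<close> fixed points are closed up to \<open>q\<close> cycles of length \<open>d\<close>, for which there are at most
  \<open>n ^ q\<close> choices of marked points. The left-hand side is a factorial moment of order \<open>q * d\<close>.
\<close>

lemma sum_fixed_points_le:
  assumes d: "d \<in> A" "d \<noteq> 0"
  shows "(\<Sum>c\<in>perms_with_cycles n A. fact (q * d) * (num_cycles n 1 c choose (q * d)))
    \<le> n ^ q * card (perms_with_cycles n A)"
proof -
  let ?V = "cycle_index (replicate q d)"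
  have "(\<Sum>c\<in>perms_with_cycles n A. fact (q * d) * (num_cycles n 1 c choose (q * d)))
      = (\<Sum>c\<in>perms_with_cycles n A. card (embeddings n c ?V (graph_on ?V (\<lambda>v. v))))"
    by (intro sum.cong refl, subst card_fixed_embeddings)
       (auto simp: cycle_index_alt dest: perms_with_cyclesD(1))
  also have "\<dots> \<le> (\<Sum>c\<in>perms_with_cycles n A. card (cycle_embeddings n c (replicate q d)))"
    by (rule sum_embeddings_exchange) (use d in \<open>auto simp: bij_betw_def\<close>)
  also have "\<dots> \<le> (\<Sum>c\<in>perms_with_cycles n A. n ^ q)"
  proof (rule sum_mono)
    fix c assume "c \<in> perms_with_cycles n A"
    from card_cycle_embeddings_le[OF perms_with_cyclesD(1)[OF this], of "replicate q d"]
    show "card (cycle_embeddings n c (replicate q d)) \<le> n ^ q" using d by simp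
  qed
  finally show ?thesis by (simp add: mult.commute)
qed

text \<open>
  Here \<open>d\<close> marked cycles of length 2 become two cycles of length \<open>d\<close>: the first points form one of them
  and the second points the other. This works for even and odd \<open>d\<close> alike.
\<close>

lemma sum_two_cycles_le:
  assumes d: "d \<in> A" "d \<noteq> 0"
  shows "(\<Sum>c\<in>perms_with_cycles n A. 2 ^ d * (fact d * (num_cycles n 2 c choose d)))
    \<le> n\<^sup>2 * card (perms_with_cycles n A)"
proof -
  let ?V = "cycle_index (replicate 2 d)" and ?W = "cycle_index (replicate d 2)"
  \<comment> \<open>\<open>?V\<close> consists of two blocks of size \<open>d\<close>; exchanging the blocks has \<open>d\<close> orbits of size 2.\<close>
  let ?\<pi> = "\<lambda>(a :: nat, b :: nat). (1 - a, b)" and ?h = "\<lambda>(a :: nat, b :: nat). (b, a)"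
  have inj: "inj_on ?h ?V" by (auto simp: inj_on_def)
  have im: "?h ` ?V = ?W" by (force simp: cycle_index_def)
  have "map_prod ?h ?h ` graph_on ?V ?\<pi> = (\<lambda>v. (?h v, ?h (?\<pi> v))) ` ?V"
    by (rule map_prod_graph_on)
  also have "\<dots> = (\<lambda>v. (?h v, rotation (replicate d 2) (?h v))) ` ?V"
    by (rule image_cong) (auto simp: rotation_def cycle_index_def less_2_cases_iff)
  also have "\<dots> = graph_on ?W (rotation (replicate d 2))"
    unfolding im[symmetric] by (simp only: image_image)
  finally have gr: "map_prod ?h ?h ` graph_on ?V ?\<pi> = graph_on ?W (rotation (replicate d 2))" .
  have "graph_on ?V ?\<pi> \<subseteq> ?V \<times> ?V" by (auto simp: cycle_index_def)
  from card_embeddings_reindex[OF inj this]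
  have *: "card (embeddings n c ?V (graph_on ?V ?\<pi>)) =
      card (cycle_embeddings n c (replicate d 2))" for c
    unfolding im gr by (rule sym)
  have "(\<Sum>c\<in>perms_with_cycles n A. 2 ^ d * (fact d * (num_cycles n 2 c choose d)))
      = (\<Sum>c\<in>perms_with_cycles n A. card (cycle_embeddings n c (replicate d 2)))"
  proof (intro sum.cong refl)
    fix c assume "c \<in> perms_with_cycles n A"
    from card_cycle_embeddings_binomial[OF perms_with_cyclesD(1)[OF this], of "replicate d 2" 2]
    show "2 ^ d * (fact d * (num_cycles n 2 c choose d)) = card (cycle_embeddings n c (replicate d 2))"
      by (simp add: count_list_replicate set_replicate_conv_if numeral_2_eq_2)
  qed
  also have "\<dots> = (\<Sum>c\<in>perms_with_cycles n A. card (embeddings n c ?V (graph_on ?V ?\<pi>)))"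
    by (simp only: *)
  also have "\<dots> \<le> (\<Sum>c\<in>perms_with_cycles n A. card (cycle_embeddings n c (replicate 2 d)))"
  proof (rule sum_embeddings_exchange)
    show "bij_betw ?\<pi> ?V ?V"
      by (rule bij_betwI[where g = ?\<pi>]) (auto simp: cycle_index_def less_2_cases_iff)
  qed (use d in auto)
  also have "\<dots> \<le> (\<Sum>c\<in>perms_with_cycles n A. n\<^sup>2)"
  proof (rule sum_mono)
    fix c assume "c \<in> perms_with_cycles n A"
    from card_cycle_embeddings_le[OF perms_with_cyclesD(1)[OF this], of "replicate 2 d"]
    show "card (cycle_embeddings n c (replicate 2 d)) \<le> n\<^sup>2" using d by simp
  qed
  finally show ?thesis by (simp add: mult.commute)
qed

section \<open>Bounds for the number of solutions\<close>

text \<open>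
  Only such systems are solvable, because permutations are injective functions and the unknowns
  take distinct values. The graph of a partial injection is a disjoint union of paths and cycles.
\<close>

definition partial_injections :: "'v set \<Rightarrow> ('v \<times> 'v) set set" where
  "partial_injections V = {E. E \<subseteq> V \<times> V \<and> single_valued E \<and> single_valued (E\<inverse>)}"

definition loops :: "('v \<times> 'v) set \<Rightarrow> 'v set" where
  "loops E = {v. (v, v) \<in> E}"

lemma finite_partial_injections [simp]: "finite V \<Longrightarrow> finite (partial_injections V)"
  by (rule finite_subset[of _ "Pow (V \<times> V)"]) (auto simp: partial_injections_def)

lemma partial_injectionsD:
  assumes "E \<in> partial_injections V"
  shows "E \<subseteq> V \<times> V" "\<And>u v w. (u, v) \<in> E \<Longrightarrow> (u, w) \<in> E \<Longrightarrow> v = w"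
    "\<And>u v w. (u, w) \<in> E \<Longrightarrow> (v, w) \<in> E \<Longrightarrow> u = v"
  using assms by (auto simp: partial_injections_def single_valued_def)

lemma partial_injections_remove:
  assumes "E \<in> partial_injections V"
  shows "E \<inter> (V - R) \<times> (V - R) \<in> partial_injections (V - R)"
  using partial_injectionsD[OF assms] unfolding partial_injections_def single_valued_def by blast

text \<open>
  Unknowns that are determined by the remaining ones and by an additional datum \<open>f x\<close> can be
  eliminated, at the cost of a factor for the possible values of the datum.
\<close>

lemma card_embeddings_remove:
  assumes V: "finite V" and E: "E \<subseteq> V \<times> V" and S: "finite S"
    and f: "\<And>x. x \<in> embeddings n c V E \<Longrightarrow> f x \<in> S"
    and det: "\<And>x y. x \<in> embeddings n c V E \<Longrightarrow> y \<in> embeddings n c V E \<Longrightarrow> f x = f y \<Longrightarrow>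
       (\<And>v. v \<in> V - R \<Longrightarrow> x v = y v) \<Longrightarrow> \<forall>v\<in>R. x v = y v"
  shows "card (embeddings n c V E) \<le>
    card S * card (embeddings n c (V - R) (E \<inter> (V - R) \<times> (V - R)))"
proof -
  let ?E' = "E \<inter> (V - R) \<times> (V - R)"
  let ?g = "\<lambda>x. (f x, \<lambda>v\<in>V - R. x v)"
  have "card (embeddings n c V E) \<le> card (S \<times> embeddings n c (V - R) ?E')"
  proof (rule card_inj_on_le[of ?g])
    show "inj_on ?g (embeddings n c V E)"
    proof (rule inj_onI)
      fix x y assume xy: "x \<in> embeddings n c V E" "y \<in> embeddings n c V E" and eq: "?g x = ?g y"
      have res: "restrict x (V - R) = restrict y (V - R)" using eq by simp
      have 1: "x v = y v" if "v \<in> V - R" for v using fun_cong[OF res, of v] that by simp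
      with det[OF xy] eq have "\<forall>v\<in>R. x v = y v" by simp
      with 1 show "x = y"
        using xy by (intro extensionalityI[of x V y]) (auto simp: embeddings_iff)
    qed
    show "?g ` embeddings n c V E \<subseteq> S \<times> embeddings n c (V - R) ?E'"
      using f embeddings_pullback[of _ n c V E "\<lambda>v. v" "V - R" ?E']
      by (auto simp: image_subset_iff)
    show "finite (S \<times> embeddings n c (V - R) ?E')" using V S by simp
  qed
  then show ?thesis by (simp add: card_cartesian_product)
qed

text \<open>
  The bookkeeping common to all elimination steps below: \<open>p\<close> counts edges, and \<open>k\<close> is the number of edges
  lost in the step.
\<close>

lemma power_weighted_bound:
  fixes s T T' K B :: real
  assumes "T \<le> K * T'" "T' * s ^ p' \<le> B" "p \<le> p' + k" "s \<ge> 1" "K \<ge> 0" "T' \<ge> 0"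
  shows "T * s ^ p \<le> K * B * s ^ k"
proof -
  have "T * s ^ p \<le> (K * T') * s ^ p" using assms by (intro mult_right_mono) auto
  also have "\<dots> \<le> (K * T') * s ^ (p' + k)"
    using assms by (intro mult_left_mono power_increasing) auto
  also have "\<dots> = K * (T' * s ^ p') * s ^ k" by (simp add: power_add)
  also have "\<dots> \<le> K * B * s ^ k"
    using assms by (intro mult_right_mono mult_left_mono) auto
  finally show ?thesis .
qed

lemma card_doubleton_le: "card {a, b} \<le> 2"
  by (simp add: card_insert_if)

lemma card_edges_remove_target:
  assumes V: "finite V" and E: "E \<in> partial_injections V" and uv: "(u, v) \<in> E"
  shows "card E \<le> card (E \<inter> (V - {v}) \<times> (V - {v})) + 2"
    and "v \<notin> Domain E \<Longrightarrow> card E \<le> card (E \<inter> (V - {v}) \<times> (V - {v})) + 1"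
proof -
  note pi = partial_injectionsD[OF E]
  let ?E' = "E \<inter> (V - {v}) \<times> (V - {v})"
  have fin: "finite ?E'" using finite_subset[OF pi(1)] V by auto
  show "card E \<le> card ?E' + 2"
  proof (cases "v \<in> Domain E")
    case True
    then obtain w where "(v, w) \<in> E" by auto
    then have "E \<subseteq> ?E' \<union> {(u, v), (v, w)}" using pi uv by blast
    then have "card E \<le> card (?E' \<union> {(u, v), (v, w)})" using fin by (intro card_mono) auto
    also have "\<dots> \<le> card ?E' + card {(u, v), (v, w)}" by (rule card_Un_le)
    also have "card {(u, v), (v, w)} \<le> 2" by (rule card_doubleton_le)
    finally show ?thesis by simp
  next
    case False
    then have "E \<subseteq> ?E' \<union> {(u, v)}" using pi uv by blast
    then have "card E \<le> card (?E' \<union> {(u, v)})" using fin by (intro card_mono) auto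
    also have "\<dots> \<le> card ?E' + card {(u, v)}" by (rule card_Un_le)
    finally show ?thesis by simp
  qed
  assume "v \<notin> Domain E"
  then have "E \<subseteq> ?E' \<union> {(u, v)}" using pi uv by blast
  then have "card E \<le> card (?E' \<union> {(u, v)})" using fin by (intro card_mono) auto
  also have "\<dots> \<le> card ?E' + card {(u, v)}" by (rule card_Un_le)
  finally show "card E \<le> card ?E' + 1" by simp
qed

lemma card_embeddings_remove_target:
  assumes V: "finite V" and E: "E \<subseteq> V \<times> V" and uv: "(u, v) \<in> E" "u \<noteq> v"
  shows "card (embeddings n c V E) \<le> card (embeddings n c (V - {v}) (E \<inter> (V - {v}) \<times> (V - {v})))"
proof -
  have "card (embeddings n c V E) \<le>
      card {()} * card (embeddings n c (V - {v}) (E \<inter> (V - {v}) \<times> (V - {v})))"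
  proof (rule card_embeddings_remove[OF V E, where f = "\<lambda>_. ()"])
    fix x y assume "x \<in> embeddings n c V E" "y \<in> embeddings n c V E" "\<And>v'. v' \<in> V - {v} \<Longrightarrow> x v' = y v'"
    moreover have "u \<in> V - {v}" using uv E by auto
    ultimately show "\<forall>v\<in>{v}. x v = y v" using uv(1) unfolding embeddings_iff by (metis singletonD)
  qed auto
  then show ?thesis by simp
qed

text \<open>
  The unknowns are eliminated one at a time. The target \<open>v\<close> of an edge that is not a loop is determined by its
  source, and at most two edges disappear with \<open>v\<close>: one unknown, worth a factor \<open>n\<close>, pays for two edges, worth
  \<open>sqrt n\<close> each. An unknown with a loop has as many values as there are fixed points. It is isolated
  otherwise, and the loop is counted twice in the exponent, which makes the two sides agree. Negative exponents are avoided
  by writing the weights of the edges on the left-hand side.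
\<close>

lemma card_embeddings_bound:
  assumes n: "n \<ge> 1" and c: "c permutes {1..n}" and V: "finite V" and E: "E \<in> partial_injections V"
  shows "real (card (embeddings n c V E)) * sqrt n ^ (card E + card (loops E))
      \<le> real (num_cycles n 1 c) ^ card (loops E) * sqrt n ^ (2 * card V)"
  using V E
proof (induction "card V" arbitrary: V E)
  case 0
  then have "V = {}" "E = {}" by (auto simp: partial_injections_def)
  then show ?case by (simp add: embeddings_def loops_def)
next
  case (Suc m)
  define s where "s = sqrt n"
  have s1: "s \<ge> 1" and s2: "s ^ 2 = n" using n by (auto simp: s_def)
  note pi = partial_injectionsD[OF Suc.prems(2)]
  have finE: "finite E" using finite_subset[OF pi(1)] Suc.prems(1) by auto
  have finL: "finite (loops E)" by (rule finite_subset[of _ V]) (use pi(1) Suc.prems(1) in \<open>auto simp: loops_def\<close>)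
  have IH: "real (card (embeddings n c V' E')) * s ^ (card E' + card (loops E'))
      \<le> real (num_cycles n 1 c) ^ card (loops E') * s ^ (2 * card V')"
    if "V' = V - {v}" "E' = E \<inter> V' \<times> V'" "v \<in> V" for V' E' v
    using Suc.hyps(1)[of V' E'] Suc.hyps(2) Suc.prems partial_injections_remove[OF Suc.prems(2), of "{v}"] that
    unfolding s_def by (simp add: card_Diff_singleton)
  have card1: "s ^ (2 * card (V - {v})) * s\<^sup>2 = s ^ (2 * card V)" if "v \<in> V" for v
    using Suc.hyps(2) that by (simp add: card_Diff_singleton power2_eq_square flip: Suc.hyps(2))
  show ?case
  proof (cases "E = {}")
    case True
    have "real (card (embeddings n c V E)) \<le> real (n ^ card V)"
      using card_embeddings_le[OF Suc.prems(1)] by (simp only: of_nat_le_iff)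
    also have "\<dots> = s ^ (2 * card V)" by (simp add: power_mult s2)
    finally show ?thesis using True by (simp add: loops_def s_def)
  next
    case False
    show ?thesis
    proof (cases "loops E = {}")
      case False
      then obtain v where vv: "(v, v) \<in> E" by (auto simp: loops_def)
      then have vV: "v \<in> V" using pi by auto
      define V' where "V' = V - {v}"
      define E' where "E' = E \<inter> V' \<times> V'"
      have "card (embeddings n c V E) \<le> card (period_points n 1 c) * card (embeddings n c V' E')"
        unfolding E'_def V'_def
      proof (rule card_embeddings_remove[OF Suc.prems(1) pi(1), where f = "\<lambda>x. x v"])
        fix x assume "x \<in> embeddings n c V E"
        then have "c (x v) = x v" "x v \<in> {1..n}" using vv vV by (auto simp: embeddings_iff)
        then show "x v \<in> period_points n 1 c"
          using orbit_eq_singleton_iff[of c "x v"] by (simp add: period_points_def)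
      qed auto
      then have 1: "real (card (embeddings n c V E)) \<le>
          real (num_cycles n 1 c) * real (card (embeddings n c V' E'))"
        unfolding of_nat_mult[symmetric] of_nat_le_iff card_period_points[OF c] by simp
      have E_eq: "E = insert (v, v) E'" "(v, v) \<notin> E'" unfolding E'_def V'_def using pi vv by blast+
      have L_eq: "loops E = insert v (loops E')" "v \<notin> loops E'"
        using E_eq by (auto simp: loops_def E'_def V'_def)
      have cE: "card E = Suc (card E')" and cL: "card (loops E) = Suc (card (loops E'))"
        using E_eq L_eq finE finL by (auto simp del: insert_iff)
      have "real (card (embeddings n c V E)) * s ^ (card E + card (loops E)) \<le>
          real (num_cycles n 1 c) * (real (num_cycles n 1 c) ^ card (loops E') * s ^ (2 * card V')) * s ^ 2"
        by (rule power_weighted_bound[OF 1 IH[OF V'_def E'_def vV]]) (use cE cL s1 in auto)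
      also have "\<dots> = real (num_cycles n 1 c) ^ card (loops E) * s ^ (2 * card V)"
        using card1[OF vV] unfolding V'_def cL by (simp add: mult.assoc)
      finally show ?thesis by (simp add: s_def)
    next
      case True
      from \<open>E \<noteq> {}\<close> obtain u v where uv: "(u, v) \<in> E" by auto
      then have "u \<noteq> v" "v \<in> V" using True pi(1) by (auto simp: loops_def)
      define V' where "V' = V - {v}"
      define E' where "E' = E \<inter> V' \<times> V'"
      have L': "loops E' = {}" using True by (auto simp: loops_def E'_def)
      have 1: "real (card (embeddings n c V E)) \<le> 1 * real (card (embeddings n c V' E'))"
        using card_embeddings_remove_target[OF Suc.prems(1) pi(1) uv \<open>u \<noteq> v\<close>] by (simp add: E'_def V'_def)
      have "real (card (embeddings n c V E)) * s ^ (card E + card (loops E)) \<le>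
          1 * (real (num_cycles n 1 c) ^ card (loops E') * s ^ (2 * card V')) * s ^ 2"
        by (rule power_weighted_bound[OF 1 IH[OF V'_def E'_def \<open>v \<in> V\<close>]])
           (use card_edges_remove_target(1)[OF Suc.prems uv] True L' s1 in \<open>auto simp: E'_def V'_def\<close>)
      then show ?thesis using card1[OF \<open>v \<in> V\<close>] L' True by (simp add: s_def V'_def mult.assoc)
    qed
  qed
qed

text \<open>
  Without loops there is a gain over \<open>card_embeddings_bound\<close> at any edge \<open>(u, v)\<close>. If \<open>v\<close> ends a path, eliminating it
  removes just one edge. If \<open>v\<close> has a successor \<open>w\<close> other than \<open>u\<close>, then \<open>v\<close> and \<open>w\<close> are both determined
  by \<open>u\<close> and at most three edges disappear with two unknowns. In the remaining case \<open>u\<close> and \<open>v\<close> form a cycle of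
  length 2, and \<open>u\<close> is mapped into one of the cycles of length 2 of \<open>c\<close>. The summand \<open>1 / sqrt n\<close> covers the first two
  cases, the other summand the last one.
\<close>

lemma card_embeddings_gain:
  assumes n: "n \<ge> 1" and c: "c permutes {1..n}" and V: "finite V" and E: "E \<in> partial_injections V"
    and ne: "E \<noteq> {}" and nl: "loops E = {}"
  shows "real (card (embeddings n c V E)) * sqrt n ^ card E
      \<le> sqrt n ^ (2 * card V) * (1 / sqrt n + 2 * real (num_cycles n 2 c) / n)"
proof -
  define s where "s = sqrt n"
  have s1: "s \<ge> 1" and s2: "s ^ 2 = n" using n by (auto simp: s_def)
  note pi = partial_injectionsD[OF E]
  have finE: "finite E" using finite_subset[OF pi(1)] V by auto
  have bound: "real (card (embeddings n c (V - R) (E \<inter> (V - R) \<times> (V - R)))) * s ^ card (E \<inter> (V - R) \<times> (V - R))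
      \<le> s ^ (2 * card (V - R))" for R
  proof -
    have "loops (E \<inter> (V - R) \<times> (V - R)) = {}" using nl by (auto simp: loops_def)
    then show ?thesis
      using card_embeddings_bound[OF n c _ partial_injections_remove[OF E, of R]] V by (simp add: s_def)
  qed
  obtain u v where uv: "(u, v) \<in> E" using ne by auto
  have "u \<noteq> v" "u \<in> V" "v \<in> V" using uv nl pi(1) by (auto simp: loops_def)
  then have card2: "card V \<ge> 2" using card_mono[OF V, of "{u, v}"] by simp
  let ?t = "real (card (embeddings n c V E)) * s ^ card E"
  have A: "?t \<le> s ^ (2 * card V) * (1 / s)" if "?t \<le> s ^ (2 * card V - 1)"
    using that s1 card2 by (simp add: power_diff)
  have "?t \<le> s ^ (2 * card V) * (1 / s) \<or> ?t \<le> s ^ (2 * card V) * (2 * real (num_cycles n 2 c) / s\<^sup>2)"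
  proof (cases "v \<in> Domain E")
    case False
    have 1: "real (card (embeddings n c V E)) \<le>
        1 * real (card (embeddings n c (V - {v}) (E \<inter> (V - {v}) \<times> (V - {v}))))"
      using card_embeddings_remove_target[OF V pi(1) uv \<open>u \<noteq> v\<close>] by simp
    have "?t \<le> 1 * s ^ (2 * card (V - {v})) * s ^ 1"
      by (rule power_weighted_bound[OF 1 bound])
         (use card_edges_remove_target(2)[OF V E uv False] s1 in auto)
    also have "\<dots> = s ^ (2 * card (V - {v}) + 1)" by simp
    also have "2 * card (V - {v}) + 1 = 2 * card V - 1"
      using \<open>v \<in> V\<close> V card2 by (simp add: card_Diff_singleton)
    finally show ?thesis using A by blast
  next
    case True
    then obtain w where vw: "(v, w) \<in> E" by auto
    then have "v \<noteq> w" "w \<in> V" using nl pi(1) by (auto simp: loops_def)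
    show ?thesis
    proof (cases "w = u")
      case False
      define R where "R = {v, w}"
      define E' where "E' = E \<inter> (V - R) \<times> (V - R)"
      have finE': "finite E'" unfolding E'_def using finE by simp
      have cV: "card (V - R) = card V - 2"
        using \<open>v \<noteq> w\<close> \<open>v \<in> V\<close> \<open>w \<in> V\<close> V by (simp add: R_def card_Diff_subset)
      have cV3: "card V \<ge> 3" using card_mono[OF V, of "{u, v, w}"] False \<open>u \<in> V\<close> \<open>v \<in> V\<close> \<open>w \<in> V\<close> \<open>u \<noteq> v\<close> \<open>v \<noteq> w\<close> by simp
      have "card (embeddings n c V E) \<le> card {()} * card (embeddings n c (V - R) E')"
        unfolding E'_def
      proof (rule card_embeddings_remove[OF V pi(1), where f = "\<lambda>_. ()"])
        fix x y assume xy: "x \<in> embeddings n c V E" "y \<in> embeddings n c V E" "\<And>v'. v' \<in> V - R \<Longrightarrow> x v' = y v'"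
        then have "x u = y u" using \<open>u \<in> V\<close> \<open>u \<noteq> v\<close> False by (simp add: R_def)
        then have "x v = y v" using xy uv unfolding embeddings_iff by metis
        moreover from this have "x w = y w" using xy vw unfolding embeddings_iff by metis
        ultimately show "\<forall>v\<in>R. x v = y v" by (simp add: R_def)
      qed auto
      then have 1: "real (card (embeddings n c V E)) \<le> 1 * real (card (embeddings n c (V - R) E'))" by simp
      have "card E \<le> card E' + 3"
      proof -
        note F = pi(2)[OF _ vw] pi(3)[OF _ uv] pi(3)[OF _ vw] subsetD[OF pi(1)]
        obtain Q where Q: "E \<subseteq> E' \<union> {(u, v), (v, w)} \<union> Q" "card Q \<le> 1" "finite Q"
        proof (cases "w \<in> Domain E")
          case True
          then obtain z where "(w, z) \<in> E" by auto
          note F' = pi(2)[OF _ this]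
          have "E \<subseteq> E' \<union> {(u, v), (v, w)} \<union> {(w, z)}"
            unfolding E'_def R_def by (intro subrelI) (auto dest: F F')
          then show ?thesis by (rule that) auto
        next
          case False
          then have "E \<subseteq> E' \<union> {(u, v), (v, w)} \<union> {}"
            unfolding E'_def R_def by (intro subrelI) (auto dest: F)
          then show ?thesis by (rule that) auto
        qed
        have "card E \<le> card (E' \<union> {(u, v), (v, w)} \<union> Q)" using Q finE' by (intro card_mono) auto
        also have "\<dots> \<le> card E' + card {(u, v), (v, w)} + card Q"
          using card_Un_le[of "E' \<union> {(u, v), (v, w)}" Q] card_Un_le[of E' "{(u, v), (v, w)}"] by linarith
        also have "card {(u, v), (v, w)} \<le> 2" by (rule card_doubleton_le)
        finally show ?thesis using Q by simp
      qed
      then have "?t \<le> 1 * s ^ (2 * card (V - R)) * s ^ 3"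
        using power_weighted_bound[OF 1 bound[of R, folded E'_def], of "card E" 3] s1 by auto
      also have "\<dots> = s ^ (2 * card (V - R) + 3)" by (simp add: power_add)
      also have "2 * card (V - R) + 3 = 2 * card V - 1" using cV cV3 by simp
      finally show ?thesis using A by blast
    next
      case True
      define R where "R = {u, v}"
      define E' where "E' = E \<inter> (V - R) \<times> (V - R)"
      have finE': "finite E'" unfolding E'_def using finE by simp
      have vu: "(v, u) \<in> E" using vw True by simp
      have cV: "card (V - R) = card V - 2"
        using \<open>u \<noteq> v\<close> \<open>v \<in> V\<close> \<open>u \<in> V\<close> V by (simp add: R_def card_Diff_subset)
      have "card (embeddings n c V E) \<le> card (period_points n 2 c) * card (embeddings n c (V - R) E')"
        unfolding E'_def
      proof (rule card_embeddings_remove[OF V pi(1), where f = "\<lambda>x. x u"])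
        fix x assume x: "x \<in> embeddings n c V E"
        then have e: "c (x u) = x v" "c (x v) = x u" "x u \<in> {1..n}" "x u \<noteq> x v"
          using uv vu \<open>u \<in> V\<close> \<open>v \<in> V\<close> \<open>u \<noteq> v\<close> by (auto simp: embeddings_iff inj_on_def)
        define y where "y = (\<lambda>b::nat. if b = 0 then x u else x v)"
        have "orbit c (y 0) = y ` {..<2}"
          by (rule orbit_of_cycle) (use e in \<open>auto simp: less_2_cases_iff y_def\<close>)
        then have "orbit c (x u) = y ` {..<2}" by (simp add: y_def)
        also have "\<dots> = {x u, x v}" by (auto simp: lessThan_Suc numeral_2_eq_2 y_def)
        finally show "x u \<in> period_points n 2 c" using e by (simp add: period_points_def)
      next
        fix x y assume "x \<in> embeddings n c V E" "y \<in> embeddings n c V E" and u: "x u = y u"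
        then have "x v = y v" using uv unfolding embeddings_iff by metis
        with u show "\<forall>v\<in>R. x v = y v" by (simp add: R_def)
      qed auto
      then have "real (card (embeddings n c V E)) \<le>
          real (2 * num_cycles n 2 c * card (embeddings n c (V - R) E'))"
        unfolding card_period_points[OF c] by (simp only: of_nat_le_iff)
      then have 1: "real (card (embeddings n c V E)) \<le>
          (2 * real (num_cycles n 2 c)) * real (card (embeddings n c (V - R) E'))"
        by simp
      note F = pi(2)[OF _ vu] pi(3)[OF _ uv] pi(3)[OF _ vu] pi(2)[OF _ uv] subsetD[OF pi(1)]
      have "E \<subseteq> E' \<union> {(u, v), (v, u)}"
        unfolding E'_def R_def by (intro subrelI) (auto dest: F)
      then have "card E \<le> card (E' \<union> {(u, v), (v, u)})" using finE' by (intro card_mono) auto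
      also have "\<dots> \<le> card E' + card {(u, v), (v, u)}" by (rule card_Un_le)
      also have "card {(u, v), (v, u)} \<le> 2" by (rule card_doubleton_le)
      finally have "card E \<le> card E' + 2" by simp
      then have "?t \<le> (2 * real (num_cycles n 2 c)) * s ^ (2 * card (V - R)) * s ^ 2"
        using power_weighted_bound[OF 1 bound[of R, folded E'_def], of "card E" 2] s1 by auto
      also have "\<dots> = 2 * real (num_cycles n 2 c) * s ^ (2 * card (V - R) + 2)" by (simp only: power_add mult.assoc)
      also have "2 * card (V - R) + 2 = 2 * card V - 2" using cV card2 by simp
      also have "s ^ (2 * card V - 2) = s ^ (2 * card V) / s\<^sup>2"
        using s1 card2 by (intro power_diff) auto
      finally show ?thesis by (simp add: field_simps)
    qed
  qed
  moreover have "0 \<le> s ^ (2 * card V) * (1 / s)" "0 \<le> s ^ (2 * card V) * (2 * real (num_cycles n 2 c) / s\<^sup>2)"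
    using s1 by auto
  ultimately have "?t \<le> s ^ (2 * card V) * (1 / s) + s ^ (2 * card V) * (2 * real (num_cycles n 2 c) / s\<^sup>2)"
    by linarith
  then show ?thesis unfolding distrib_left[symmetric] s2 by (simp add: s_def)
qed

section \<open>Averaging over conjugates\<close>

text \<open>
  One solution \<open>g0\<close> exists because the prescribed partial map is injective; the others differ from it by a
  permutation that fixes the points \<open>p i\<close>.
\<close>

lemma card_permutes_extending:
  assumes I: "finite I" and p: "\<And>i. i \<in> I \<Longrightarrow> p i \<in> {1..n}" and q: "\<And>i. i \<in> I \<Longrightarrow> q i \<in> {1..n}"
    and ker: "\<And>i j. i \<in> I \<Longrightarrow> j \<in> I \<Longrightarrow> p i = p j \<longleftrightarrow> q i = q j"
  shows "card {g. g permutes {1..n::nat} \<and> (\<forall>i\<in>I. g (p i) = q i)} = fact (n - card (p ` I))"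
proof -
  let ?U = "p ` I" and ?W = "q ` I"
  define f where "f = (\<lambda>u. q (inv_into I p u))"
  have fp: "f (p i) = q i" if "i \<in> I" for i
    using ker[of "inv_into I p (p i)" i] that by (auto simp: f_def inv_into_into f_inv_into_f)
  have UW: "?U \<subseteq> {1..n}" "?W \<subseteq> {1..n}" using p q by auto
  have f: "bij_betw f ?U ?W"
    using fp ker by (auto simp: bij_betw_def inj_on_def image_image)
  then have cUW: "card ?U = card ?W" by (rule bij_betw_same_card)
  have "card ({1..n} - ?U) = card ({1..n} - ?W)"
    using UW I cUW by (simp add: card_Diff_subset)
  then obtain h where h: "bij_betw h ({1..n} - ?U) ({1..n} - ?W)"
    using finite_same_card_bij[of "{1..n} - ?U" "{1..n} - ?W"] by auto
  define g0 where "g0 = (\<lambda>u. if u \<in> ?U then f u else if u \<in> {1..n} then h u else u)"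
  have b1: "bij_betw g0 ?U ?W"
    using f by (rule bij_betw_cong[THEN iffD1, rotated]) (simp add: g0_def)
  have b2: "bij_betw g0 ({1..n} - ?U) ({1..n} - ?W)"
    using h by (rule bij_betw_cong[THEN iffD1, rotated]) (auto simp: g0_def)
  have "bij_betw g0 (?U \<union> ({1..n} - ?U)) (?W \<union> ({1..n} - ?W))"
    by (rule bij_betw_combine[OF b1 b2]) auto
  then have "bij_betw g0 {1..n} {1..n}" using UW by (simp add: Un_absorb1)
  then have g0: "g0 permutes {1..n}"
    by (rule bij_imp_permutes) (use UW in \<open>auto simp: g0_def\<close>)
  have g0p: "g0 (p i) = q i" if "i \<in> I" for i using that fp by (simp add: g0_def)
  have "{g. g permutes {1..n} \<and> (\<forall>i\<in>I. g (p i) = q i)} = (\<lambda>k. g0 \<circ> k) ` {k. k permutes ({1..n} - ?U)}"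
  proof (intro equalityI subsetI)
    fix g assume "g \<in> {g. g permutes {1..n} \<and> (\<forall>i\<in>I. g (p i) = q i)}"
    then have g: "g permutes {1..n}" and gp: "\<And>i. i \<in> I \<Longrightarrow> g (p i) = q i" by auto
    have inv: "inv g0 permutes {1..n}" by (rule permutes_inv[OF g0])
    have "inv g0 \<circ> g permutes {1..n}" by (rule permutes_compose[OF g inv])
    moreover have "(inv g0 \<circ> g) u = u" if u: "u \<in> {1..n} - ({1..n} - ?U)" for u
    proof -
      obtain i where i: "i \<in> I" "u = p i" using u by auto
      have "inv g0 (g (p i)) = inv g0 (g0 (p i))" using gp[OF i(1)] g0p[OF i(1)] by simp
      then show ?thesis using permutes_inverses(2)[OF g0] i(2) by simp
    qed
    ultimately have "inv g0 \<circ> g permutes ({1..n} - ?U)"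
      by (rule permutes_superset)
    moreover have "g = g0 \<circ> (inv g0 \<circ> g)"
      using permutes_inverses(1)[OF g0] by (simp add: fun_eq_iff)
    ultimately show "g \<in> (\<lambda>k. g0 \<circ> k) ` {k. k permutes ({1..n} - ?U)}" by blast
  next
    fix g assume "g \<in> (\<lambda>k. g0 \<circ> k) ` {k. k permutes ({1..n} - ?U)}"
    then obtain k where k: "k permutes ({1..n} - ?U)" "g = g0 \<circ> k" by auto
    have "k permutes {1..n}" by (rule permutes_subset[OF k(1)]) auto
    then have "g permutes {1..n}" unfolding k(2) by (rule permutes_compose[OF _ g0])
    moreover have "k (p i) = p i" if "i \<in> I" for i
      using permutes_not_in[OF k(1)] that by auto
    ultimately show "g \<in> {g. g permutes {1..n} \<and> (\<forall>i\<in>I. g (p i) = q i)}"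
      using g0p k(2) by auto
  qed
  moreover have "inj_on (\<lambda>k. g0 \<circ> k) {k. k permutes ({1..n} - ?U)}"
    using permutes_inj[OF g0] by (auto simp: inj_on_def fun_eq_iff inj_def)
  ultimately have "card {g. g permutes {1..n} \<and> (\<forall>i\<in>I. g (p i) = q i)} = card {k. k permutes ({1..n} - ?U)}"
    by (simp only: card_image)
  also have "\<dots> = fact (card ({1..n} - ?U))" by (rule card_permutations) auto
  also have "card ({1..n} - ?U) = n - card ?U" using UW(1) I by (simp add: card_Diff_subset)
  finally show ?thesis .
qed

definition tuples :: "nat \<Rightarrow> 'v set \<Rightarrow> ('v \<Rightarrow> nat) set" where
  "tuples n V = {x \<in> V \<rightarrow>\<^sub>E {1..n}. inj_on x V}"

text \<open>
  The equations that \<open>z\<close> happens to satisfy, as opposed to those it is required to satisfy.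
\<close>

definition pattern :: "(nat \<Rightarrow> nat) \<Rightarrow> 'v set \<Rightarrow> ('v \<Rightarrow> nat) \<Rightarrow> ('v \<times> 'v) set" where
  "pattern d V z = {(i, j). i \<in> V \<and> j \<in> V \<and> d (z i) = z j}"

text \<open>
  The coincidences among the values prescribed for \<open>g\<close>: since \<open>g (d (z i))\<close> has to be \<open>inv c (x (\<pi> i))\<close>, it
  is equal to \<open>g (z j)\<close> just when \<open>c (x j) = x (\<pi> i)\<close>.
\<close>

definition pattern_to :: "(nat \<Rightarrow> nat) \<Rightarrow> ('v \<Rightarrow> 'v) \<Rightarrow> 'v set \<Rightarrow> ('v \<Rightarrow> nat) \<Rightarrow> ('v \<times> 'v) set" where
  "pattern_to c \<pi> V x = {(i, j). i \<in> V \<and> j \<in> V \<and> c (x j) = x (\<pi> i)}"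

lemma tuples_iff: "x \<in> tuples n V \<longleftrightarrow> x \<in> extensional V \<and> x ` V \<subseteq> {1..n} \<and> inj_on x V"
  unfolding tuples_def PiE_def Pi_def by auto

lemma finite_tuples [simp]: "finite V \<Longrightarrow> finite (tuples n V)"
  by (rule finite_subset[of _ "V \<rightarrow>\<^sub>E {1..n}"]) (auto simp: tuples_def intro: finite_PiE)

text \<open>
  The permutation \<open>g\<close> is prescribed on the points \<open>z i\<close> and \<open>d (z i)\<close>. These are \<open>2 * card V\<close> points of which
  as many coincide as the pattern has edges, and the prescription is consistent and injective if
  and only if the prescribed values coincide in the same way.
\<close>

lemma card_conjugators:
  assumes c: "c permutes {1..n}" and d: "d permutes {1..n}" and V: "finite V" and \<pi>: "bij_betw \<pi> V V"
    and z: "z \<in> tuples n V" and x: "x \<in> tuples n V"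
  shows "card {g. g permutes {1..n} \<and> (\<forall>i\<in>V. g (z i) = x i \<and> c (g (d (z i))) = x (\<pi> i))} =
    (if pattern d V z = pattern_to c \<pi> V x then fact (n - (2 * card V - card (pattern d V z))) else 0)"
proof -
  \<comment> \<open>The two families of prescribed points are indexed together, with a tag.\<close>
  define p where "p = (\<lambda>(b, i). if b then d (z i) else z i)"
  define q where "q = (\<lambda>(b, i). if b then inv c (x (\<pi> i)) else x i)"
  let ?I = "(UNIV :: bool set) \<times> V"
  have c_inv: "c u = v \<longleftrightarrow> u = inv c v" for u v
    using permutes_inverses[OF c] by metis
  have zx: "z ` V \<subseteq> {1..n}" "inj_on z V" "x ` V \<subseteq> {1..n}" "inj_on x V"
    using z x by (auto simp only: tuples_iff)
  have \<pi>V: "\<pi> i \<in> V" if "i \<in> V" for i using \<pi> that by (auto simp: bij_betw_def)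
  have set_eq: "{g. g permutes {1..n} \<and> (\<forall>i\<in>V. g (z i) = x i \<and> c (g (d (z i))) = x (\<pi> i))} =
      {g. g permutes {1..n} \<and> (\<forall>k\<in>?I. g (p k) = q k)}"
    unfolding c_inv by (auto simp: p_def q_def)
  have d_eq: "d (z i) = d (z j) \<longleftrightarrow> i = j" if "i \<in> V" "j \<in> V" for i j
    using permutes_inj[OF d] zx(2) that by (auto simp: inj_eq inj_on_eq_iff)
  have c_eq: "inv c (x (\<pi> i)) = inv c (x (\<pi> j)) \<longleftrightarrow> i = j" if "i \<in> V" "j \<in> V" for i j
    using permutes_inj[OF permutes_inv[OF c]] zx(4) \<pi> \<pi>V that
    by (auto simp: inj_eq inj_on_eq_iff bij_betw_def)
  have z_eq: "z i = z j \<longleftrightarrow> i = j" "x i = x j \<longleftrightarrow> i = j" if "i \<in> V" "j \<in> V" for i j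
    using zx that by (auto simp: inj_on_eq_iff)
  have pat: "pattern_to c \<pi> V x = {(i, j). i \<in> V \<and> j \<in> V \<and> inv c (x (\<pi> i)) = x j}"
    unfolding pattern_to_def c_inv by auto
  show ?thesis
  proof (cases "pattern d V z = pattern_to c \<pi> V x")
    case True
    then have tr: "d (z i) = z j \<longleftrightarrow> inv c (x (\<pi> i)) = x j" if "i \<in> V" "j \<in> V" for i j
      unfolding pat pattern_def using that by blast
    have "card {g. g permutes {1..n} \<and> (\<forall>k\<in>?I. g (p k) = q k)} = fact (n - card (p ` ?I))"
    proof (rule card_permutes_extending)
      show "finite ?I" using V by simp
      show "p k \<in> {1..n}" if "k \<in> ?I" for k
        using that zx(1) permutes_closed[OF d] by (cases k) (auto simp: p_def image_subset_iff)
      show "q k \<in> {1..n}" if "k \<in> ?I" for k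
        using that zx(3) permutes_closed[OF permutes_inv[OF c]] \<pi>V
        by (cases k) (auto simp: q_def image_subset_iff)
      show "(p k = p l) = (q k = q l)" if "k \<in> ?I" "l \<in> ?I" for k l
        using that tr[of "snd k" "snd l"] tr[of "snd l" "snd k"] d_eq[of "snd k" "snd l"]
          c_eq[of "snd k" "snd l"] z_eq[of "snd k" "snd l"]
        by (cases k; cases l) (auto simp: p_def q_def eq_commute)
    qed
    moreover have "card (p ` ?I) = 2 * card V - card (pattern d V z)"
    proof -
      have "p ` ?I = z ` V \<union> (\<lambda>i. d (z i)) ` V"
        by (auto simp: p_def image_iff split: if_splits) (metis (full_types))+
      moreover have "card (z ` V) = card V" using zx(2) by (rule card_image)
      moreover have "card ((\<lambda>i. d (z i)) ` V) = card V"
        by (rule card_image) (use d_eq in \<open>auto simp: inj_on_def\<close>)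
      moreover have "card (z ` V \<inter> (\<lambda>i. d (z i)) ` V) = card (pattern d V z)"
      proof -
        have "z ` V \<inter> (\<lambda>i. d (z i)) ` V = (\<lambda>(i, j). z j) ` pattern d V z"
        proof (intro equalityI subsetI)
          fix u assume "u \<in> z ` V \<inter> (\<lambda>i. d (z i)) ` V"
          then obtain i j where "i \<in> V" "j \<in> V" "u = z j" "d (z i) = z j" by auto
          then show "u \<in> (\<lambda>(i, j). z j) ` pattern d V z"
            by (intro image_eqI[of _ _ "(i, j)"]) (auto simp: pattern_def)
        next
          fix u assume "u \<in> (\<lambda>(i, j). z j) ` pattern d V z"
          then obtain i j where "i \<in> V" "j \<in> V" "u = z j" "d (z i) = z j" by (auto simp: pattern_def)
          then show "u \<in> z ` V \<inter> (\<lambda>i. d (z i)) ` V" by (metis IntI imageI)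
        qed
        moreover have "inj_on (\<lambda>(i, j). z j) (pattern d V z)"
          using d_eq z_eq by (auto simp: pattern_def inj_on_def) metis+
        ultimately show ?thesis by (simp add: card_image)
      qed
      ultimately show ?thesis
        using card_Un_Int[of "z ` V" "(\<lambda>i. d (z i)) ` V"] V by simp
    qed
    ultimately show ?thesis using True set_eq by simp
  next
    case False
    have "{g. g permutes {1..n} \<and> (\<forall>k\<in>?I. g (p k) = q k)} = {}"
    proof (rule ccontr)
      assume "{g. g permutes {1..n} \<and> (\<forall>k\<in>?I. g (p k) = q k)} \<noteq> {}"
      then obtain g where g: "g permutes {1..n}" "\<And>k. k \<in> ?I \<Longrightarrow> g (p k) = q k" by blast
      have "d (z i) = z j \<longleftrightarrow> inv c (x (\<pi> i)) = x j" if "i \<in> V" "j \<in> V" for i j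
      proof -
        have "d (z i) = z j \<longleftrightarrow> g (d (z i)) = g (z j)"
          using permutes_inj[OF g(1)] by (simp add: inj_eq)
        then show ?thesis
          using g(2)[of "(True, i)"] g(2)[of "(False, j)"] that by (simp add: p_def q_def)
      qed
      then show False using False unfolding pat pattern_def by auto
    qed
    then show ?thesis using False set_eq by (simp only: card.empty if_False)
  qed
qed

text \<open>
  Every solution \<open>x\<close> for the conjugated product is \<open>g \<circ> z\<close> for exactly one tuple \<open>z\<close>. Counting triples
  \<open>(g, z, x)\<close> with \<open>g\<close> last leaves the number of conjugators.
\<close>

lemma sum_conjugates:
  assumes c: "c permutes {1..n}" and d: "d permutes {1..n}" and V: "finite V" and \<pi>: "bij_betw \<pi> V V"
  shows "(\<Sum>g | g permutes {1..n}. card (embeddings n (c \<circ> (g \<circ> d \<circ> inv g)) V (graph_on V \<pi>))) =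
    (\<Sum>z\<in>tuples n V. \<Sum>x\<in>tuples n V.
       if pattern d V z = pattern_to c \<pi> V x then fact (n - (2 * card V - card (pattern d V z))) else 0)"
proof -
  let ?P = "{g. g permutes {1..n}}"
  have fin: "finite ?P" by (rule finite_permutations) simp
  let ?Q = "\<lambda>g z x. \<forall>i\<in>V. g (z i) = x i \<and> c (g (d (z i))) = x (\<pi> i)"
  have 1: "card (embeddings n (c \<circ> (g \<circ> d \<circ> inv g)) V (graph_on V \<pi>)) =
      (\<Sum>z\<in>tuples n V. \<Sum>x\<in>tuples n V. of_bool (?Q g z x))" if g: "g permutes {1..n}" for g
  proof -
    note ig = permutes_inverses[OF g]
    let ?E = "embeddings n (c \<circ> (g \<circ> d \<circ> inv g)) V (graph_on V \<pi>)"
    have E: "?E = {x \<in> tuples n V. \<forall>i\<in>V. c (g (d (inv g (x i)))) = x (\<pi> i)}"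
      unfolding embeddings_graph_iff[abs_def] tuples_iff set_eq_iff by auto
    have "(\<Sum>z\<in>tuples n V. of_bool (?Q g z x)) = (of_bool (x \<in> ?E) :: nat)" if x: "x \<in> tuples n V" for x
    proof -
      define z0 where "z0 = (\<lambda>i\<in>V. inv g (x i))"
      have z0: "z0 \<in> tuples n V"
        unfolding tuples_iff
      proof (intro conjI)
        have xx: "x ` V \<subseteq> {1..n}" "inj_on x V" using x by (simp_all only: tuples_iff)
        show "z0 ` V \<subseteq> {1..n}"
          using xx(1) permutes_closed[OF permutes_inv[OF g]] unfolding z0_def image_restrict_eq by blast
        have "inj_on (\<lambda>i. inv g (x i)) V"
          using comp_inj_on[OF xx(2), of "inv g"] permutes_inj_on[OF permutes_inv[OF g]]
          by (simp only: comp_def)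
        then show "inj_on z0 V" by (simp add: z0_def)
      qed (simp add: z0_def)
      have "?Q g z x \<longleftrightarrow> z = z0 \<and> x \<in> ?E" if z: "z \<in> tuples n V" for z
      proof
        assume Q: "?Q g z x"
        have "z = z0"
        proof (rule extensionalityI[of _ V])
          fix i assume "i \<in> V"
          then show "z i = z0 i" using Q ig unfolding z0_def by (metis restrict_apply')
        qed (use z z0 in \<open>simp_all add: tuples_iff\<close>)
        moreover from this have "x \<in> ?E" unfolding E using Q x by (auto simp: z0_def)
        ultimately show "z = z0 \<and> x \<in> ?E" by simp
      next
        assume "z = z0 \<and> x \<in> ?E"
        then show "?Q g z x" unfolding E using ig by (auto simp: z0_def)
      qed
      then have "(\<Sum>z\<in>tuples n V. of_bool (?Q g z x)) = (\<Sum>z\<in>tuples n V. if z = z0 then of_bool (x \<in> ?E) else (0::nat))"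
        by (intro sum.cong) (auto simp: of_bool_def)
      also have "\<dots> = of_bool (x \<in> ?E)" using z0 V by (simp add: sum.delta)
      finally show ?thesis .
    qed
    then have "(\<Sum>x\<in>tuples n V. \<Sum>z\<in>tuples n V. of_bool (?Q g z x)) = (\<Sum>x\<in>tuples n V. (of_bool (x \<in> ?E) :: nat))"
      by (intro sum.cong refl)
    also have "\<dots> = card (tuples n V \<inter> ?E)"
      using V by (simp add: sum_of_bool_eq del: of_bool_eq_iff)
    also have "tuples n V \<inter> ?E = ?E" unfolding E by blast
    finally show ?thesis by (subst sum.swap) simp
  qed
  have "(\<Sum>g\<in>?P. card (embeddings n (c \<circ> (g \<circ> d \<circ> inv g)) V (graph_on V \<pi>))) =
      (\<Sum>g\<in>?P. \<Sum>z\<in>tuples n V. \<Sum>x\<in>tuples n V. of_bool (?Q g z x))"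
    using 1 by (intro sum.cong) auto
  also have "\<dots> = (\<Sum>z\<in>tuples n V. \<Sum>g\<in>?P. \<Sum>x\<in>tuples n V. of_bool (?Q g z x))" by (rule sum.swap)
  also have "\<dots> = (\<Sum>z\<in>tuples n V. \<Sum>x\<in>tuples n V. \<Sum>g\<in>?P. of_bool (?Q g z x))"
    by (intro sum.cong refl sum.swap)
  also have "\<dots> = (\<Sum>z\<in>tuples n V. \<Sum>x\<in>tuples n V. card {g. g permutes {1..n} \<and> ?Q g z x})"
  proof (intro sum.cong refl)
    fix z x
    have "(\<Sum>g\<in>?P. of_bool (?Q g z x)) = (card (?P \<inter> {g. ?Q g z x}))"
      using fin by (simp add: sum_of_bool_eq)
    also have "?P \<inter> {g. ?Q g z x} = {g. g permutes {1..n} \<and> ?Q g z x}" by auto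
    finally show "(\<Sum>g\<in>?P. of_bool (?Q g z x)) = card {g. g permutes {1..n} \<and> ?Q g z x}" .
  qed
  also have "\<dots> = (\<Sum>z\<in>tuples n V. \<Sum>x\<in>tuples n V.
       if pattern d V z = pattern_to c \<pi> V x then fact (n - (2 * card V - card (pattern d V z))) else 0)"
    by (intro sum.cong refl card_conjugators[OF c d V \<pi>])
  finally show ?thesis .
qed

text \<open>
  The system which \<open>x\<close> solves for \<open>c\<close> when its pattern in the sense of \<open>pattern_to\<close> is \<open>E\<close>.
\<close>

definition twist :: "('v \<Rightarrow> 'v) \<Rightarrow> ('v \<times> 'v) set \<Rightarrow> ('v \<times> 'v) set" where
  "twist \<pi> E = (\<lambda>(i, j). (j, \<pi> i)) ` E"

definition free_tuples :: "nat \<Rightarrow> (nat \<Rightarrow> nat) \<Rightarrow> 'v set \<Rightarrow> ('v \<Rightarrow> nat) set" where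
  "free_tuples n c V = {z \<in> tuples n V. pattern c V z = {}}"

text \<open>
  The number of solutions divided by \<open>n powr (card V - card E / 2)\<close>, the largest order of magnitude that it can
  have when there are \<open>O(sqrt n)\<close> fixed points.
\<close>

definition embedding_density :: "nat \<Rightarrow> (nat \<Rightarrow> nat) \<Rightarrow> 'v set \<Rightarrow> ('v \<times> 'v) set \<Rightarrow> real" where
  "embedding_density n c V E = real (card (embeddings n c V E)) * sqrt n ^ card E / sqrt n ^ (2 * card V)"

definition free_density :: "nat \<Rightarrow> (nat \<Rightarrow> nat) \<Rightarrow> 'v set \<Rightarrow> real" where
  "free_density n c V = real (card (free_tuples n c V)) / real n ^ card V"

lemma pattern_partial_injection:
  assumes "c permutes {1..n}" "z \<in> tuples n V"
  shows "pattern c V z \<in> partial_injections V"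
proof -
  have "z i = z j \<longleftrightarrow> i = j" if "i \<in> V" "j \<in> V" for i j
    using assms(2) that by (auto simp: tuples_iff inj_on_eq_iff)
  moreover have "c (z i) = c (z j) \<longleftrightarrow> z i = z j" for i j
    using permutes_inj[OF assms(1)] by (simp add: inj_eq)
  ultimately show ?thesis
    unfolding partial_injections_def single_valued_def pattern_def by auto metis+
qed

lemma pattern_embeddings: "z \<in> tuples n V \<Longrightarrow> z \<in> embeddings n c V (pattern c V z)"
  by (auto simp: embeddings_iff tuples_iff pattern_def)

lemma pattern_to_embeddings: "x \<in> tuples n V \<Longrightarrow> x \<in> embeddings n c V (twist \<pi> (pattern_to c \<pi> V x))"
  by (auto simp: embeddings_iff tuples_iff pattern_to_def twist_def)

lemma twist_partial_injection:
  assumes E: "E \<in> partial_injections V" and \<pi>: "bij_betw \<pi> V V"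
  shows "twist \<pi> E \<in> partial_injections V" "card (twist \<pi> E) = card E" "twist \<pi> E = {} \<longleftrightarrow> E = {}"
proof -
  note pi = partial_injectionsD[OF E]
  have \<pi>i: "\<pi> i = \<pi> j \<longleftrightarrow> i = j" if "i \<in> V" "j \<in> V" for i j
    using \<pi> that by (auto simp: bij_betw_def inj_on_eq_iff)
  have \<pi>V: "\<pi> i \<in> V" if "i \<in> V" for i using \<pi> that by (auto simp: bij_betw_def)
  have V: "i \<in> V" "j \<in> V" if "(i, j) \<in> E" for i j using pi(1) that by auto
  have "twist \<pi> E \<subseteq> V \<times> V" using V \<pi>V by (auto simp: twist_def)
  moreover have "single_valued (twist \<pi> E)"
  proof (rule single_valuedI)
    fix j k l assume "(j, k) \<in> twist \<pi> E" "(j, l) \<in> twist \<pi> E"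
    then obtain a b where "(a, j) \<in> E" "k = \<pi> a" "(b, j) \<in> E" "l = \<pi> b" by (auto simp: twist_def)
    then show "k = l" using pi(3) by metis
  qed
  moreover have "single_valued ((twist \<pi> E)\<inverse>)"
  proof (rule single_valuedI)
    fix k j l assume "(k, j) \<in> (twist \<pi> E)\<inverse>" "(k, l) \<in> (twist \<pi> E)\<inverse>"
    then obtain a b where ab: "(a, j) \<in> E" "k = \<pi> a" "(b, l) \<in> E" "k = \<pi> b" by (auto simp: twist_def)
    then have "a = b" using \<pi>i V by metis
    with ab show "j = l" using pi(2) by metis
  qed
  ultimately show "twist \<pi> E \<in> partial_injections V" by (simp add: partial_injections_def)
  have "inj_on (\<lambda>(i, j). (j, \<pi> i)) E" using \<pi>i V by (auto simp: inj_on_def)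
  then show "card (twist \<pi> E) = card E" unfolding twist_def by (rule card_image)
  show "twist \<pi> E = {} \<longleftrightarrow> E = {}" by (simp add: twist_def)
qed

lemma pattern_to_empty_iff:
  assumes "bij_betw \<pi> V V"
  shows "pattern_to c \<pi> V x = {} \<longleftrightarrow> pattern c V x = {}"
proof -
  have \<pi>: "\<pi> ` V = V" using assms by (simp add: bij_betw_def)
  have "pattern_to c \<pi> V x = {} \<longleftrightarrow> (\<forall>j\<in>V. \<forall>i\<in>V. c (x j) \<noteq> x (\<pi> i))"
    by (auto simp: pattern_to_def)
  also have "\<dots> \<longleftrightarrow> (\<forall>j\<in>V. \<forall>k\<in>\<pi> ` V. c (x j) \<noteq> x k)" by blast
  also have "\<dots> \<longleftrightarrow> pattern c V x = {}" unfolding \<pi> by (auto simp: pattern_def)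
  finally show ?thesis .
qed

lemma sum_conjugates_by_pattern:
  assumes c: "c permutes {1..n}" and d: "d permutes {1..n}" and V: "finite V" and \<pi>: "bij_betw \<pi> V V"
  shows "(\<Sum>g | g permutes {1..n}. card (embeddings n (c \<circ> (g \<circ> d \<circ> inv g)) V (graph_on V \<pi>))) =
    (\<Sum>E\<in>partial_injections V. card {z \<in> tuples n V. pattern d V z = E} *
       card {x \<in> tuples n V. pattern_to c \<pi> V x = E} * fact (n - (2 * card V - card E)))"
proof -
  let ?h = "\<lambda>z. \<Sum>x\<in>tuples n V.
       if pattern d V z = pattern_to c \<pi> V x then fact (n - (2 * card V - card (pattern d V z))) else (0::nat)"
  have "(\<Sum>z\<in>tuples n V. ?h z) = (\<Sum>E\<in>partial_injections V. sum ?h {z \<in> tuples n V. pattern d V z = E})"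
    by (rule sum.group[symmetric]) (use V pattern_partial_injection[OF d] in auto)
  also have "\<dots> = (\<Sum>E\<in>partial_injections V. card {z \<in> tuples n V. pattern d V z = E} *
       card {x \<in> tuples n V. pattern_to c \<pi> V x = E} * fact (n - (2 * card V - card E)))"
  proof (intro sum.cong refl)
    fix E
    have "?h z = card {x \<in> tuples n V. pattern_to c \<pi> V x = E} * fact (n - (2 * card V - card E))"
      if "z \<in> {z \<in> tuples n V. pattern d V z = E}" for z
    proof -
      have "?h z = (\<Sum>x\<in>{x \<in> tuples n V. pattern_to c \<pi> V x = E}. fact (n - (2 * card V - card E)))"
        using that V by (intro sum.mono_neutral_cong_right) auto
      then show ?thesis by simp
    qed
    then have "sum ?h {z \<in> tuples n V. pattern d V z = E} = (\<Sum>z\<in>{z \<in> tuples n V. pattern d V z = E}.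
        card {x \<in> tuples n V. pattern_to c \<pi> V x = E} * fact (n - (2 * card V - card E)))"
      by (intro sum.cong refl)
    then show "sum ?h {z \<in> tuples n V. pattern d V z = E} = card {z \<in> tuples n V. pattern d V z = E} *
       card {x \<in> tuples n V. pattern_to c \<pi> V x = E} * fact (n - (2 * card V - card E))"
      by simp
  qed
  finally show ?thesis using sum_conjugates[OF assms] by simp
qed

lemma fact_diff_le:
  assumes "n \<ge> 2 * k"
  shows "fact (n - k) * real n ^ k \<le> 2 ^ k * fact n"
  using assms
proof (induction k)
  case (Suc k)
  have "fact (n - Suc k) * real n ^ Suc k = fact (n - Suc k) * real n * real n ^ k" by simp
  also have "\<dots> \<le> fact (n - Suc k) * (2 * real (n - k)) * real n ^ k"
    using Suc.prems by (intro mult_right_mono mult_left_mono) auto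
  also have "\<dots> = 2 * (fact (n - k) * real n ^ k)"
    using Suc.prems fact_reduce[of "n - k", where 'a = real] by (simp add: mult.commute)
  also have "\<dots> \<le> 2 * (2 ^ k * fact n)" using Suc by simp
  finally show ?case by simp
qed simp

lemma empty_partial_injection: "{} \<in> partial_injections V"
  by (simp add: partial_injections_def single_valued_def)

text \<open>
  The pattern formula in normalised form. The normalisations of the two densities and the factorial quotient, which
  is of order \<open>n ^ card E / n ^ (2 * card V)\<close>, cancel for every pattern; the factor \<open>4 ^ card V\<close> bounds the error of replacing
  the quotient by this power.
\<close>

lemma mean_conjugates_bounds:
  fixes c d :: "nat \<Rightarrow> nat" and \<pi> :: "'v \<Rightarrow> 'v"
  assumes c: "c permutes {1..n}" and d: "d permutes {1..n}" and V: "finite V" and \<pi>: "bij_betw \<pi> V V"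
    and n: "n \<ge> 4 * card V" "n \<ge> 1"
  defines "mean \<equiv> (\<Sum>g | g permutes {1..n}.
      real (card (embeddings n (c \<circ> (g \<circ> d \<circ> inv g)) V (graph_on V \<pi>)))) / fact n"
    and "main \<equiv> free_density n d V * free_density n c V * (fact (n - 2 * card V) * real n ^ (2 * card V) / fact n)"
  shows "main \<le> mean"
    "mean \<le> main + (\<Sum>E\<in>partial_injections V - {{}}.
       4 ^ card V * embedding_density n d V E * embedding_density n c V (twist \<pi> E))"
proof -
  let ?m = "card V"
  define s where "s = sqrt n"
  have s0: "s > 0" and s2: "s\<^sup>2 = n" using n by (auto simp: s_def)
  define t where "t = (\<lambda>E. real (card {z \<in> tuples n V. pattern d V z = E}) *
       real (card {x \<in> tuples n V. pattern_to c \<pi> V x = E}) * (fact (n - (2 * ?m - card E)) / fact n))"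
  have "mean = (\<Sum>E\<in>partial_injections V. t E)"
    unfolding mean_def t_def of_nat_sum[symmetric] sum_conjugates_by_pattern[OF c d V \<pi>]
    by (simp add: sum_divide_distrib)
  also have "\<dots> = t {} + (\<Sum>E\<in>partial_injections V - {{}}. t E)"
    by (rule sum.remove) (use V empty_partial_injection in auto)
  finally have mean: "mean = t {} + (\<Sum>E\<in>partial_injections V - {{}}. t E)" .
  have "t {} = main"
    using n unfolding t_def main_def free_density_def free_tuples_def pattern_to_empty_iff[OF \<pi>]
    by (simp add: mult_2 power_add)
  moreover have "t E \<ge> 0" for E by (simp add: t_def)
  then have "(\<Sum>E\<in>partial_injections V - {{}}. t E) \<ge> 0" by (intro sum_nonneg)
  ultimately show "main \<le> mean" using mean by simp
  have "t E \<le> 4 ^ ?m * embedding_density n d V E * embedding_density n c V (twist \<pi> E)"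
    if E: "E \<in> partial_injections V" for E
  proof -
    define k where "k = 2 * ?m - card E"
    have cE: "card E \<le> ?m"
    proof -
      note pi = partial_injectionsD[OF E]
      have "card E = card (fst ` E)"
        by (rule card_image[symmetric]) (use pi(2) in \<open>auto simp: inj_on_def\<close>)
      also have "\<dots> \<le> ?m" by (rule card_mono[OF V]) (use pi(1) in auto)
      finally show ?thesis .
    qed
    have "fact (n - k) * real n ^ k \<le> 2 ^ k * fact n" by (rule fact_diff_le) (use n in \<open>simp add: k_def\<close>)
    also have "\<dots> \<le> 4 ^ ?m * fact n"
    proof (rule mult_right_mono)
      have "(2::real) ^ k \<le> 2 ^ (2 * ?m)" by (rule power_increasing) (auto simp: k_def)
      then show "(2::real) ^ k \<le> 4 ^ ?m" by (simp add: power_mult)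
    qed simp
    finally have "fact (n - k) / fact n \<le> 4 ^ ?m / real n ^ k"
      using n by (simp add: field_simps)
    also have "real n ^ k = s ^ k * s ^ k" unfolding s2[symmetric] by (simp add: power2_eq_square power_mult_distrib)
    also have "4 ^ ?m / (s ^ k * s ^ k) = 4 ^ ?m * (s ^ card E / s ^ (2 * ?m)) * (s ^ card E / s ^ (2 * ?m))"
    proof -
      have "s ^ k = s ^ (2 * ?m) / s ^ card E" unfolding k_def by (rule power_diff) (use s0 cE in auto)
      then have "s ^ card E / s ^ (2 * ?m) = 1 / s ^ k" using s0 by (simp add: field_simps)
      then show ?thesis by (simp only: times_divide_eq_right divide_divide_eq_left mult_1_right)
    qed
    finally have F: "fact (n - k) / fact n \<le> 4 ^ ?m * (s ^ card E / s ^ (2 * ?m)) * (s ^ card E / s ^ (2 * ?m))" .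
    have d1: "card {z \<in> tuples n V. pattern d V z = E} \<le> card (embeddings n d V E)"
      by (rule card_mono) (use V pattern_embeddings in auto)
    have c1: "card {x \<in> tuples n V. pattern_to c \<pi> V x = E} \<le> card (embeddings n c V (twist \<pi> E))"
      by (rule card_mono) (use V pattern_to_embeddings in auto)
    have "t E \<le> real (card (embeddings n d V E)) * real (card (embeddings n c V (twist \<pi> E))) *
        (4 ^ ?m * (s ^ card E / s ^ (2 * ?m)) * (s ^ card E / s ^ (2 * ?m)))"
      unfolding t_def by (intro mult_mono F[unfolded k_def]) (use d1 c1 in auto)
    also have "\<dots> = 4 ^ ?m * embedding_density n d V E * embedding_density n c V (twist \<pi> E)"
      by (simp add: embedding_density_def twist_partial_injection(2)[OF E \<pi>] s_def)
    finally show ?thesis .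
  qed
  then have "(\<Sum>E\<in>partial_injections V - {{}}. t E) \<le> (\<Sum>E\<in>partial_injections V - {{}}.
       4 ^ ?m * embedding_density n d V E * embedding_density n c V (twist \<pi> E))"
    by (intro sum_mono) auto
  then show "mean \<le> main + (\<Sum>E\<in>partial_injections V - {{}}.
       4 ^ card V * embedding_density n d V E * embedding_density n c V (twist \<pi> E))"
    using mean \<open>t {} = main\<close> by simp
qed

lemma card_tuples:
  assumes "finite V"
  shows "card (tuples n V) = fact (card V) * (n choose card V)"
proof -
  have "orbit id i = {i}" for i :: nat using orbit_eq_singleton_iff[of id i] by simp
  then have "period_points n 1 id = {1..n}" by (auto simp: period_points_def simp del: id_apply)
  then have "num_cycles n 1 id = n" using card_period_points[OF permutes_id, of n 1] by simp
  moreover have "tuples n V = embeddings n id V (graph_on V (\<lambda>v. v))"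
    by (auto simp: tuples_iff embeddings_graph_iff simp del: eq_id_iff)
  ultimately show ?thesis using card_fixed_embeddings[OF permutes_id assms, of n] by simp
qed

text \<open>
  Tuples with a nonempty pattern solve the corresponding system. Their proportion is the density of that
  system divided by \<open>sqrt n ^ card E\<close>, hence at most the density divided by \<open>sqrt n\<close>.
\<close>

lemma free_density_bounds:
  assumes c: "c permutes {1..n}" and V: "finite V" and n: "n \<ge> 1"
  shows "0 \<le> free_density n c V" "free_density n c V \<le> 1"
    "real (card (tuples n V)) / real n ^ card V -
      (\<Sum>E\<in>partial_injections V - {{}}. embedding_density n c V E / sqrt n) \<le> free_density n c V"
proof -
  let ?m = "card V"
  show "0 \<le> free_density n c V" by (simp add: free_density_def)
  have "card (free_tuples n c V) \<le> card (embeddings n c V {})"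
    by (rule card_mono) (auto simp: V free_tuples_def tuples_iff embeddings_iff)
  also have "\<dots> \<le> n ^ ?m" by (rule card_embeddings_le[OF V])
  finally have "real (card (free_tuples n c V)) \<le> real (n ^ ?m)" by (simp only: of_nat_le_iff)
  then show "free_density n c V \<le> 1" using n by (simp add: free_density_def)
  have "tuples n V \<subseteq> free_tuples n c V \<union> (\<Union>E\<in>partial_injections V - {{}}. embeddings n c V E)"
    using pattern_partial_injection[OF c] pattern_embeddings by (fastforce simp: free_tuples_def)
  then have "card (tuples n V) \<le> card (free_tuples n c V \<union> (\<Union>E\<in>partial_injections V - {{}}. embeddings n c V E))"
    using V by (intro card_mono) (auto simp: free_tuples_def)
  also have "\<dots> \<le> card (free_tuples n c V) + card (\<Union>E\<in>partial_injections V - {{}}. embeddings n c V E)"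
    by (rule card_Un_le)
  also have "\<dots> \<le> card (free_tuples n c V) + (\<Sum>E\<in>partial_injections V - {{}}. card (embeddings n c V E))"
    using V by (intro add_left_mono card_UN_le) auto
  finally have "real (card (tuples n V)) \<le>
      real (card (free_tuples n c V) + (\<Sum>E\<in>partial_injections V - {{}}. card (embeddings n c V E)))"
    by (simp only: of_nat_le_iff)
  then have "real (card (tuples n V)) / real n ^ ?m \<le>
      free_density n c V + (\<Sum>E\<in>partial_injections V - {{}}. real (card (embeddings n c V E)) / real n ^ ?m)"
    using n by (simp add: free_density_def field_simps flip: sum_divide_distrib)
  moreover have "(\<Sum>E\<in>partial_injections V - {{}}. real (card (embeddings n c V E)) / real n ^ ?m)
      \<le> (\<Sum>E\<in>partial_injections V - {{}}. embedding_density n c V E / sqrt n)"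
  proof (rule sum_mono)
    fix E assume E: "E \<in> partial_injections V - {{}}"
    then have "finite E" using V partial_injectionsD(1)[of E V] finite_subset by auto
    then have "card E \<ge> 1" using E by (simp add: Suc_le_eq card_gt_0_iff)
    then have "sqrt n ^ 1 \<le> sqrt n ^ card E" using n by (intro power_increasing) auto
    then have "1 \<le> sqrt n ^ card E / sqrt n" using n by simp
    then have "real (card (embeddings n c V E)) * 1 \<le> real (card (embeddings n c V E)) * (sqrt n ^ card E / sqrt n)"
      by (rule mult_left_mono) simp
    then have "real (card (embeddings n c V E)) / real n ^ ?m \<le>
        real (card (embeddings n c V E)) * (sqrt n ^ card E / sqrt n) / real n ^ ?m"
      by (intro divide_right_mono) auto
    then show "real (card (embeddings n c V E)) / real n ^ ?m \<le> embedding_density n c V E / sqrt n"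
      by (simp add: embedding_density_def power_mult mult.commute[of "sqrt (real n)"])
  qed
  ultimately show "real (card (tuples n V)) / real n ^ card V -
      (\<Sum>E\<in>partial_injections V - {{}}. embedding_density n c V E / sqrt n) \<le> free_density n c V"
    by simp
qed

lemma embedding_density_bounds:
  assumes n: "n \<ge> 1" and c: "c permutes {1..n}" and V: "finite V" and E: "E \<in> partial_injections V"
  shows "0 \<le> embedding_density n c V E"
    "embedding_density n c V E \<le> (real (num_cycles n 1 c) / sqrt n) ^ card (loops E)"
    "E \<noteq> {} \<Longrightarrow> loops E = {} \<Longrightarrow>
      embedding_density n c V E \<le> 1 / sqrt n + 2 * real (num_cycles n 2 c) / n"
proof -
  have s: "sqrt n > 0" using n by simp
  show "0 \<le> embedding_density n c V E" by (simp add: embedding_density_def)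
  show "embedding_density n c V E \<le> (real (num_cycles n 1 c) / sqrt n) ^ card (loops E)"
    using card_embeddings_bound[OF assms] s
    by (simp add: embedding_density_def power_divide power_add field_simps)
  assume "E \<noteq> {}" "loops E = {}"
  from card_embeddings_gain[OF assms this] s
  show "embedding_density n c V E \<le> 1 / sqrt n + 2 * real (num_cycles n 2 c) / n"
    unfolding embedding_density_def by (subst pos_divide_le_eq) (auto simp: mult.commute)
qed

section \<open>Conjugation-invariant means on permutations\<close>

text \<open>
  Expectations with respect to the conjugation-invariant laws on the permutations of $[n]$, seen as positive linear
  functionals on all functions of a permutation. With functionals, the law of a product of independent factors is
  just the iteration \<open>mean_product\<close>, and Fubini's theorem is replaced by linearity.
\<close>

locale class_mean =
  fixes n :: nat and L :: "((nat \<Rightarrow> nat) \<Rightarrow> real) \<Rightarrow> real"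
  assumes add: "L (\<lambda>p. f p + g p) = L f + L g"
    and scale: "L (\<lambda>p. a * f p) = a * L f"
    and mono: "(\<And>p. p permutes {1..n} \<Longrightarrow> f p \<le> g p) \<Longrightarrow> L f \<le> L g"
    and one: "L (\<lambda>_. 1) = 1"
    and conj: "h permutes {1..n} \<Longrightarrow> L (\<lambda>p. f (h \<circ> p \<circ> inv h)) = L f"
begin

lemma cong: "(\<And>p. p permutes {1..n} \<Longrightarrow> f p = g p) \<Longrightarrow> L f = L g"
  by (intro antisym mono) auto

lemma const: "L (\<lambda>_. a) = a"
  using scale[of a "\<lambda>_. 1"] one by simp

lemma scale_right: "L (\<lambda>p. f p * a) = L f * a"
  using scale[of a f] by (simp add: mult.commute)

lemma divide: "L (\<lambda>p. f p / a) = L f / a"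
  using scale_right[of f "1 / a"] by simp

lemma sum: "finite I \<Longrightarrow> L (\<lambda>p. \<Sum>i\<in>I. f i p) = (\<Sum>i\<in>I. L (f i))"
proof (induction rule: finite_induct)
  case (insert i I)
  then show ?case using add[of "f i" "\<lambda>p. \<Sum>i\<in>I. f i p"] by simp
qed (use const[of 0] in simp)

lemma diff: "L (\<lambda>p. f p - g p) = L f - L g"
  using add[of f "\<lambda>p. - 1 * g p"] scale[of "-1" g] by simp

lemma nonneg: "(\<And>p. p permutes {1..n} \<Longrightarrow> 0 \<le> f p) \<Longrightarrow> 0 \<le> L f"
  using mono[of "\<lambda>_. 0" f] const[of 0] by simp

lemma upper: "(\<And>p. p permutes {1..n} \<Longrightarrow> f p \<le> a) \<Longrightarrow> L f \<le> a"
  using mono[of f "\<lambda>_. a"] const[of a] by simp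

lemma conj_mean: "L f = L (\<lambda>p. (\<Sum>g | g permutes {1..n}. f (g \<circ> p \<circ> inv g)) / fact n)"
proof -
  have fin: "finite {g. g permutes {1..n}}" by (rule finite_permutations) simp
  have "L (\<lambda>p. (\<Sum>g | g permutes {1..n}. f (g \<circ> p \<circ> inv g)) / fact n) =
      (\<Sum>g | g permutes {1..n}. L (\<lambda>p. f (g \<circ> p \<circ> inv g))) / fact n"
    unfolding divide sum[OF fin] ..
  also have "\<dots> = (\<Sum>g | g permutes {1..n}. L f) / fact n"
    by (rule arg_cong[of _ _ "\<lambda>t. t / fact n"], rule sum.cong) (use conj in blast)+
  also have "\<dots> = L f" using card_permutations[of "{1..n}" n] by simp
  finally show ?thesis ..
qed

end

definition mean_product ::
  "((('a \<Rightarrow> 'a) \<Rightarrow> real) \<Rightarrow> real) \<Rightarrow> ((('a \<Rightarrow> 'a) \<Rightarrow> real) \<Rightarrow> real) \<Rightarrow> (('a \<Rightarrow> 'a) \<Rightarrow> real) \<Rightarrow> real" where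
  "mean_product L1 L2 f = L1 (\<lambda>c. L2 (\<lambda>d. f (c \<circ> d)))"

lemma class_mean_product:
  assumes "class_mean n L1" "class_mean n L2"
  shows "class_mean n (mean_product L1 L2)"
proof -
  interpret L1: class_mean n L1 by fact
  interpret L2: class_mean n L2 by fact
  show ?thesis
  proof
    fix f g :: "(nat \<Rightarrow> nat) \<Rightarrow> real" and a :: real
    show "mean_product L1 L2 (\<lambda>p. f p + g p) = mean_product L1 L2 f + mean_product L1 L2 g"
      by (simp add: mean_product_def L1.add L2.add)
    show "mean_product L1 L2 (\<lambda>p. a * f p) = a * mean_product L1 L2 f"
      by (simp add: mean_product_def L1.scale L2.scale)
    show "mean_product L1 L2 (\<lambda>_. 1) = 1" by (simp add: mean_product_def L1.one L2.one)
    show "mean_product L1 L2 f \<le> mean_product L1 L2 g" if "\<And>p. p permutes {1..n} \<Longrightarrow> f p \<le> g p"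
      unfolding mean_product_def by (intro L1.mono L2.mono that permutes_compose)
    fix h :: "nat \<Rightarrow> nat" assume h: "h permutes {1..n}"
    have split: "h \<circ> (c \<circ> d) \<circ> inv h = (h \<circ> c \<circ> inv h) \<circ> (h \<circ> d \<circ> inv h)" for c d
      using permutes_inverses[OF h] by (simp add: fun_eq_iff)
    have "mean_product L1 L2 (\<lambda>p. f (h \<circ> p \<circ> inv h)) =
        L1 (\<lambda>c. L2 (\<lambda>d. f ((h \<circ> c \<circ> inv h) \<circ> (h \<circ> d \<circ> inv h))))"
      unfolding mean_product_def split ..
    also have "\<dots> = L1 (\<lambda>c. L2 (\<lambda>d. f ((h \<circ> c \<circ> inv h) \<circ> d)))"
      by (subst L2.conj[OF h, of "\<lambda>d. f ((h \<circ> c \<circ> inv h) \<circ> d)" for c]) simp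
    also have "\<dots> = L1 (\<lambda>c. L2 (\<lambda>d. f (c \<circ> d)))"
      by (rule L1.conj[OF h, of "\<lambda>c. L2 (\<lambda>d. f (c \<circ> d))"])
    finally show "mean_product L1 L2 (\<lambda>p. f (h \<circ> p \<circ> inv h)) = mean_product L1 L2 f"
      by (simp add: mean_product_def)
  qed
qed

lemma mean_product_embeddings_bounds:
  assumes L1: "class_mean n L1" and L2: "class_mean n L2"
    and V: "finite V" and \<pi>: "bij_betw \<pi> V V" and n: "n \<ge> 4 * card V" "n \<ge> 1"
  defines "M \<equiv> mean_product L1 L2 (\<lambda>p. real (card (embeddings n p V (graph_on V \<pi>))))"
    and "main \<equiv> L2 (\<lambda>d. free_density n d V) * L1 (\<lambda>c. free_density n c V) *
      (fact (n - 2 * card V) * real n ^ (2 * card V) / fact n)"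
  shows "main \<le> M"
    "M \<le> main + (\<Sum>E\<in>partial_injections V - {{}}. 4 ^ card V *
        L2 (\<lambda>d. embedding_density n d V E) * L1 (\<lambda>c. embedding_density n c V (twist \<pi> E)))"
proof -
  interpret L1: class_mean n L1 by fact
  interpret L2: class_mean n L2 by fact
  let ?K = "fact (n - 2 * card V) * real n ^ (2 * card V) / fact n"
  let ?mean = "\<lambda>c d. (\<Sum>g | g permutes {1..n}.
      real (card (embeddings n (c \<circ> (g \<circ> d \<circ> inv g)) V (graph_on V \<pi>)))) / fact n"
  have M: "M = L1 (\<lambda>c. L2 (\<lambda>d. ?mean c d))"
    unfolding M_def mean_product_def
    by (subst L2.conj_mean) (rule refl)
  have main: "main = L1 (\<lambda>c. L2 (\<lambda>d. free_density n d V * free_density n c V * ?K))"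
    unfolding main_def by (simp only: L1.scale L2.scale L1.scale_right L2.scale_right)
  \<comment> \<open>Both bounds hold for fixed \<open>c\<close> and \<open>d\<close>; the means then factorise by linearity.\<close>
  show "main \<le> M" unfolding main M
    by (intro L1.mono L2.mono mean_conjugates_bounds(1)[OF _ _ V \<pi> n])
  have fin: "finite (partial_injections V - {{}})" using V by simp
  have "M \<le> L1 (\<lambda>c. L2 (\<lambda>d. free_density n d V * free_density n c V * ?K +
      (\<Sum>E\<in>partial_injections V - {{}}.
       4 ^ card V * embedding_density n d V E * embedding_density n c V (twist \<pi> E))))"
    unfolding M by (intro L1.mono L2.mono mean_conjugates_bounds(2)[OF _ _ V \<pi> n])
  also have "\<dots> = main + (\<Sum>E\<in>partial_injections V - {{}}. 4 ^ card V *
        L2 (\<lambda>d. embedding_density n d V E) * L1 (\<lambda>c. embedding_density n c V (twist \<pi> E)))"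
    unfolding main by (simp only: L1.add L2.add L1.sum[OF fin] L2.sum[OF fin]
        L1.scale L2.scale L1.scale_right L2.scale_right)
  finally show "M \<le> main + (\<Sum>E\<in>partial_injections V - {{}}. 4 ^ card V *
        L2 (\<lambda>d. embedding_density n d V E) * L1 (\<lambda>c. embedding_density n c V (twist \<pi> E)))" .
qed

section \<open>Products of two random permutations\<close>

text \<open>
  All moments of the number of fixed points have at most the order they would have for a number bounded by a multiple
  of \<open>sqrt n\<close>. This is what a factor needs for patterns to contribute a bounded amount.
\<close>

definition tame_means :: "nat filter \<Rightarrow> (nat \<Rightarrow> ((nat \<Rightarrow> nat) \<Rightarrow> real) \<Rightarrow> real) \<Rightarrow> bool" where
  "tame_means F L \<longleftrightarrow> (\<forall>\<^sub>F n in F. class_mean n (L n)) \<and>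
     (\<forall>a. \<exists>C. \<forall>\<^sub>F n in F. L n (\<lambda>p. (real (num_cycles n 1 p) / sqrt n) ^ a) \<le> C)"

text \<open>
  Fixed points are of smaller order than \<open>sqrt n\<close> and cycles of length 2 of smaller order than \<open>n\<close>. One factor with
  this property makes the nonempty patterns negligible.
\<close>

definition scarce_means :: "nat filter \<Rightarrow> (nat \<Rightarrow> ((nat \<Rightarrow> nat) \<Rightarrow> real) \<Rightarrow> real) \<Rightarrow> bool" where
  "scarce_means F L \<longleftrightarrow> (\<forall>\<^sub>F n in F. class_mean n (L n)) \<and>
     (\<forall>a\<ge>1. ((\<lambda>n. L n (\<lambda>p. (real (num_cycles n 1 p) / sqrt n) ^ a)) \<longlongrightarrow> 0) F) \<and>
     ((\<lambda>n. L n (\<lambda>p. real (num_cycles n 2 p) / n)) \<longlongrightarrow> 0) F"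

lemma tame_meansD:
  assumes "tame_means F L"
  shows "\<forall>\<^sub>F n in F. class_mean n (L n)"
    "\<exists>C. \<forall>\<^sub>F n in F. L n (\<lambda>p. (real (num_cycles n 1 p) / sqrt n) ^ a) \<le> C"
  using assms by (auto simp: tame_means_def)

lemma scarce_imp_tame:
  assumes "scarce_means F L" shows "tame_means F L"
  unfolding tame_means_def
proof (intro conjI allI)
  show ev: "\<forall>\<^sub>F n in F. class_mean n (L n)" using assms by (simp add: scarce_means_def)
  fix a :: nat
  show "\<exists>C. \<forall>\<^sub>F n in F. L n (\<lambda>p. (real (num_cycles n 1 p) / sqrt n) ^ a) \<le> C"
  proof (cases "a = 0")
    case True
    have "\<forall>\<^sub>F n in F. L n (\<lambda>p. (real (num_cycles n 1 p) / sqrt n) ^ a) \<le> 1"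
      using ev by eventually_elim (simp add: class_mean.one True)
    then show ?thesis by blast
  next
    case False
    then have "((\<lambda>n. L n (\<lambda>p. (real (num_cycles n 1 p) / sqrt n) ^ a)) \<longlongrightarrow> 0) F"
      using assms by (simp add: scarce_means_def)
    then have "\<forall>\<^sub>F n in F. L n (\<lambda>p. (real (num_cycles n 1 p) / sqrt n) ^ a) < 1"
      by (rule order_tendstoD) simp
    then have "\<forall>\<^sub>F n in F. L n (\<lambda>p. (real (num_cycles n 1 p) / sqrt n) ^ a) \<le> 1"
      by eventually_elim simp
    then show ?thesis by blast
  qed
qed

context
  fixes F :: "nat filter"
  assumes F: "F \<le> sequentially"
begin

lemma eventually_large: "\<forall>\<^sub>F n in F. n \<ge> N"
  using F eventually_ge_at_top[of N] by (rule filter_leD)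

lemma tendsto_sequentially: "(f \<longlongrightarrow> l) sequentially \<Longrightarrow> (f \<longlongrightarrow> l) F"
  using F by (rule tendsto_mono)

lemma embedding_density_nonneg_mean:
  assumes "tame_means F L" "finite V" "E \<in> partial_injections V"
  shows "\<forall>\<^sub>F n in F. 0 \<le> L n (\<lambda>p. embedding_density n p V E)"
  using tame_meansD(1)[OF assms(1)]
proof eventually_elim
  case (elim n)
  show ?case by (rule class_mean.nonneg[OF elim]) (simp add: embedding_density_def)
qed

lemma embedding_density_bounded:
  assumes L: "tame_means F L" and V: "finite V" and E: "E \<in> partial_injections V"
  shows "\<exists>C. \<forall>\<^sub>F n in F. L n (\<lambda>p. embedding_density n p V E) \<le> C"
proof -
  obtain C where "\<forall>\<^sub>F n in F. L n (\<lambda>p. (real (num_cycles n 1 p) / sqrt n) ^ card (loops E)) \<le> C"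
    using tame_meansD(2)[OF L] by blast
  then have "\<forall>\<^sub>F n in F. L n (\<lambda>p. embedding_density n p V E) \<le> C"
    using tame_meansD(1)[OF L] eventually_large[of 1]
  proof eventually_elim
    case (elim n)
    have "L n (\<lambda>p. embedding_density n p V E) \<le> L n (\<lambda>p. (real (num_cycles n 1 p) / sqrt n) ^ card (loops E))"
      by (rule class_mean.mono[OF elim(2)]) (rule embedding_density_bounds(2)[OF elim(3) _ V E])
    with elim(1) show ?case by simp
  qed
  then show ?thesis by blast
qed

lemma embedding_density_tendsto_0:
  assumes L: "scarce_means F L" and V: "finite V" and E: "E \<in> partial_injections V" "E \<noteq> {}"
  shows "((\<lambda>n. L n (\<lambda>p. embedding_density n p V E)) \<longlongrightarrow> 0) F"
proof -
  have ev: "\<forall>\<^sub>F n in F. class_mean n (L n)" using L by (simp add: scarce_means_def)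
  have nn: "\<forall>\<^sub>F n in F. 0 \<le> L n (\<lambda>p. embedding_density n p V E)"
    by (rule embedding_density_nonneg_mean[OF scarce_imp_tame[OF L] V E(1)])
  show ?thesis
  proof (cases "loops E = {}")
    case False
    have "finite (loops E)"
      by (rule finite_subset[of _ V]) (use partial_injectionsD(1)[OF E(1)] V in \<open>auto simp: loops_def\<close>)
    with False have "card (loops E) \<ge> 1" by (simp add: Suc_le_eq card_gt_0_iff)
    then have lim: "((\<lambda>n. L n (\<lambda>p. (real (num_cycles n 1 p) / sqrt n) ^ card (loops E))) \<longlongrightarrow> 0) F"
      using L by (simp add: scarce_means_def)
    have "\<forall>\<^sub>F n in F. L n (\<lambda>p. embedding_density n p V E) \<le>
        L n (\<lambda>p. (real (num_cycles n 1 p) / sqrt n) ^ card (loops E))"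
      using ev eventually_large[of 1]
    proof eventually_elim
      case (elim n)
      show ?case
        by (rule class_mean.mono[OF elim(1)]) (rule embedding_density_bounds(2)[OF elim(2) _ V E(1)])
    qed
    from tendsto_sandwich[OF nn this tendsto_const lim] show ?thesis .
  next
    case True
    have "((\<lambda>n. 1 / sqrt (real n)) \<longlongrightarrow> 0) F" by (rule tendsto_sequentially) real_asymp
    then have "((\<lambda>n. 1 / sqrt (real n) + 2 * L n (\<lambda>p. real (num_cycles n 2 p) / n)) \<longlongrightarrow> 0 + 2 * 0) F"
      using L by (intro tendsto_intros) (auto simp: scarce_means_def)
    then have lim: "((\<lambda>n. 1 / sqrt (real n) + 2 * L n (\<lambda>p. real (num_cycles n 2 p) / n)) \<longlongrightarrow> 0) F" by simp
    have "\<forall>\<^sub>F n in F. L n (\<lambda>p. embedding_density n p V E) \<le>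
        1 / sqrt (real n) + 2 * L n (\<lambda>p. real (num_cycles n 2 p) / n)"
      using ev eventually_large[of 1]
    proof eventually_elim
      case (elim n)
      interpret class_mean n "L n" by fact
      have "L n (\<lambda>p. embedding_density n p V E) \<le> L n (\<lambda>p. 1 / sqrt n + 2 * (real (num_cycles n 2 p) / n))"
        by (rule mono) (use embedding_density_bounds(3)[OF elim(2) _ V E True] in simp)
      then show ?case unfolding add scale const .
    qed
    from tendsto_sandwich[OF nn this tendsto_const lim] show ?thesis .
  qed
qed

lemma falling_factorial_ratio: "(\<lambda>n. fact k * real (n choose k) / real n ^ k) \<longlonglongrightarrow> 1"
proof (induction k)
  case (Suc k)
  have "(\<lambda>n. real (n - k) / real n) \<longlonglongrightarrow> 1"
  proof (rule Lim_transform_eventually)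
    show "(\<lambda>n. 1 - real k / real n) \<longlonglongrightarrow> 1" by real_asymp
    show "\<forall>\<^sub>F n in sequentially. 1 - real k / real n = real (n - k) / real n"
      using eventually_ge_at_top[of "Suc k"] by eventually_elim (simp add: field_simps of_nat_diff)
  qed
  then have "(\<lambda>n. (fact k * real (n choose k) / real n ^ k) * (real (n - k) / real n)) \<longlonglongrightarrow> 1 * 1"
    using Suc by (intro tendsto_mult)
  moreover have "(fact k * real (n choose k) / real n ^ k) * (real (n - k) / real n) =
      fact (Suc k) * real (n choose Suc k) / real n ^ Suc k" for n
  proof -
    have "fact (Suc k) * (n choose Suc k) = fact k * (n choose k) * (n - k)"
      using prod_falling_factorial[where j = 1 and N = n and r = k]
        prod_falling_factorial[where j = 1 and N = n and r = "Suc k"] by simp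
    then have "real (fact (Suc k) * (n choose Suc k)) = real (fact k * (n choose k) * (n - k))" by simp
    then show ?thesis by (simp only: of_nat_mult of_nat_fact power_Suc times_divide_times_eq) (simp add: mult_ac)
  qed
  ultimately show ?case by simp
qed (use tendsto_const in simp)

lemma fact_ratio: "(\<lambda>n. fact (n - k) * real n ^ k / fact n) \<longlonglongrightarrow> 1"
proof (rule Lim_transform_eventually)
  show "(\<lambda>n. inverse (fact k * real (n choose k) / real n ^ k)) \<longlonglongrightarrow> 1"
    using tendsto_inverse[OF falling_factorial_ratio[of k]] by simp
  show "\<forall>\<^sub>F n in sequentially. inverse (fact k * real (n choose k) / real n ^ k) = fact (n - k) * real n ^ k / fact n"
    using eventually_ge_at_top[of k] by eventually_elim (simp add: binomial_fact field_simps)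
qed

text \<open>
  Nonempty patterns have proportion \<open>O(1 / sqrt n)\<close>, so almost every tuple satisfies no equation at all.
\<close>

lemma free_density_mean_tendsto_1:
  assumes L: "tame_means F L" and V: "finite V"
  shows "((\<lambda>n. L n (\<lambda>p. free_density n p V)) \<longlongrightarrow> 1) F"
proof -
  note ev = tame_meansD(1)[OF L]
  have fin: "finite (partial_injections V - {{}})" using V by simp
  have "\<exists>C. \<forall>E\<in>partial_injections V - {{}}. \<forall>\<^sub>F n in F. L n (\<lambda>p. embedding_density n p V E) \<le> C E"
    using embedding_density_bounded[OF L V] by (intro bchoice) auto
  then obtain C where C: "\<And>E. E \<in> partial_injections V - {{}} \<Longrightarrow>
      \<forall>\<^sub>F n in F. L n (\<lambda>p. embedding_density n p V E) \<le> C E" by blast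
  then have Call: "\<forall>\<^sub>F n in F. \<forall>E\<in>partial_injections V - {{}}. L n (\<lambda>p. embedding_density n p V E) \<le> C E"
    using fin by (simp add: eventually_ball_finite)
  define S where "S = (\<Sum>E\<in>partial_injections V - {{}}. C E)"
  have lower: "\<forall>\<^sub>F n in F. fact (card V) * real (n choose card V) / real n ^ card V - S * (1 / sqrt n) \<le>
      L n (\<lambda>p. free_density n p V)"
    using ev eventually_large[of 1] Call
  proof eventually_elim
    case (elim n)
    interpret class_mean n "L n" by fact
    have "L n (\<lambda>p. real (card (tuples n V)) / real n ^ card V -
      (\<Sum>E\<in>partial_injections V - {{}}. embedding_density n p V E / sqrt n)) \<le> L n (\<lambda>p. free_density n p V)"
      by (rule mono) (rule free_density_bounds(3)[OF _ V elim(2)])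
    then have "real (card (tuples n V)) / real n ^ card V -
      (\<Sum>E\<in>partial_injections V - {{}}. L n (\<lambda>p. embedding_density n p V E) / sqrt n) \<le> L n (\<lambda>p. free_density n p V)"
      unfolding diff const sum[OF fin] divide .
    moreover have "(\<Sum>E\<in>partial_injections V - {{}}. L n (\<lambda>p. embedding_density n p V E) / sqrt n)
        \<le> (\<Sum>E\<in>partial_injections V - {{}}. C E / sqrt n)"
      using elim(3) by (intro sum_mono divide_right_mono) auto
    moreover have "\<dots> = S * (1 / sqrt n)" by (simp add: S_def sum_divide_distrib)
    ultimately show ?case by (simp add: card_tuples[OF V])
  qed
  have upper: "\<forall>\<^sub>F n in F. L n (\<lambda>p. free_density n p V) \<le> 1"
    using ev eventually_large[of 1]
  proof eventually_elim
    case (elim n)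
    show ?case by (rule class_mean.upper[OF elim(1)]) (rule free_density_bounds(2)[OF _ V elim(2)])
  qed
  have "(\<lambda>n. 1 / sqrt (real n)) \<longlonglongrightarrow> 0" by real_asymp
  then have "(\<lambda>n. fact (card V) * real (n choose card V) / real n ^ card V - S * (1 / sqrt n)) \<longlonglongrightarrow> 1 - S * 0"
    by (intro tendsto_intros falling_factorial_ratio)
  then have lim: "((\<lambda>n. fact (card V) * real (n choose card V) / real n ^ card V - S * (1 / sqrt n)) \<longlongrightarrow> 1) F"
    by (intro tendsto_sequentially) simp
  show ?thesis by (rule tendsto_sandwich[OF lower upper lim tendsto_const])
qed

end

text \<open>
  A power is bounded by the factorial power of the same order, up to constants: for \<open>N \<ge> 2 * a\<close> every
  factor \<open>N - i\<close> is at least \<open>N / 2\<close>, and the last summand covers the small \<open>N\<close>.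
\<close>

lemma power_le_choose:
  fixes N a :: nat
  shows "real N ^ a \<le> 2 ^ a * (fact a * real (N choose a)) + (2 * real a) ^ a"
proof (cases "N \<ge> 2 * a")
  case True
  have "fact a * (N choose a) = (\<Prod>i<a. N - i)" using prod_falling_factorial[where j = 1 and N = N and r = a] by simp
  then have eq: "fact a * real (N choose a) = (\<Prod>i<a. real (N - i))" by (metis of_nat_fact of_nat_mult of_nat_prod)
  have "real N ^ a = 2 ^ a * (\<Prod>i<a. real N / 2)" by (simp add: power_divide)
  also have "\<dots> \<le> 2 ^ a * (\<Prod>i<a. real (N - i))"
    using True by (intro mult_left_mono prod_mono) auto
  finally show ?thesis unfolding eq by (simp add: add_increasing2)
next
  case False
  then have "real N ^ a \<le> (2 * real a) ^ a" by (intro power_mono) auto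
  then show ?thesis by (simp add: add_increasing)
qed

context
  fixes F :: "nat filter"
  assumes F: "F \<le> sequentially"
begin

lemma mean_product_embeddings_bounded:
  assumes L1: "tame_means F L1" and L2: "tame_means F L2" and V: "finite V" and \<pi>: "bij_betw \<pi> V V"
  shows "\<exists>C. \<forall>\<^sub>F n in F. mean_product (L1 n) (L2 n) (\<lambda>p. real (card (embeddings n p V (graph_on V \<pi>)))) \<le> C"
proof -
  have fin: "finite (partial_injections V - {{}})" using V by simp
  have "\<exists>C. \<forall>E\<in>partial_injections V. \<forall>\<^sub>F n in F. L1 n (\<lambda>p. embedding_density n p V E) \<le> C E"
    using embedding_density_bounded[OF F L1 V] by (intro bchoice) auto
  then obtain C1 where C1: "\<And>E. E \<in> partial_injections V \<Longrightarrow>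
      \<forall>\<^sub>F n in F. L1 n (\<lambda>p. embedding_density n p V E) \<le> C1 E" by blast
  have "\<exists>C. \<forall>E\<in>partial_injections V. \<forall>\<^sub>F n in F. L2 n (\<lambda>p. embedding_density n p V E) \<le> C E"
    using embedding_density_bounded[OF F L2 V] by (intro bchoice) auto
  then obtain C2 where C2: "\<And>E. E \<in> partial_injections V \<Longrightarrow>
      \<forall>\<^sub>F n in F. L2 n (\<lambda>p. embedding_density n p V E) \<le> C2 E" by blast
  have all1: "\<forall>\<^sub>F n in F. \<forall>E\<in>partial_injections V - {{}}. L1 n (\<lambda>p. embedding_density n p V (twist \<pi> E)) \<le> C1 (twist \<pi> E)"
    using fin C1 twist_partial_injection(1)[OF _ \<pi>] by (simp add: eventually_ball_finite)
  have all2: "\<forall>\<^sub>F n in F. \<forall>E\<in>partial_injections V - {{}}. L2 n (\<lambda>p. embedding_density n p V E) \<le> C2 E"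
    using fin C2 by (simp add: eventually_ball_finite)
  define C where "C = 4 ^ card V + (\<Sum>E\<in>partial_injections V - {{}}. 4 ^ card V * C2 E * C1 (twist \<pi> E))"
  have "\<forall>\<^sub>F n in F. mean_product (L1 n) (L2 n) (\<lambda>p. real (card (embeddings n p V (graph_on V \<pi>)))) \<le> C"
    using tame_meansD(1)[OF L1] tame_meansD(1)[OF L2] all1 all2
      eventually_large[OF F, of 1] eventually_large[OF F, of "4 * card V"]
  proof eventually_elim
    case (elim n)
    interpret L1: class_mean n "L1 n" by fact
    interpret L2: class_mean n "L2 n" by fact
    have nonneg: "0 \<le> embedding_density n p V E" for p and E :: "('a \<times> 'a) set"
      by (simp add: embedding_density_def)
    have "L2 n (\<lambda>d. free_density n d V) \<le> 1" "0 \<le> L2 n (\<lambda>d. free_density n d V)"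
      by (rule L2.upper L2.nonneg, rule free_density_bounds[OF _ V elim(5)], assumption)+
    moreover have "L1 n (\<lambda>d. free_density n d V) \<le> 1" "0 \<le> L1 n (\<lambda>d. free_density n d V)"
      by (rule L1.upper L1.nonneg, rule free_density_bounds[OF _ V elim(5)], assumption)+
    ultimately have a: "L2 n (\<lambda>d. free_density n d V) * L1 n (\<lambda>c. free_density n c V) \<le> 1 * 1"
      by (intro mult_mono) auto
    have "fact (n - 2 * card V) * real n ^ (2 * card V) \<le> 2 ^ (2 * card V) * fact n"
      by (rule fact_diff_le) (use elim in simp)
    then have b: "fact (n - 2 * card V) * real n ^ (2 * card V) / fact n \<le> 4 ^ card V"
      by (simp add: divide_simps power_mult)
    have main: "L2 n (\<lambda>d. free_density n d V) * L1 n (\<lambda>c. free_density n c V) *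
      (fact (n - 2 * card V) * real n ^ (2 * card V) / fact n) \<le> (1 * 1) * 4 ^ card V"
      by (rule mult_mono[OF a b]) auto
    have "(\<Sum>E\<in>partial_injections V - {{}}. 4 ^ card V *
        L2 n (\<lambda>d. embedding_density n d V E) * L1 n (\<lambda>c. embedding_density n c V (twist \<pi> E)))
      \<le> (\<Sum>E\<in>partial_injections V - {{}}. 4 ^ card V * C2 E * C1 (twist \<pi> E))"
    proof (rule sum_mono)
      fix E assume E: "E \<in> partial_injections V - {{}}"
      have "0 \<le> L2 n (\<lambda>d. embedding_density n d V E)" by (rule L2.nonneg[OF nonneg])
      moreover have "0 \<le> L1 n (\<lambda>c. embedding_density n c V (twist \<pi> E))" by (rule L1.nonneg[OF nonneg])
      moreover have "L2 n (\<lambda>d. embedding_density n d V E) \<le> C2 E"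
        "L1 n (\<lambda>c. embedding_density n c V (twist \<pi> E)) \<le> C1 (twist \<pi> E)" using elim E by auto
      ultimately show "4 ^ card V * L2 n (\<lambda>d. embedding_density n d V E) * L1 n (\<lambda>c. embedding_density n c V (twist \<pi> E))
          \<le> 4 ^ card V * C2 E * C1 (twist \<pi> E)"
        by (intro mult_mono) auto
    qed
    with main mean_product_embeddings_bounds(2)[OF elim(1,2) V \<pi> elim(6,5)]
    show ?case unfolding C_def by linarith
  qed
  then show ?thesis by blast
qed

lemma mean_product_embeddings_tendsto_1:
  assumes L1: "tame_means F L1" and L2: "tame_means F L2" and scarce: "scarce_means F L1 \<or> scarce_means F L2"
    and V: "finite V" and \<pi>: "bij_betw \<pi> V V"
  shows "((\<lambda>n. mean_product (L1 n) (L2 n) (\<lambda>p. real (card (embeddings n p V (graph_on V \<pi>))))) \<longlongrightarrow> 1) F"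
proof -
  let ?main = "\<lambda>n. L2 n (\<lambda>d. free_density n d V) * L1 n (\<lambda>c. free_density n c V) *
      (fact (n - 2 * card V) * real n ^ (2 * card V) / fact n)"
  let ?rest = "\<lambda>n. \<Sum>E\<in>partial_injections V - {{}}. 4 ^ card V *
        L2 n (\<lambda>d. embedding_density n d V E) * L1 n (\<lambda>c. embedding_density n c V (twist \<pi> E))"
  have "(?main \<longlongrightarrow> 1 * 1 * 1) F"
    by (rule tendsto_mult[OF tendsto_mult[OF free_density_mean_tendsto_1[OF F L2 V] free_density_mean_tendsto_1[OF F L1 V]]
          tendsto_sequentially[OF F fact_ratio[OF F]]])
  then have main: "(?main \<longlongrightarrow> 1) F" by simp
  have "((\<lambda>n. L2 n (\<lambda>d. embedding_density n d V E) * L1 n (\<lambda>c. embedding_density n c V (twist \<pi> E))) \<longlongrightarrow> 0) F"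
    if E: "E \<in> partial_injections V - {{}}" for E
  proof -
    have E': "E \<in> partial_injections V" "E \<noteq> {}" using E by auto
    note tw = twist_partial_injection[OF E'(1) \<pi>]
    have Bf: "Bfun (\<lambda>n. L n (\<lambda>d. embedding_density n d V E)) F"
      if L: "tame_means F L" and E: "E \<in> partial_injections V" for L and E :: "('a \<times> 'a) set"
    proof -
      obtain C where C: "\<forall>\<^sub>F n in F. L n (\<lambda>p. embedding_density n p V E) \<le> C"
        using embedding_density_bounded[OF F L V E] by blast
      have "\<forall>\<^sub>F n in F. norm (L n (\<lambda>p. embedding_density n p V E)) \<le> C"
        using C embedding_density_nonneg_mean[OF F L V E] by eventually_elim simp
      then show ?thesis by (rule BfunI)
    qed
    from scarce show ?thesis
    proof
      assume "scarce_means F L1"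
      from embedding_density_tendsto_0[OF F this V tw(1)] tw(3) E'(2)
      have "((\<lambda>n. L1 n (\<lambda>c. embedding_density n c V (twist \<pi> E))) \<longlongrightarrow> 0) F" by blast
      then show ?thesis
        using bounded_bilinear.Bfun_prod_Zfun[OF bounded_bilinear_mult Bf[OF L2 E'(1)]] by (simp add: tendsto_Zfun_iff)
    next
      assume "scarce_means F L2"
      from embedding_density_tendsto_0[OF F this V E']
      show ?thesis
        using bounded_bilinear.Zfun_prod_Bfun[OF bounded_bilinear_mult _ Bf[OF L1 tw(1)]] by (simp add: tendsto_Zfun_iff)
    qed
  qed
  then have "(?rest \<longlongrightarrow> (\<Sum>E\<in>partial_injections V - {{}}. 4 ^ card V * 0)) F"
    unfolding mult.assoc by (intro tendsto_sum tendsto_mult_left)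
  then have "((\<lambda>n. ?main n + ?rest n) \<longlongrightarrow> 1 + 0) F"
    using main by (intro tendsto_add) simp_all
  then have upper: "((\<lambda>n. ?main n + ?rest n) \<longlongrightarrow> 1) F" by simp
  have ev: "\<forall>\<^sub>F n in F. ?main n \<le> mean_product (L1 n) (L2 n) (\<lambda>p. real (card (embeddings n p V (graph_on V \<pi>)))) \<and>
      mean_product (L1 n) (L2 n) (\<lambda>p. real (card (embeddings n p V (graph_on V \<pi>)))) \<le> ?main n + ?rest n"
    using tame_meansD(1)[OF L1] tame_meansD(1)[OF L2] eventually_large[OF F, of 1] eventually_large[OF F, of "4 * card V"]
  proof eventually_elim
    case (elim n)
    from mean_product_embeddings_bounds[OF elim(1,2) V \<pi> elim(4,3)] show ?case by blast
  qed
  show ?thesis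
    by (rule tendsto_sandwich[OF _ _ main upper]) (use ev in \<open>auto elim: eventually_mono\<close>)
qed

text \<open>
  The factorial moments of the numbers of fixed points and of 2-cycles of a product are
  numbers of solutions, hence bounded; after normalisation by powers of \<open>sqrt n\<close> or by \<open>n\<close> they vanish in the limit.
\<close>

lemma mean_product_scarce:
  assumes L1: "tame_means F L1" and L2: "tame_means F L2"
  shows "scarce_means F (\<lambda>n. mean_product (L1 n) (L2 n))"
  unfolding scarce_means_def
proof (intro conjI allI impI)
  let ?L = "\<lambda>n. mean_product (L1 n) (L2 n)"
  show ev: "\<forall>\<^sub>F n in F. class_mean n (?L n)"
    using tame_meansD(1)[OF L1] tame_meansD(1)[OF L2] by eventually_elim (rule class_mean_product)
  have nn: "\<forall>\<^sub>F n in F. 0 \<le> ?L n (f n)" if "\<And>n p. 0 \<le> f n p" for f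
    using ev
  proof eventually_elim
    case (elim n)
    show ?case by (rule class_mean.nonneg[OF elim that])
  qed
  {
    fix a :: nat assume a: "1 \<le> a"
    obtain C where C: "\<forall>\<^sub>F n in F. ?L n (\<lambda>p. real (card (embeddings n p {..<a} (graph_on {..<a} (\<lambda>v. v))))) \<le> C"
      using mean_product_embeddings_bounded[OF L1 L2, of "{..<a}" "\<lambda>v. v"] by (auto simp: bij_betw_def)
    let ?B = "\<lambda>n. (2 ^ a * C + (2 * real a) ^ a) * (1 / sqrt (real n)) ^ a"
    have "((\<lambda>n. 1 / sqrt (real n)) \<longlongrightarrow> 0) F" by (rule tendsto_sequentially[OF F]) real_asymp
    then have "(?B \<longlongrightarrow> (2 ^ a * C + (2 * real a) ^ a) * 0 ^ a) F" by (intro tendsto_intros)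
    then have lim: "(?B \<longlongrightarrow> 0) F" using a by (simp add: power_0_left)
    have "\<forall>\<^sub>F n in F. ?L n (\<lambda>p. (real (num_cycles n 1 p) / sqrt n) ^ a) \<le> ?B n"
      using ev C
    proof eventually_elim
      case (elim n)
      interpret class_mean n "?L n" by fact
      have "?L n (\<lambda>p. real (num_cycles n 1 p) ^ a) \<le>
          ?L n (\<lambda>p. 2 ^ a * real (card (embeddings n p {..<a} (graph_on {..<a} (\<lambda>v. v)))) + (2 * real a) ^ a)"
        by (rule mono) (use power_le_choose in \<open>simp add: card_fixed_embeddings\<close>)
      also have "\<dots> \<le> 2 ^ a * C + (2 * real a) ^ a"
        unfolding add scale const using elim(2) by simp
      finally show ?case by (simp add: power_divide divide divide_right_mono)
    qed
    from tendsto_sandwich[OF nn this tendsto_const lim]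
    show "((\<lambda>n. ?L n (\<lambda>p. (real (num_cycles n 1 p) / sqrt n) ^ a)) \<longlongrightarrow> 0) F" by simp
  next
    obtain C where C: "\<forall>\<^sub>F n in F. ?L n (\<lambda>p. real (card (cycle_embeddings n p [2]))) \<le> C"
      using mean_product_embeddings_bounded[OF L1 L2 finite_cycle_index bij_betw_rotation] by blast
    have "((\<lambda>n. 1 / real n) \<longlongrightarrow> 0) F" by (rule tendsto_sequentially[OF F]) real_asymp
    then have "((\<lambda>n. C / 2 * (1 / real n)) \<longlongrightarrow> C / 2 * 0) F" by (rule tendsto_mult_left)
    then have lim: "((\<lambda>n. C / 2 * (1 / real n)) \<longlongrightarrow> 0) F" by simp
    have "\<forall>\<^sub>F n in F. ?L n (\<lambda>p. real (num_cycles n 2 p) / n) \<le> C / 2 * (1 / real n)"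
      using ev C
    proof eventually_elim
      case (elim n)
      interpret class_mean n "?L n" by fact
      have "card (cycle_embeddings n p [2]) = 2 * num_cycles n 2 p" if "p permutes {1..n}" for p
        using card_cycle_embeddings_snoc[OF that, of 2 "[]"]
        by (simp add: card_period_points[OF that] cycle_embeddings_Nil)
      then have "?L n (\<lambda>p. 2 * real (num_cycles n 2 p)) = ?L n (\<lambda>p. real (card (cycle_embeddings n p [2])))"
        by (intro cong) simp
      with elim(2) have "?L n (\<lambda>p. real (num_cycles n 2 p)) \<le> C / 2" by (simp add: scale)
      from divide_right_mono[OF this, of "real n"] show ?case by (simp add: divide)
    qed
    from tendsto_sandwich[OF nn this tendsto_const lim]
    show "((\<lambda>n. ?L n (\<lambda>p. real (num_cycles n 2 p) / n)) \<longlongrightarrow> 0) F" by simp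
  }
qed

end

section \<open>Uniform permutations with restricted cycle lengths\<close>

definition uniform_mean :: "'a set \<Rightarrow> ('a \<Rightarrow> real) \<Rightarrow> real" where
  "uniform_mean S f = (\<Sum>x\<in>S. f x) / card S"

lemma conjugate_perms_with_cycles:
  assumes p: "p \<in> perms_with_cycles n A" and h: "h permutes {1..n}"
  shows "h \<circ> p \<circ> inv h \<in> perms_with_cycles n A"
proof -
  note pp = perms_with_cyclesD[OF p]
  have perm: "h \<circ> p \<circ> inv h permutes {1..n}"
    by (intro permutes_compose permutes_inv pp h)
  have "card (orbit (h \<circ> p \<circ> inv h) u) \<in> A" if u: "u \<in> {1..n}" for u
  proof -
    define v where "v = inv h u"
    have hv: "h v = u" and v: "v \<in> {1..n}"
      using permutes_inverses[OF h] permutes_closed[OF permutes_inv[OF h] u] by (simp_all add: v_def)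
    have "h ` orbit p v = orbit (h \<circ> p \<circ> inv h) (h v)"
      by (rule orbit_inverse)
         (use permutation_self_in_orbit[OF permutation_of_permutes[OF pp(1)]] permutes_inverses[OF h] in auto)
    then have "card (orbit (h \<circ> p \<circ> inv h) u) = card (orbit p v)"
      using card_image[of h "orbit p v"] permutes_inj_on[OF h] unfolding hv by metis
    then show ?thesis using pp(2)[OF v] by simp
  qed
  with perm show ?thesis by (auto simp: perms_with_cycles_def cycles_of_perm_def)
qed

lemma class_mean_uniform:
  assumes "perms_with_cycles n A \<noteq> {}"
  shows "class_mean n (uniform_mean (perms_with_cycles n A))"
proof -
  let ?S = "perms_with_cycles n A"
  have c0: "card ?S > 0" using assms by (simp add: card_gt_0_iff)
  show ?thesis
  proof
    fix f g :: "(nat \<Rightarrow> nat) \<Rightarrow> real" and a :: real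
    show "uniform_mean ?S (\<lambda>p. f p + g p) = uniform_mean ?S f + uniform_mean ?S g"
      by (simp add: uniform_mean_def sum.distrib add_divide_distrib)
    show "uniform_mean ?S (\<lambda>p. a * f p) = a * uniform_mean ?S f"
      by (simp add: uniform_mean_def flip: sum_distrib_left)
    show "uniform_mean ?S (\<lambda>_. 1) = 1" using assms by (simp add: uniform_mean_def)
    show "uniform_mean ?S f \<le> uniform_mean ?S g" if "\<And>p. p permutes {1..n} \<Longrightarrow> f p \<le> g p"
      unfolding uniform_mean_def
      by (intro divide_right_mono sum_mono that) (auto dest: perms_with_cyclesD)
    fix h :: "nat \<Rightarrow> nat" assume h: "h permutes {1..n}"
    have hi: "inv h permutes {1..n}" "inv (inv h) = h"
      using permutes_inv[OF h] permutes_inv_inv[OF h] by auto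
    have "(\<Sum>p\<in>?S. f (h \<circ> p \<circ> inv h)) = sum f ?S"
      by (rule sum.reindex_bij_witness[where i = "\<lambda>p. inv h \<circ> p \<circ> h" and j = "\<lambda>p. h \<circ> p \<circ> inv h"])
         (use conjugate_perms_with_cycles[OF _ h] conjugate_perms_with_cycles[OF _ hi(1)] hi(2)
            permutes_inverses[OF h] in \<open>auto simp: fun_eq_iff\<close>)
    then show "uniform_mean ?S (\<lambda>p. f (h \<circ> p \<circ> inv h)) = uniform_mean ?S f"
      by (simp add: uniform_mean_def)
  qed
qed

lemma power_le_one_plus_power:
  fixes x :: real assumes "x \<ge> 0" "a \<le> b" shows "x ^ a \<le> 1 + x ^ b"
proof (cases "x \<le> 1")
  case True
  then have "x ^ a \<le> 1" using assms by (intro power_le_one) auto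
  then show ?thesis using assms by (simp add: add_increasing2)
next
  case False
  then have "x ^ a \<le> x ^ b" using assms by (intro power_increasing) auto
  then show ?thesis by simp
qed

text \<open>
  The moments whose order is a multiple of \<open>d\<close> show that the number of fixed points is of order \<open>n powr (1 / d)\<close>; the other
  moments follow because \<open>x ^ a \<le> 1 + x ^ (a * d)\<close> for \<open>x \<ge> 0\<close>.
\<close>

lemma uniform_mean_fixed_points_power:
  assumes ne: "perms_with_cycles n A \<noteq> {}" and d: "d \<in> A" "d \<ge> 2" and n: "n \<ge> 1"
  shows "uniform_mean (perms_with_cycles n A) (\<lambda>p. (real (num_cycles n 1 p) / sqrt n) ^ a)
    \<le> (1 + 2 ^ (a * d) + (2 * real (a * d)) ^ (a * d)) * (real n powr (1 / d) / sqrt n) ^ a"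
proof -
  let ?S = "perms_with_cycles n A"
  interpret class_mean n "uniform_mean ?S" by (rule class_mean_uniform[OF ne])
  define t where "t = real n powr (1 / d)"
  have t: "t > 0" and td: "t ^ (a * d) = real n ^ a"
    using n d by (simp_all add: t_def powr_powr flip: powr_realpow)
  have na: "real n ^ a \<ge> 1" using n by simp
  have c0: "card ?S > 0" using ne by (simp add: card_gt_0_iff)
  have "real (\<Sum>c\<in>?S. fact (a * d) * (num_cycles n 1 c choose (a * d))) \<le> real (n ^ a * card ?S)"
    using sum_fixed_points_le[OF d(1), where n = n and q = a] d(2) by (simp only: of_nat_le_iff) 
  then have m: "uniform_mean ?S (\<lambda>p. fact (a * d) * real (num_cycles n 1 p choose (a * d))) \<le> real n ^ a"
    using c0 by (simp add: uniform_mean_def divide_simps)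
  have "uniform_mean ?S (\<lambda>p. real (num_cycles n 1 p) ^ (a * d)) \<le>
      uniform_mean ?S (\<lambda>p. 2 ^ (a * d) * (fact (a * d) * real (num_cycles n 1 p choose (a * d))) + (2 * real (a * d)) ^ (a * d))"
    by (rule mono) (rule power_le_choose)
  also have "\<dots> = 2 ^ (a * d) * uniform_mean ?S (\<lambda>p. fact (a * d) * real (num_cycles n 1 p choose (a * d))) +
      (2 * real (a * d)) ^ (a * d)"
    unfolding add scale const ..
  also have "\<dots> \<le> 2 ^ (a * d) * real n ^ a + (2 * real (a * d)) ^ (a * d)"
    by (intro add_right_mono mult_left_mono m) simp
  also have "\<dots> \<le> 2 ^ (a * d) * real n ^ a + (2 * real (a * d)) ^ (a * d) * real n ^ a"
    using mult_left_mono[OF na, of "(2 * real (a * d)) ^ (a * d)"] by simp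
  also have "\<dots> = (2 ^ (a * d) + (2 * real (a * d)) ^ (a * d)) * real n ^ a" by (simp add: distrib_right)
  finally have moment: "uniform_mean ?S (\<lambda>p. (real (num_cycles n 1 p) / t) ^ (a * d)) \<le>
      2 ^ (a * d) + (2 * real (a * d)) ^ (a * d)"
    unfolding power_divide divide td using n by (simp add: divide_simps)
  have "uniform_mean ?S (\<lambda>p. (real (num_cycles n 1 p) / t) ^ a) \<le>
      uniform_mean ?S (\<lambda>p. 1 + (real (num_cycles n 1 p) / t) ^ (a * d))"
    by (rule mono, rule power_le_one_plus_power) (use t d in auto)
  also have "\<dots> \<le> 1 + 2 ^ (a * d) + (2 * real (a * d)) ^ (a * d)"
    unfolding add one using moment by simp
  finally have 1: "uniform_mean ?S (\<lambda>p. (real (num_cycles n 1 p) / t) ^ a) \<le> 1 + 2 ^ (a * d) + (2 * real (a * d)) ^ (a * d)" .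
  have "uniform_mean ?S (\<lambda>p. (real (num_cycles n 1 p) / sqrt n) ^ a) =
      uniform_mean ?S (\<lambda>p. (real (num_cycles n 1 p) / t) ^ a) * (t / sqrt n) ^ a"
    unfolding scale_right[symmetric] using t by (simp flip: power_mult_distrib)
  also have "\<dots> \<le> (1 + 2 ^ (a * d) + (2 * real (a * d)) ^ (a * d)) * (t / sqrt n) ^ a"
    using 1 t by (intro mult_right_mono) auto
  finally show ?thesis by (simp add: t_def)
qed

text \<open>
  The moment of order \<open>d\<close> is \<open>O(n\<^sup>2)\<close>, so the number of cycles of length 2 has order at most
  \<open>n powr (2 / d)\<close>, and \<open>d \<ge> 3\<close> makes this at most \<open>n powr (2 / 3)\<close>.
\<close>

lemma uniform_mean_two_cycles:
  assumes ne: "perms_with_cycles n A \<noteq> {}" and d: "d \<in> A" "d \<ge> 3" and n: "n \<ge> 1"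
  shows "uniform_mean (perms_with_cycles n A) (\<lambda>p. real (num_cycles n 2 p) / n)
    \<le> (2 + (2 * real d) ^ d) * (real n powr (2 / 3) / n)"
proof -
  let ?S = "perms_with_cycles n A"
  interpret class_mean n "uniform_mean ?S" by (rule class_mean_uniform[OF ne])
  define t where "t = real n powr (2 / 3)"
  have t: "t \<ge> 1" using n by (simp add: t_def ge_one_powr_ge_zero)
  have "t powr 3 = real n powr 2" by (simp add: t_def powr_powr)
  then have "real n ^ 2 = t ^ 3" using n t by simp
  also have "\<dots> \<le> t ^ d" using d t by (intro power_increasing) auto
  finally have td: "real n ^ 2 \<le> t ^ d" .
  have td1: "t ^ d \<ge> 1" using t by simp
  have c0: "card ?S > 0" using ne by (simp add: card_gt_0_iff)
  have "real (\<Sum>c\<in>?S. 2 ^ d * (fact d * (num_cycles n 2 c choose d))) \<le> real (n\<^sup>2 * card ?S)"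
    using sum_two_cycles_le[OF d(1), where n = n] d(2) by (simp only: of_nat_le_iff)
  then have m: "uniform_mean ?S (\<lambda>p. 2 ^ d * (fact d * real (num_cycles n 2 p choose d))) \<le> real n ^ 2"
    using c0 by (simp add: uniform_mean_def divide_simps)
  have "uniform_mean ?S (\<lambda>p. real (num_cycles n 2 p) ^ d) \<le>
      uniform_mean ?S (\<lambda>p. 2 ^ d * (fact d * real (num_cycles n 2 p choose d)) + (2 * real d) ^ d)"
    by (rule mono) (rule power_le_choose)
  also have "\<dots> = uniform_mean ?S (\<lambda>p. 2 ^ d * (fact d * real (num_cycles n 2 p choose d))) + (2 * real d) ^ d"
    unfolding add const ..
  also have "\<dots> \<le> t ^ d + (2 * real d) ^ d * t ^ d"
  proof (rule add_mono)
    show "(2 * real d) ^ d \<le> (2 * real d) ^ d * t ^ d"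
      using mult_left_mono[OF td1, of "(2 * real d) ^ d"] by simp
  qed (use m td in simp)
  finally have moment: "uniform_mean ?S (\<lambda>p. (real (num_cycles n 2 p) / t) ^ d) \<le> 1 + (2 * real d) ^ d"
    unfolding power_divide divide using t by (simp add: divide_simps distrib_right)
  have "uniform_mean ?S (\<lambda>p. real (num_cycles n 2 p) / t) \<le>
      uniform_mean ?S (\<lambda>p. 1 + (real (num_cycles n 2 p) / t) ^ d)"
    by (rule mono) (use power_le_one_plus_power[of _ 1 d] t d in auto)
  also have "\<dots> \<le> 2 + (2 * real d) ^ d" unfolding add one using moment by simp
  finally have 1: "uniform_mean ?S (\<lambda>p. real (num_cycles n 2 p) / t) \<le> 2 + (2 * real d) ^ d" .
  have "uniform_mean ?S (\<lambda>p. real (num_cycles n 2 p) / n) =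
      uniform_mean ?S (\<lambda>p. real (num_cycles n 2 p) / t) * (t / n)"
    unfolding scale_right[symmetric] using t by simp
  also have "\<dots> \<le> (2 + (2 * real d) ^ d) * (t / n)"
    using 1 t by (intro mult_right_mono) auto
  finally show ?thesis by (simp add: t_def)
qed

lemma eventually_class_mean_uniform:
  assumes ne: "\<forall>\<^sub>F n in F. perms_with_cycles n A \<noteq> {}"
  shows "\<forall>\<^sub>F n in F. class_mean n (uniform_mean (perms_with_cycles n A))"
  using ne by eventually_elim (rule class_mean_uniform)

lemma uniform_mean_tame:
  assumes F: "F \<le> sequentially" and ne: "\<forall>\<^sub>F n in F. perms_with_cycles n A \<noteq> {}" and d: "d \<in> A" "d \<ge> 2"
  shows "tame_means F (\<lambda>n. uniform_mean (perms_with_cycles n A))"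
  unfolding tame_means_def
proof (intro conjI allI)
  show "\<forall>\<^sub>F n in F. class_mean n (uniform_mean (perms_with_cycles n A))"
    by (rule eventually_class_mean_uniform[OF ne])
  fix a :: nat
  define C where "C = 1 + 2 ^ (a * d) + (2 * real (a * d)) ^ (a * d)"
  have "\<forall>\<^sub>F n in F. uniform_mean (perms_with_cycles n A) (\<lambda>p. (real (num_cycles n 1 p) / sqrt n) ^ a) \<le> C"
    using ne eventually_large[OF F, of 1]
  proof eventually_elim
    case (elim n)
    have "real n powr (1 / d) \<le> real n powr (1 / 2)"
      using d elim(2) by (intro powr_mono) (auto simp: divide_simps)
    then have "real n powr (1 / d) / sqrt n \<le> 1" using elim(2) by (simp add: powr_half_sqrt)
    then have "(real n powr (1 / d) / sqrt n) ^ a \<le> 1" by (intro power_le_one) auto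
    then have "C * (real n powr (1 / d) / sqrt n) ^ a \<le> C * 1" by (rule mult_left_mono) (simp add: C_def)
    with uniform_mean_fixed_points_power[OF elim(1) d elim(2), of a] show ?case
      unfolding C_def[symmetric] by simp
  qed
  then show "\<exists>C. \<forall>\<^sub>F n in F. uniform_mean (perms_with_cycles n A) (\<lambda>p. (real (num_cycles n 1 p) / sqrt n) ^ a) \<le> C"
    by blast
qed

lemma uniform_mean_scarce:
  assumes F: "F \<le> sequentially" and ne: "\<forall>\<^sub>F n in F. perms_with_cycles n A \<noteq> {}" and d: "d \<in> A" "d \<ge> 3"
  shows "scarce_means F (\<lambda>n. uniform_mean (perms_with_cycles n A))"
  unfolding scarce_means_def
proof (intro conjI allI impI)
  show ev: "\<forall>\<^sub>F n in F. class_mean n (uniform_mean (perms_with_cycles n A))"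
    by (rule eventually_class_mean_uniform[OF ne])
  have nn: "\<forall>\<^sub>F n in F. 0 \<le> uniform_mean (perms_with_cycles n A) (f n)" if "\<And>n p. 0 \<le> f n p" for f
    by (intro always_eventually allI) (simp add: uniform_mean_def that sum_nonneg)
  {
    fix a :: nat assume a: "1 \<le> a"
    let ?B = "\<lambda>n. (1 + 2 ^ (a * d) + (2 * real (a * d)) ^ (a * d)) * (real n powr (1 / 3) / sqrt n) ^ a"
    have "((\<lambda>n. real n powr (1 / 3) / sqrt n) \<longlongrightarrow> 0) F"
      by (rule tendsto_sequentially[OF F]) real_asymp
    then have "(?B \<longlongrightarrow> (1 + 2 ^ (a * d) + (2 * real (a * d)) ^ (a * d)) * 0 ^ a) F" by (intro tendsto_intros)
    then have lim: "(?B \<longlongrightarrow> 0) F" using a by (simp add: power_0_left)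
    have "\<forall>\<^sub>F n in F. uniform_mean (perms_with_cycles n A) (\<lambda>p. (real (num_cycles n 1 p) / sqrt n) ^ a) \<le> ?B n"
      using ne eventually_large[OF F, of 1]
    proof eventually_elim
      case (elim n)
      have "real n powr (1 / d) \<le> real n powr (1 / 3)"
        using d elim(2) by (intro powr_mono) (auto simp: divide_simps)
      then have "(real n powr (1 / d) / sqrt n) ^ a \<le> (real n powr (1 / 3) / sqrt n) ^ a"
        by (intro power_mono divide_right_mono) auto
      then have "(1 + 2 ^ (a * d) + (2 * real (a * d)) ^ (a * d)) * (real n powr (1 / d) / sqrt n) ^ a \<le> ?B n"
        by (rule mult_left_mono) simp
      moreover have "d \<ge> 2" using d by simp
      ultimately show ?case using uniform_mean_fixed_points_power[OF elim(1) d(1) _ elim(2), of a] by linarith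
    qed
    from tendsto_sandwich[OF nn this tendsto_const lim]
    show "((\<lambda>n. uniform_mean (perms_with_cycles n A) (\<lambda>p. (real (num_cycles n 1 p) / sqrt n) ^ a)) \<longlongrightarrow> 0) F" by simp
  next
    let ?B = "\<lambda>n. (2 + (2 * real d) ^ d) * (real n powr (2 / 3) / n)"
    have "((\<lambda>n. real n powr (2 / 3) / n) \<longlongrightarrow> 0) F"
      by (rule tendsto_sequentially[OF F]) real_asymp
    then have "(?B \<longlongrightarrow> (2 + (2 * real d) ^ d) * 0) F" by (rule tendsto_mult_left)
    then have lim: "(?B \<longlongrightarrow> 0) F" by simp
    have "\<forall>\<^sub>F n in F. uniform_mean (perms_with_cycles n A) (\<lambda>p. real (num_cycles n 2 p) / n) \<le> ?B n"
      using ne eventually_large[OF F, of 1] by eventually_elim (rule uniform_mean_two_cycles[OF _ d])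
    from tendsto_sandwich[OF nn this tendsto_const lim]
    show "((\<lambda>n. uniform_mean (perms_with_cycles n A) (\<lambda>p. real (num_cycles n 2 p) / n)) \<longlongrightarrow> 0) F" by simp
  }
qed

section \<open>From factorial moments to Poisson limits\<close>

lemma alternating_binomial_partial_sum:
  "(\<Sum>s<Suc r. (-1) ^ s * real (Suc m choose s)) = (-1) ^ r * real (m choose r)"
  by (induction r) (simp_all add: algebra_simps)

lemma alternating_binomial_truncation:
  "\<bar>of_bool (m = 0) - (\<Sum>s<r. (-1) ^ s * real (m choose s))\<bar> \<le> real (m choose r)"
proof (cases m)
  case 0
  then show ?thesis by (cases r) (simp_all add: sum.lessThan_Suc_shift del: sum.lessThan_Suc)
next
  case (Suc m')
  show ?thesis
  proof (cases r)
    case (Suc r')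
    then show ?thesis
      unfolding Suc \<open>m = Suc m'\<close> alternating_binomial_partial_sum by (simp add: abs_mult)
  qed (simp add: Suc)
qed

text \<open>
  Inclusion and exclusion for the event that exactly \<open>v\<close> of \<open>N\<close> events occur; after dividing out \<open>N choose v\<close> the
  truncation error is a single binomial coefficient.
\<close>

lemma bonferroni_binomial:
  fixes N v R :: nat
  shows "\<bar>of_bool (N = v) - (\<Sum>s<R. (-1) ^ s * real (v + s choose v) * real (N choose (v + s)))\<bar>
    \<le> real (v + R choose v) * real (N choose (v + R))"
proof (cases "v \<le> N")
  case True
  have choose: "(v + s choose v) * (N choose (v + s)) = (N choose v) * (N - v choose s)" for s
  proof (cases "v + s \<le> N")
    case True
    then show ?thesis using choose_mult[of v "v + s" N] by (simp add: mult.commute)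
  qed (use True in \<open>simp add: binomial_eq_0\<close>)
  have choose': "real (v + s choose v) * real (N choose (v + s)) = real (N choose v) * real (N - v choose s)" for s
    using choose[of s] by (simp flip: of_nat_mult)
  have "of_bool (N = v) - (\<Sum>s<R. (-1) ^ s * real (v + s choose v) * real (N choose (v + s))) =
      real (N choose v) * (of_bool (N - v = 0) - (\<Sum>s<R. (-1) ^ s * real (N - v choose s)))"
    using True by (simp add: mult.assoc choose' right_diff_distrib sum_distrib_left mult.left_commute)
  then have "\<bar>of_bool (N = v) - (\<Sum>s<R. (-1) ^ s * real (v + s choose v) * real (N choose (v + s)))\<bar> =
      real (N choose v) * \<bar>of_bool (N - v = 0) - (\<Sum>s<R. (-1) ^ s * real (N - v choose s))\<bar>"
    by (simp only: abs_mult abs_of_nat)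
  also have "\<dots> \<le> real (N choose v) * real (N - v choose R)"
    by (intro mult_left_mono alternating_binomial_truncation) simp
  finally show ?thesis by (simp only: choose')
qed (simp add: binomial_eq_0)

text \<open>
  Here \<open>x\<close> is approximated by \<open>y R\<close> up to \<open>z R\<close>, and the limit in \<open>n\<close> is taken before the
  limit in the truncation level \<open>R\<close>.
\<close>

lemma tendsto_by_approximation:
  fixes x :: "'a \<Rightarrow> real" and a :: real
  assumes xy: "\<And>R. \<forall>\<^sub>F n in F. \<bar>x n - y R n\<bar> \<le> z R n"
    and y: "\<And>R::nat. (y R \<longlongrightarrow> a' R) F" and z: "\<And>R. (z R \<longlongrightarrow> b R) F"
    and a': "a' \<longlonglongrightarrow> a" and b: "b \<longlonglongrightarrow> 0"
  shows "(x \<longlongrightarrow> a) F"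
proof (rule tendstoI)
  fix e :: real assume e: "e > 0"
  have "\<forall>\<^sub>F R in sequentially. dist (a' R) a < e / 4 \<and> dist (b R) 0 < e / 4"
    using tendstoD[OF a', of "e / 4"] tendstoD[OF b, of "e / 4"] e by (simp add: eventually_conj)
  then obtain R where R: "dist (a' R) a < e / 4" "dist (b R) 0 < e / 4"
    by (auto simp: eventually_sequentially)
  have e4: "e / 4 > 0" using e by simp
  show "\<forall>\<^sub>F n in F. dist (x n) a < e"
    using xy[of R] tendstoD[OF y[of R] e4] tendstoD[OF z[of R] e4]
  proof eventually_elim
    case (elim n)
    then show ?case using R unfolding dist_real_def by linarith
  qed
qed

text \<open>
  The weight \<open>W\<close> carries the other coordinates along, so that a joint law can be treated one coordinate
  at a time.
\<close>

lemma poisson_from_factorial_moments: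
  fixes W :: "nat \<Rightarrow> (nat \<Rightarrow> nat) \<Rightarrow> real" and X :: "nat \<Rightarrow> (nat \<Rightarrow> nat) \<Rightarrow> nat"
  assumes L: "\<forall>\<^sub>F n in F. class_mean n (L n)" and W: "\<And>n p. W n p \<ge> 0"
    and mom: "\<And>r. ((\<lambda>n. L n (\<lambda>p. W n p * real (X n p choose r))) \<longlongrightarrow> w * (\<mu> ^ r / fact r)) F"
  shows "((\<lambda>n. L n (\<lambda>p. W n p * of_bool (X n p = v))) \<longlongrightarrow> w * (\<mu> ^ v / fact v * exp (- \<mu>))) F"
proof (rule tendsto_by_approximation)
  let ?y = "\<lambda>R n. \<Sum>s<R. (-1) ^ s * real (v + s choose v) * L n (\<lambda>p. W n p * real (X n p choose (v + s)))"
  let ?z = "\<lambda>R n. real (v + R choose v) * L n (\<lambda>p. W n p * real (X n p choose (v + R)))"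
  show "\<forall>\<^sub>F n in F. \<bar>L n (\<lambda>p. W n p * of_bool (X n p = v)) - ?y R n\<bar> \<le> ?z R n" for R
    using L
  proof eventually_elim
    case (elim n)
    interpret class_mean n "L n" by fact
    let ?S = "\<lambda>p. \<Sum>s<R. (-1) ^ s * real (v + s choose v) * (W n p * real (X n p choose (v + s)))"
    let ?B = "\<lambda>p. real (v + R choose v) * (W n p * real (X n p choose (v + R)))"
    have "\<bar>W n p * of_bool (X n p = v) - ?S p\<bar> \<le> ?B p" for p
    proof -
      have "W n p * of_bool (X n p = v) - ?S p = W n p * (of_bool (X n p = v) -
          (\<Sum>s<R. (-1) ^ s * real (v + s choose v) * real (X n p choose (v + s))))"
        by (simp add: right_diff_distrib sum_distrib_left mult_ac)
      then have "\<bar>W n p * of_bool (X n p = v) - ?S p\<bar> = W n p * \<bar>of_bool (X n p = v) -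
          (\<Sum>s<R. (-1) ^ s * real (v + s choose v) * real (X n p choose (v + s)))\<bar>"
        using W[of n p] by (simp only: abs_mult abs_of_nonneg)
      also have "\<dots> \<le> W n p * (real (v + R choose v) * real (X n p choose (v + R)))"
        by (intro mult_left_mono bonferroni_binomial W)
      finally show ?thesis by (simp only: mult_ac)
    qed
    then have "W n p * of_bool (X n p = v) \<le> ?S p + ?B p" "?S p \<le> W n p * of_bool (X n p = v) + ?B p" for p
      unfolding abs_diff_le_iff by (simp_all only: diff_le_eq)
    then have "L n (\<lambda>p. W n p * of_bool (X n p = v)) \<le> L n (\<lambda>p. ?S p + ?B p)"
      "L n ?S \<le> L n (\<lambda>p. W n p * of_bool (X n p = v) + ?B p)"
      by (intro mono; blast)+
    then show ?case unfolding add scale sum[OF finite_lessThan] by linarith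
  qed
  show "(?y R \<longlongrightarrow> (\<Sum>s<R. (-1) ^ s * real (v + s choose v) * (w * (\<mu> ^ (v + s) / fact (v + s))))) F" for R
    by (intro tendsto_sum tendsto_mult_left mom)
  show "(?z R \<longlongrightarrow> real (v + R choose v) * (w * (\<mu> ^ (v + R) / fact (v + R)))) F" for R
    by (intro tendsto_mult_left mom)
  have summand: "real (v + s choose v) * (w * (\<mu> ^ (v + s) / fact (v + s))) = w * (\<mu> ^ v / fact v) * (\<mu> ^ s / fact s)" for s
    by (simp add: binomial_fact power_add)
  have ex: "(\<lambda>s. x ^ s / fact s) sums exp x" for x :: real
    using exp_converges[of x] by (simp add: divide_inverse mult.commute)
  have "(\<lambda>R. w * (\<mu> ^ v / fact v) * (\<mu> ^ R / fact R)) \<longlonglongrightarrow> w * (\<mu> ^ v / fact v) * 0"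
    by (intro tendsto_mult_left summable_LIMSEQ_zero sums_summable[OF ex])
  then show "(\<lambda>R. real (v + R choose v) * (w * (\<mu> ^ (v + R) / fact (v + R)))) \<longlonglongrightarrow> 0"
    unfolding summand by simp
  have "(\<lambda>R. w * (\<mu> ^ v / fact v) * (\<Sum>s<R. (- \<mu>) ^ s / fact s)) \<longlonglongrightarrow> w * (\<mu> ^ v / fact v) * exp (- \<mu>)"
    by (intro tendsto_mult_left ex[unfolded sums_def])
  moreover have "w * (\<mu> ^ v / fact v) * (\<Sum>s<R. (- \<mu>) ^ s / fact s) =
      (\<Sum>s<R. (-1) ^ s * real (v + s choose v) * (w * (\<mu> ^ (v + s) / fact (v + s))))" for R
  proof -
    have "w * (\<mu> ^ v / fact v) * ((- \<mu>) ^ s / fact s) =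
        (-1) ^ s * real (v + s choose v) * (w * (\<mu> ^ (v + s) / fact (v + s)))" for s
      by (subst mult.assoc[of "(-1) ^ s"], subst summand, subst power_minus) simp
    then show ?thesis unfolding sum_distrib_left by simp
  qed
  ultimately show "(\<lambda>R. \<Sum>s<R. (-1) ^ s * real (v + s choose v) * (w * (\<mu> ^ (v + s) / fact (v + s))))
      \<longlonglongrightarrow> w * (\<mu> ^ v / fact v * exp (- \<mu>))"
    by (simp add: mult.assoc)
qed

lemma joint_poisson_from_factorial_moments:
  fixes X :: "nat \<Rightarrow> nat \<Rightarrow> (nat \<Rightarrow> nat) \<Rightarrow> nat" and rate :: "nat \<Rightarrow> real"
  assumes L: "\<forall>\<^sub>F n in F. class_mean n (L n)" and I: "finite I"
    and mom: "\<And>r. ((\<lambda>n. L n (\<lambda>p. \<Prod>j\<in>I. real (X n j p choose r j))) \<longlongrightarrow> (\<Prod>j\<in>I. rate j ^ r j / fact (r j))) F"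
  shows "((\<lambda>n. L n (\<lambda>p. of_bool (\<forall>j\<in>I. X n j p = v j))) \<longlongrightarrow> (\<Prod>j\<in>I. rate j ^ v j / fact (v j) * exp (- rate j))) F"
proof -
  have "((\<lambda>n. L n (\<lambda>p. (\<Prod>j\<in>J. of_bool (X n j p = v j)) * (\<Prod>j\<in>I - J. real (X n j p choose r j)))) \<longlongrightarrow>
      (\<Prod>j\<in>J. rate j ^ v j / fact (v j) * exp (- rate j)) * (\<Prod>j\<in>I - J. rate j ^ r j / fact (r j))) F"
    if "finite J" "J \<subseteq> I" for J r
    using that
  proof (induction J arbitrary: r rule: finite_induct)
    case empty
    then show ?case using mom[of r] by simp
  next
    case (insert i J)
    let ?W = "\<lambda>n p. (\<Prod>j\<in>J. of_bool (X n j p = v j)) * (\<Prod>j\<in>I - insert i J. real (X n j p choose r j))"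
    let ?w = "(\<Prod>j\<in>J. rate j ^ v j / fact (v j) * exp (- rate j)) * (\<Prod>j\<in>I - insert i J. rate j ^ r j / fact (r j))"
    have split: "I - J = insert i (I - insert i J)" "i \<notin> I - insert i J" "finite (I - insert i J)"
      using insert I by auto
    have "((\<lambda>n. L n (\<lambda>p. ?W n p * of_bool (X n i p = v i))) \<longlongrightarrow> ?w * (rate i ^ v i / fact (v i) * exp (- rate i))) F"
    proof (rule poisson_from_factorial_moments[OF L])
      fix k
      have "(\<Prod>j\<in>I - J. real (X n j p choose (r(i := k)) j)) =
          real (X n i p choose k) * (\<Prod>j\<in>I - insert i J. real (X n j p choose r j))" for n p
        unfolding split(1) prod.insert[OF split(3,2)] by (auto intro!: prod.cong)
      moreover have "(\<Prod>j\<in>I - J. rate j ^ (r(i := k)) j / fact ((r(i := k)) j)) =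
          rate i ^ k / fact k * (\<Prod>j\<in>I - insert i J. rate j ^ r j / fact (r j))"
        unfolding split(1) prod.insert[OF split(3,2)] by (auto intro!: prod.cong)
      ultimately show "((\<lambda>n. L n (\<lambda>p. ?W n p * real (X n i p choose k))) \<longlongrightarrow> ?w * (rate i ^ k / fact k)) F"
        using insert.IH[of "r(i := k)"] insert.prems by (simp add: mult_ac)
    qed (simp add: prod_nonneg)
    then show ?case using insert.hyps by (simp add: mult_ac)
  qed
  from this[OF I order_refl] have "((\<lambda>n. L n (\<lambda>p. \<Prod>j\<in>I. of_bool (X n j p = v j))) \<longlongrightarrow>
      (\<Prod>j\<in>I. rate j ^ v j / fact (v j) * exp (- rate j))) F" by simp
  moreover have "(\<Prod>j\<in>I. of_bool (X n j p = v j)) = (of_bool (\<forall>j\<in>I. X n j p = v j) :: real)" for n p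
  proof (cases "\<forall>j\<in>I. X n j p = v j")
    case False
    then show ?thesis using I by (auto simp: prod_zero_iff)
  qed simp
  ultimately show ?thesis by simp
qed

lemma cycle_counts_pointwise_limit:
  assumes L: "\<forall>\<^sub>F n in F. class_mean n (L n)"
    and emb: "\<And>js. 0 \<notin> set js \<Longrightarrow> ((\<lambda>n. L n (\<lambda>p. real (card (cycle_embeddings n p js)))) \<longlongrightarrow> 1) F"
  shows "((\<lambda>n. L n (\<lambda>p. of_bool (\<forall>j\<in>{1..l}. num_cycles n j p = v j))) \<longlongrightarrow>
    (\<Prod>j\<in>{1..l}. pmf (poisson_pmf (1 / real j)) (v j))) F"
proof -
  have "((\<lambda>n. L n (\<lambda>p. of_bool (\<forall>j\<in>{1..l}. num_cycles n j p = v j))) \<longlongrightarrow>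
      (\<Prod>j\<in>{1..l}. (1 / real j) ^ v j / fact (v j) * exp (- (1 / real j)))) F"
  proof (rule joint_poisson_from_factorial_moments[OF L])
    fix r :: "nat \<Rightarrow> nat"
    define js where "js = concat (map (\<lambda>j. replicate (r j) j) [1..<Suc l])"
    have cat: "count_list (concat (map (\<lambda>j. replicate (r j) j) ks)) i = (if i \<in> set ks then r i else 0)"
      if "distinct ks" for ks i
      using that by (induction ks) (auto simp: count_list_replicate)
    have cnt: "count_list js j = r j" if "j \<in> {1..l}" for j
      unfolding js_def by (subst cat) (use that in auto)
    have set: "set js \<subseteq> {1..l}" by (auto simp: js_def set_replicate_conv_if split: if_splits)
    then have "0 \<notin> set js" by auto
    define c where "c = (\<Prod>j\<in>{1..l}. real j ^ r j * fact (r j))"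
    have c0: "c > 0" unfolding c_def by (intro prod_pos) auto
    have card_eq: "real (card (cycle_embeddings n p js)) = c * (\<Prod>j\<in>{1..l}. real (num_cycles n j p choose r j))"
      if "p permutes {1..n}" for n p
      unfolding card_cycle_embeddings_binomial[OF that set] c_def prod.distrib[symmetric] of_nat_prod
      by (intro prod.cong refl) (simp add: cnt mult.assoc)
    have ev: "\<forall>\<^sub>F n in F. L n (\<lambda>p. real (card (cycle_embeddings n p js))) / c =
        L n (\<lambda>p. \<Prod>j\<in>{1..l}. real (num_cycles n j p choose r j))"
      using L
    proof eventually_elim
      case (elim n)
      interpret class_mean n "L n" by fact
      have "L n (\<lambda>p. real (card (cycle_embeddings n p js))) =
          L n (\<lambda>p. c * (\<Prod>j\<in>{1..l}. real (num_cycles n j p choose r j)))"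
        by (rule cong) (rule card_eq)
      then show ?case using c0 by (simp add: scale)
    qed
    have "((\<lambda>n. L n (\<lambda>p. real (card (cycle_embeddings n p js))) / c) \<longlongrightarrow> 1 / c) F"
      using emb[OF \<open>0 \<notin> set js\<close>] c0 by (intro tendsto_divide tendsto_const) auto
    then have "((\<lambda>n. L n (\<lambda>p. \<Prod>j\<in>{1..l}. real (num_cycles n j p choose r j))) \<longlongrightarrow> 1 / c) F"
      using ev by (rule Lim_transform_eventually)
    also have "1 / c = (\<Prod>j\<in>{1..l}. (1 / real j) ^ r j / fact (r j))"
    proof -
      have "(\<Prod>j\<in>{1..l}. (1 / real j) ^ r j / fact (r j)) = (\<Prod>j\<in>{1..l}. 1 / (real j ^ r j * fact (r j)))"
        by (intro prod.cong refl) (simp add: power_one_over)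
      also have "\<dots> = 1 / c" unfolding prod_dividef c_def by simp
      finally show ?thesis by (rule sym)
    qed
    finally show "((\<lambda>n. L n (\<lambda>p. \<Prod>j\<in>{1..l}. real (num_cycles n j p choose r j))) \<longlongrightarrow>
        (\<Prod>j\<in>{1..l}. (1 / real j) ^ r j / fact (r j))) F" .
  qed simp
  also have "(\<Prod>j\<in>{1..l}. (1 / real j) ^ v j / fact (v j) * exp (- (1 / real j))) =
      (\<Prod>j\<in>{1..l}. pmf (poisson_pmf (1 / real j)) (v j))"
    by (intro prod.cong refl pmf_poisson[symmetric]) simp
  finally show ?thesis .
qed

section \<open>From means to laws\<close>

lemma integral_over_finite_set:
  fixes f :: "'a \<Rightarrow> real"
  assumes N: "finite_measure N" and B: "finite B" "\<And>v. v \<in> B \<Longrightarrow> v \<in> space N \<and> {v} \<in> sets N"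
  shows "(\<integral>v. f v * indicator B v \<partial>N) = (\<Sum>v\<in>B. f v * measure N {v})"
    "integrable N (\<lambda>v. f v * indicator B v)"
proof -
  interpret finite_measure N by fact
  have eq: "f v * indicator B v = (\<Sum>u\<in>B. f u * indicator {u} v)" for v
    using B(1) by (simp add: indicator_def if_distrib[of "\<lambda>t. _ * t"] sum.delta cong: if_cong)
  have int: "integrable N (\<lambda>v. f u * indicator {u} v)" if "u \<in> B" for u
    using B(2)[OF that] by (intro integrable_mult_right integrable_real_indicator) (auto simp: emeasure_eq_measure)
  have "(\<integral>v. f v * indicator B v \<partial>N) = (\<Sum>u\<in>B. \<integral>v. f u * indicator {u} v \<partial>N)"
    unfolding eq by (rule Bochner_Integration.integral_sum) (rule int)
  also have "\<dots> = (\<Sum>u\<in>B. f u * measure N {u})"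
    using B(2) by (intro sum.cong refl) (simp add: Int_absorb2)
  finally show "(\<integral>v. f v * indicator B v \<partial>N) = (\<Sum>v\<in>B. f v * measure N {v})" .
  show "integrable N (\<lambda>v. f v * indicator B v)"
    unfolding eq by (rule Bochner_Integration.integrable_sum) (rule int)
qed

lemma poisson_product_simps:
  shows "prob_space (poisson_product l)" "space (poisson_product l) = {1..l} \<rightarrow>\<^sub>E UNIV"
    "sets (poisson_product l) = Pow ({1..l} \<rightarrow>\<^sub>E UNIV)"
    "v \<in> {1..l} \<rightarrow>\<^sub>E UNIV \<Longrightarrow> measure (poisson_product l) {v} = (\<Prod>j\<in>{1..l}. pmf (poisson_pmf (1 / real j)) (v j))"
proof -
  interpret product_prob_space "\<lambda>j. measure_pmf (poisson_pmf (1 / real j))" "{1..l}"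
    by (intro product_prob_spaceI measure_pmf.prob_space_axioms)
  show "prob_space (poisson_product l)" unfolding poisson_product_def by (rule prob_space_PiM) (rule measure_pmf.prob_space_axioms)
  show "space (poisson_product l) = {1..l} \<rightarrow>\<^sub>E UNIV" by (simp add: poisson_product_def space_PiM)
  have "sets (poisson_product l) = sets (\<Pi>\<^sub>M j\<in>{1..l}. count_space (UNIV :: nat set))"
    unfolding poisson_product_def by (intro sets_PiM_cong) auto
  also have "(\<Pi>\<^sub>M j\<in>{1..l}. count_space (UNIV :: nat set)) = count_space ({1..l} \<rightarrow>\<^sub>E UNIV)"
    by (rule count_space_PiM_finite) auto
  finally show "sets (poisson_product l) = Pow ({1..l} \<rightarrow>\<^sub>E UNIV)" by simp
  assume v: "v \<in> {1..l} \<rightarrow>\<^sub>E UNIV"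
  have "{v} = PiE {1..l} (\<lambda>j. {v j})"
    using v by (intro PiE_singleton[symmetric]) (simp add: PiE_iff)
  then have "emeasure (poisson_product l) {v} = (\<Prod>j\<in>{1..l}. emeasure (measure_pmf (poisson_pmf (1 / real j))) {v j})"
    unfolding poisson_product_def by (simp add: emeasure_PiM)
  also have "\<dots> = ennreal (\<Prod>j\<in>{1..l}. pmf (poisson_pmf (1 / real j)) (v j))"
    unfolding emeasure_pmf_single by (rule prod_ennreal) (rule pmf_nonneg)
  finally show "measure (poisson_product l) {v} = (\<Prod>j\<in>{1..l}. pmf (poisson_pmf (1 / real j)) (v j))"
    by (simp only: measure_def enn2real_ennreal prod_nonneg pmf_nonneg)
qed

text \<open>
  The boxes \<open>B k\<close> exhaust the limit law. Since the mass of a box converges to its limiting mass, the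
  mass outside a large box is uniformly small for large \<open>n\<close>.
\<close>

lemma bounded_mean_limit:
  fixes f :: "(nat \<Rightarrow> nat) \<Rightarrow> real"
  assumes L: "\<forall>\<^sub>F n in F. class_mean n (L n)"
    and lim: "\<And>v. ((\<lambda>n. L n (\<lambda>p. of_bool (\<forall>j\<in>{1..l}. num_cycles n j p = v j))) \<longlongrightarrow>
        (\<Prod>j\<in>{1..l}. pmf (poisson_pmf (1 / real j)) (v j))) F"
    and K: "\<And>v. v \<in> {1..l} \<rightarrow>\<^sub>E UNIV \<Longrightarrow> \<bar>f v\<bar> \<le> K"
  shows "((\<lambda>n. L n (\<lambda>p. f (\<lambda>j\<in>{1..l}. num_cycles n j p))) \<longlongrightarrow> (\<integral>v. f v \<partial>poisson_product l)) F"
proof -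
  let ?\<nu> = "poisson_product l" and ?X = "\<lambda>n p. \<lambda>j\<in>{1..l}. num_cycles n j p"
  define B where "B = (\<lambda>k::nat. {1..l} \<rightarrow>\<^sub>E {..k})"
  interpret \<nu>: prob_space ?\<nu> by (rule poisson_product_simps)
  note sp = poisson_product_simps(2,3)[of l]
  have finB: "finite (B k)" for k unfolding B_def by (intro finite_PiE) auto
  have BE: "v \<in> {1..l} \<rightarrow>\<^sub>E UNIV" if "v \<in> B k" for v k using that by (auto simp: B_def PiE_iff)
  have eqX: "?X n p = v \<longleftrightarrow> (\<forall>j\<in>{1..l}. num_cycles n j p = v j)" if "v \<in> {1..l} \<rightarrow>\<^sub>E UNIV" for n p v
    using that by (auto simp: PiE_iff fun_eq_iff extensional_def)
  have limX: "((\<lambda>n. L n (\<lambda>p. of_bool (?X n p = v))) \<longlongrightarrow> measure ?\<nu> {v}) F" if "v \<in> {1..l} \<rightarrow>\<^sub>E UNIV" for v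
    using lim[of v] unfolding eqX[OF that] poisson_product_simps(4)[OF that] .
  have intB: "(\<integral>v. g v * indicator (B k) v \<partial>?\<nu>) = (\<Sum>v\<in>B k. g v * measure ?\<nu> {v})" for g :: "(nat \<Rightarrow> nat) \<Rightarrow> real" and k
    by (rule integral_over_finite_set) (use finB BE sp in \<open>auto intro: \<nu>.finite_measure_axioms\<close>)
  have meas: "g \<in> borel_measurable ?\<nu>" for g :: "(nat \<Rightarrow> nat) \<Rightarrow> real"
    unfolding measurable_def sp by auto
  have dct: "(\<lambda>k. \<integral>v. g v * indicator (B k) v \<partial>?\<nu>) \<longlonglongrightarrow> (\<integral>v. g v \<partial>?\<nu>)"
    if g: "\<And>v. v \<in> {1..l} \<rightarrow>\<^sub>E UNIV \<Longrightarrow> \<bar>g v\<bar> \<le> C" for g :: "(nat \<Rightarrow> nat) \<Rightarrow> real" and C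
  proof (rule integral_dominated_convergence[where w = "\<lambda>_. C"])
    show "AE v in ?\<nu>. (\<lambda>k. g v * indicator (B k) v) \<longlonglongrightarrow> g v"
    proof (rule AE_I2)
      fix v assume v: "v \<in> space ?\<nu>"
      have "\<forall>\<^sub>F k in sequentially. g v * indicator (B k) v = g v"
        using eventually_ge_at_top[of "\<Sum>j\<in>{1..l}. v j"]
      proof eventually_elim
        case (elim k)
        have "v j \<le> (\<Sum>j\<in>{1..l}. v j)" if "j \<in> {1..l}" for j
          using that by (intro member_le_sum) auto
        then have "v \<in> B k" using elim v sp by (force simp: B_def PiE_iff)
        then show ?case by simp
      qed
      then show "(\<lambda>k. g v * indicator (B k) v) \<longlonglongrightarrow> g v" by (rule tendsto_eventually)
    qed
    show "AE v in ?\<nu>. norm (g v * indicator (B k) v) \<le> C" for k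
    proof (rule AE_I2)
      fix v assume "v \<in> space ?\<nu>"
      then have "\<bar>g v\<bar> \<le> C" using g sp by simp
      then show "norm (g v * indicator (B k) v) \<le> C" by (auto simp: indicator_def)
    qed
  qed (use meas in auto)
  have K0: "K \<ge> 0" using K[of "\<lambda>j\<in>{1..l}. 0"] by auto
  let ?y = "\<lambda>k n. \<Sum>v\<in>B k. f v * L n (\<lambda>p. of_bool (?X n p = v))"
  let ?z = "\<lambda>k n. K * (1 - (\<Sum>v\<in>B k. L n (\<lambda>p. of_bool (?X n p = v))))"
  show ?thesis
  proof (rule tendsto_by_approximation)
    show "\<forall>\<^sub>F n in F. \<bar>L n (\<lambda>p. f (?X n p)) - ?y k n\<bar> \<le> ?z k n" for k
      using L
    proof eventually_elim
      case (elim n)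
      interpret class_mean n "L n" by fact
      let ?S = "\<lambda>p. \<Sum>v\<in>B k. f v * of_bool (?X n p = v)"
      let ?R = "\<lambda>p. K * (1 - (\<Sum>v\<in>B k. of_bool (?X n p = v)))"
      have S: "(\<Sum>v\<in>B k. g v * of_bool (?X n p = v)) = (if ?X n p \<in> B k then g (?X n p) else 0)"
        for g :: "(nat \<Rightarrow> nat) \<Rightarrow> real" and p
        using finB by (simp add: of_bool_def if_distrib[of "\<lambda>t. _ * t"] sum.delta' cong: if_cong)
      have R: "(\<Sum>v\<in>B k. of_bool (?X n p = v)) = (if ?X n p \<in> B k then 1 else 0 :: real)" for p
        using S[of "\<lambda>_. 1" p] by simp
      have "\<bar>f (?X n p) - ?S p\<bar> \<le> ?R p" for p
        unfolding S R using K[of "?X n p"] K0 by auto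
      then have "f (?X n p) \<le> ?S p + ?R p" "?S p \<le> f (?X n p) + ?R p" for p
        unfolding abs_diff_le_iff by (simp_all only: diff_le_eq)
      then have "L n (\<lambda>p. f (?X n p)) \<le> L n (\<lambda>p. ?S p + ?R p)"
        "L n ?S \<le> L n (\<lambda>p. f (?X n p) + ?R p)"
        by (intro mono; blast)+
      then show ?case unfolding add scale diff one sum[OF finB] by linarith
    qed
    show "(?y k \<longlongrightarrow> (\<integral>v. f v * indicator (B k) v \<partial>?\<nu>)) F" for k
      unfolding intB by (intro tendsto_sum tendsto_mult_left limX BE)
    have "(?z k \<longlongrightarrow> K * (1 - (\<Sum>v\<in>B k. measure ?\<nu> {v}))) F" for k
      by (intro tendsto_mult_left tendsto_diff tendsto_const tendsto_sum limX BE)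
    then show "(?z k \<longlongrightarrow> K * (1 - (\<integral>v. 1 * indicator (B k) v \<partial>?\<nu>))) F" for k
      unfolding intB by simp
    show "(\<lambda>k. \<integral>v. f v * indicator (B k) v \<partial>?\<nu>) \<longlonglongrightarrow> (\<integral>v. f v \<partial>?\<nu>)"
      by (rule dct) (rule K)
    have "(\<lambda>k. K * (1 - (\<integral>v. 1 * indicator (B k) v \<partial>?\<nu>))) \<longlonglongrightarrow> K * (1 - (\<integral>v. 1 \<partial>?\<nu>))"
      by (intro tendsto_mult_left tendsto_diff tendsto_const dct[of _ 1]) simp
    then show "(\<lambda>k. K * (1 - (\<integral>v. 1 * indicator (B k) v \<partial>?\<nu>))) \<longlonglongrightarrow> 0"
      by (simp add: \<nu>.prob_space)
  qed
qed

definition iterated_mean :: "('i \<Rightarrow> (('a \<Rightarrow> 'a) \<Rightarrow> real) \<Rightarrow> real) \<Rightarrow> 'i list \<Rightarrow> (('a \<Rightarrow> 'a) \<Rightarrow> real) \<Rightarrow> real" where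
  "iterated_mean U js = foldr (\<lambda>i. mean_product (U i)) js (\<lambda>f. f id)"

lemma iterated_mean_simps:
  "iterated_mean U [] f = f id" "iterated_mean U (i # js) = mean_product (U i) (iterated_mean U js)"
  "iterated_mean U [i] = U i"
  by (simp_all add: iterated_mean_def mean_product_def fun_eq_iff)

lemma uniform_average_of_product:
  fixes S :: "'i \<Rightarrow> ('a \<Rightarrow> 'a) set"
  assumes "distinct js" and "\<And>i. finite (S i)"
  shows "(\<Sum>v\<in>PiE (set js) S. h (foldr (\<circ>) (map v js) id)) / (\<Prod>i\<in>set js. real (card (S i))) =
    iterated_mean (\<lambda>i. uniform_mean (S i)) js h"
  using assms(1)
proof (induction js arbitrary: h)
  case (Cons i js)
  have inj: "inj_on (\<lambda>(y, g). g(i := y)) (S i \<times> PiE (set js) S)"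
    using Cons.prems by (intro inj_combinator) auto
  have "(\<Sum>v\<in>PiE (set (i # js)) S. h (foldr (\<circ>) (map v (i # js)) id)) =
      (\<Sum>(y, g)\<in>S i \<times> PiE (set js) S. h (y \<circ> foldr (\<circ>) (map (g(i := y)) js) id))"
    unfolding list.set PiE_insert_eq by (subst sum.reindex[OF inj]) (simp add: case_prod_beta)
  also have "\<dots> = (\<Sum>(y, g)\<in>S i \<times> PiE (set js) S. h (y \<circ> foldr (\<circ>) (map g js) id))"
  proof (intro sum.cong refl, clarify)
    fix y :: "'a \<Rightarrow> 'a" and g :: "'i \<Rightarrow> 'a \<Rightarrow> 'a"
    have "map (g(i := y)) js = map g js" using Cons.prems by auto
    then show "h (y \<circ> foldr (\<circ>) (map (g(i := y)) js) id) = h (y \<circ> foldr (\<circ>) (map g js) id)"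
      by (simp only:)
  qed
  also have "\<dots> = (\<Sum>y\<in>S i. \<Sum>g\<in>PiE (set js) S. h (y \<circ> foldr (\<circ>) (map g js) id))"
    by (rule sum.cartesian_product[symmetric])
  finally have "(\<Sum>v\<in>PiE (set (i # js)) S. h (foldr (\<circ>) (map v (i # js)) id)) / (\<Prod>i\<in>set (i # js). real (card (S i))) =
      (\<Sum>y\<in>S i. (\<Sum>g\<in>PiE (set js) S. h (y \<circ> foldr (\<circ>) (map g js) id)) / (\<Prod>i\<in>set js. real (card (S i)))) / real (card (S i))"
    using Cons.prems by (simp add: sum_divide_distrib[symmetric])
  also have "\<dots> = (\<Sum>y\<in>S i. iterated_mean (\<lambda>i. uniform_mean (S i)) js (\<lambda>d. h (y \<circ> d))) / real (card (S i))"
  proof -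
    have "distinct js" using Cons.prems by simp
    have "(\<Sum>g\<in>PiE (set js) S. h (y \<circ> foldr (\<circ>) (map g js) id)) / (\<Prod>i\<in>set js. real (card (S i))) =
        iterated_mean (\<lambda>i. uniform_mean (S i)) js (\<lambda>d. h (y \<circ> d))" for y
      using Cons.IH[OF \<open>distinct js\<close>, of "\<lambda>d. h (y \<circ> d)"] .
    then show ?thesis by (simp only:)
  qed
  also have "\<dots> = uniform_mean (S i) (\<lambda>y. iterated_mean (\<lambda>i. uniform_mean (S i)) js (\<lambda>d. h (y \<circ> d)))"
    by (rule uniform_mean_def[symmetric])
  finally show ?case unfolding iterated_mean_simps mean_product_def .
qed (simp add: iterated_mean_simps)

lemma integral_independent_uniform:
  fixes X :: "'i \<Rightarrow> 'w \<Rightarrow> 'b" and G :: "('i \<Rightarrow> 'b) \<Rightarrow> real"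
  assumes M: "prob_space M" and I: "finite I" "I \<noteq> {}"
    and S: "\<And>i. finite (S i)" 
    and indep: "prob_space.indep_vars M (\<lambda>i. count_space (S i)) X I"
    and unif: "\<And>i. i \<in> I \<Longrightarrow> distr M (count_space (S i)) (X i) = uniform_count_measure (S i)"
  shows "(\<integral>\<omega>. G (\<lambda>i\<in>I. X i \<omega>) \<partial>M) = (\<Sum>v\<in>PiE I S. G v) / (\<Prod>i\<in>I. real (card (S i)))"
    "(\<lambda>\<omega>. \<lambda>i\<in>I. X i \<omega>) \<in> M \<rightarrow>\<^sub>M count_space (PiE I S)"
proof -
  interpret M: prob_space M by fact
  have rv: "M.random_variable (count_space (S i)) (X i)" if "i \<in> I" for i
    using indep that unfolding M.indep_vars_def2 by blast
  have cs: "(\<Pi>\<^sub>M i\<in>I. count_space (S i)) = count_space (PiE I S)"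
    by (rule count_space_PiM_finite) (use I S in \<open>auto intro: countable_finite\<close>)
  show T: "(\<lambda>\<omega>. \<lambda>i\<in>I. X i \<omega>) \<in> M \<rightarrow>\<^sub>M count_space (PiE I S)"
    unfolding cs[symmetric] by (intro measurable_restrict rv)
  let ?U = "\<lambda>i. uniform_count_measure (S i)"
  have "distr M (\<Pi>\<^sub>M i\<in>I. count_space (S i)) (\<lambda>\<omega>. \<lambda>i\<in>I. X i \<omega>) = (\<Pi>\<^sub>M i\<in>I. distr M (count_space (S i)) (X i))"
    using M.indep_vars_iff_distr_eq_PiM'[where M' = "\<lambda>i. count_space (S i)" and X = X, OF I(2) rv] indep by blast
  also have "\<dots> = PiM I ?U" by (intro PiM_cong refl unif)
  finally have D: "distr M (count_space (PiE I S)) (\<lambda>\<omega>. \<lambda>i\<in>I. X i \<omega>) = PiM I ?U" unfolding cs .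
  then interpret P: prob_space "PiM I ?U" using M.prob_space_distr[OF T] by simp
  have spP: "space (PiM I ?U) = PiE I S" by (simp add: space_PiM space_uniform_count_measure)
  have "sets (PiM I ?U) = sets (\<Pi>\<^sub>M i\<in>I. count_space (S i))"
    by (intro sets_PiM_cong refl sets_uniform_count_measure_count_space)
  then have stP: "sets (PiM I ?U) = Pow (PiE I S)" unfolding cs by simp
  have finP: "finite (PiE I S)" using I S by (intro finite_PiE)
  have "finite_measure (?U i)" for i
    by (rule finite_measureI) (simp add: S emeasure_uniform_count_measure space_uniform_count_measure)
  then interpret PS: product_sigma_finite ?U
    by (intro product_sigma_finite.intro finite_measure.axioms(1))
  have single: "measure (PiM I ?U) {v} = 1 / (\<Prod>i\<in>I. real (card (S i)))" if v: "v \<in> PiE I S" for v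
  proof -
    have "{v} = PiE I (\<lambda>i. {v i})"
      using v by (intro PiE_singleton[symmetric]) (simp add: PiE_iff)
    then have "emeasure (PiM I ?U) {v} = (\<Prod>i\<in>I. emeasure (?U i) {v i})"
      using PS.emeasure_PiM[OF I(1), of "\<lambda>i. {v i}"] v by (auto simp: sets_uniform_count_measure PiE_iff)
    also have "\<dots> = (\<Prod>i\<in>I. ennreal (1 / real (card (S i))))"
      using v S by (intro prod.cong refl) (simp add: emeasure_uniform_count_measure PiE_iff)
    also have "\<dots> = ennreal (\<Prod>i\<in>I. 1 / real (card (S i)))" by (rule prod_ennreal) simp
    finally have "measure (PiM I ?U) {v} = (\<Prod>i\<in>I. 1 / real (card (S i)))"
      by (simp only: measure_def) (simp add: prod_nonneg)
    then show ?thesis by (simp add: prod_dividef)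
  qed
  have "(\<integral>\<omega>. G (\<lambda>i\<in>I. X i \<omega>) \<partial>M) = (\<integral>v. G v \<partial>PiM I ?U)"
    unfolding D[symmetric] by (rule integral_distr[symmetric, OF T]) simp
  also have "\<dots> = (\<integral>v. G v * indicator (PiE I S) v \<partial>PiM I ?U)"
    by (rule Bochner_Integration.integral_cong) (simp_all add: spP)
  also have "\<dots> = (\<Sum>v\<in>PiE I S. G v * measure (PiM I ?U) {v})"
    by (rule integral_over_finite_set(1)) (use finP spP stP in \<open>auto intro: P.finite_measure_axioms\<close>)
  also have "\<dots> = (\<Sum>v\<in>PiE I S. G v) / (\<Prod>i\<in>I. real (card (S i)))"
    by (simp add: single sum_divide_distrib)
  finally show "(\<integral>\<omega>. G (\<lambda>i\<in>I. X i \<omega>) \<partial>M) = (\<Sum>v\<in>PiE I S. G v) / (\<Prod>i\<in>I. real (card (S i)))" .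
qed

lemma integral_cycle_count_law:
  fixes X :: "nat \<Rightarrow> 'w \<Rightarrow> nat \<Rightarrow> nat" and f :: "(nat \<Rightarrow> nat) \<Rightarrow> real"
  assumes M: "prob_space M" and k: "k \<ge> 1"
    and indep: "prob_space.indep_vars M (\<lambda>i. count_space (perms_with_cycles n (A i))) X {1..k}"
    and unif: "\<And>i. i \<in> {1..k} \<Longrightarrow> distr M (count_space (perms_with_cycles n (A i))) (X i)
        = uniform_count_measure (perms_with_cycles n (A i))"
    and \<sigma>: "\<And>\<omega>. \<omega> \<in> space M \<Longrightarrow> \<sigma> \<omega> = perm_product k (\<lambda>i. X i \<omega>)"
  shows "(\<integral>x. f x \<partial>cycle_count_law M n l \<sigma>) =
    iterated_mean (\<lambda>i. uniform_mean (perms_with_cycles n (A i))) [1..<Suc k] (\<lambda>p. f (\<lambda>j\<in>{1..l}. num_cycles n j p))"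
proof -
  let ?S = "\<lambda>i. perms_with_cycles n (A i)" and ?I = "{1..k}"
  let ?h = "\<lambda>p. \<lambda>j\<in>{1..l}. num_cycles n j p"
  let ?T = "\<lambda>\<omega>. \<lambda>i\<in>?I. X i \<omega>"
  have I: "finite ?I" "?I \<noteq> {}" using k by auto
  note int = integral_independent_uniform[OF M I finite_perms_with_cycles indep unif]
  have pp: "\<sigma> \<omega> = perm_product k (?T \<omega>)" if "\<omega> \<in> space M" for \<omega>
  proof -
    have "map (\<lambda>i. X i \<omega>) [1..<Suc k] = map (?T \<omega>) [1..<Suc k]" by auto
    then show ?thesis unfolding \<sigma>[OF that] perm_product_def by (simp only:)
  qed
  have cs: "(\<Pi>\<^sub>M j\<in>{1..l}. count_space (UNIV :: nat set)) = count_space ({1..l} \<rightarrow>\<^sub>E UNIV)"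
    by (rule count_space_PiM_finite) auto
  have meas: "(\<lambda>\<omega>. ?h (\<sigma> \<omega>)) \<in> M \<rightarrow>\<^sub>M (\<Pi>\<^sub>M j\<in>{1..l}. count_space UNIV)"
  proof -
    have "(\<lambda>v. ?h (perm_product k v)) \<in> count_space (PiE ?I ?S) \<rightarrow>\<^sub>M (\<Pi>\<^sub>M j\<in>{1..l}. count_space UNIV)"
      unfolding cs by auto
    from measurable_compose[OF int(2) this]
    show ?thesis
    proof (rule measurable_cong[THEN iffD1, rotated])
      show "?h (perm_product k (?T \<omega>)) = ?h (\<sigma> \<omega>)" if "\<omega> \<in> space M" for \<omega>
        by (rule arg_cong[OF pp[OF that, symmetric]])
    qed
  qed
  have "(\<integral>x. f x \<partial>cycle_count_law M n l \<sigma>) = (\<integral>\<omega>. f (?h (\<sigma> \<omega>)) \<partial>M)"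
    unfolding cycle_count_law_def by (rule integral_distr[OF meas]) (unfold cs, simp)
  also have "\<dots> = (\<integral>\<omega>. f (?h (perm_product k (?T \<omega>))) \<partial>M)"
    by (rule Bochner_Integration.integral_cong[OF refl]) (simp only: pp)
  also have "\<dots> = (\<Sum>v\<in>PiE ?I ?S. f (?h (perm_product k v))) / (\<Prod>i\<in>?I. real (card (?S i)))"
    by (rule int(1))
  also have "\<dots> = iterated_mean (\<lambda>i. uniform_mean (?S i)) [1..<Suc k] (\<lambda>p. f (?h p))"
  proof -
    have "set [1..<Suc k] = ?I" by auto
    then show ?thesis
      using uniform_average_of_product[of "[1..<Suc k]" ?S "\<lambda>p. f (?h p)"]
      unfolding perm_product_def by simp
  qed
  finally show ?thesis .
qed

text \<open>
  A product of at least two tame factors is scarce, and scarce factors are tame; so the property is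
  preserved when further factors are multiplied on the left.
\<close>

lemma iterated_mean_tame:
  assumes F: "F \<le> sequentially" and U: "\<And>i. i \<in> set js \<Longrightarrow> tame_means F (U i)" and js: "js \<noteq> []"
  shows "tame_means F (\<lambda>n. iterated_mean (\<lambda>i. U i n) js)"
    "length js \<ge> 2 \<Longrightarrow> scarce_means F (\<lambda>n. iterated_mean (\<lambda>i. U i n) js)"
proof -
  have "tame_means F (\<lambda>n. iterated_mean (\<lambda>i. U i n) js) \<and>
    (length js \<ge> 2 \<longrightarrow> scarce_means F (\<lambda>n. iterated_mean (\<lambda>i. U i n) js))"
    using js U
  proof (induction js rule: list_nonempty_induct)
    case (single i)
    then show ?case by (simp add: iterated_mean_simps(3))
  next
    case (cons i js)
    then have "scarce_means F (\<lambda>n. iterated_mean (\<lambda>i. U i n) (i # js))"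
      unfolding iterated_mean_simps(2) by (intro mean_product_scarce[OF F]) auto
    then show ?case using scarce_imp_tame by auto
  qed
  then show "tame_means F (\<lambda>n. iterated_mean (\<lambda>i. U i n) js)"
    "length js \<ge> 2 \<Longrightarrow> scarce_means F (\<lambda>n. iterated_mean (\<lambda>i. U i n) js)" by auto
qed

theorem theorem3p8:
  fixes k :: nat
    and A :: "nat \<Rightarrow> nat set"
    and M :: "nat \<Rightarrow> 'w measure"
    and s :: "nat \<Rightarrow> nat \<Rightarrow> 'w \<Rightarrow> nat \<Rightarrow> nat"
    and \<sigma> :: "nat \<Rightarrow> 'w \<Rightarrow> nat \<Rightarrow> nat"
  assumes k_ge_2: "k \<ge> 2"
    and A_pos: "\<And>i. i \<in> {1..k} \<Longrightarrow> A i \<subseteq> {1..}"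
    and A_nonempty: "\<And>i. i \<in> {1..k} \<Longrightarrow> A i \<noteq> {}"
    and A_not_one: "\<And>i. i \<in> {1..k} \<Longrightarrow> A i \<noteq> {1}"
    and A_fin_or_cofin: "\<And>i. i \<in> {1..k} \<Longrightarrow>
          finite (A i) \<or> (\<lambda>j. 1 / real j) summable_on {j. j \<ge> 1 \<and> j \<notin> A i}"
    and prob: "\<And>n. n \<in> admissible k A \<Longrightarrow> prob_space (M n)"
    and indep: "\<And>n. n \<in> admissible k A \<Longrightarrow>
          prob_space.indep_vars (M n) (\<lambda>i. count_space (perms_with_cycles n (A i)))
            (\<lambda>i. s i n) {1..k}"
    and uniform: "\<And>n i. n \<in> admissible k A \<Longrightarrow> i \<in> {1..k} \<Longrightarrow>
          distr (M n) (count_space (perms_with_cycles n (A i))) (s i n)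
            = uniform_count_measure (perms_with_cycles n (A i))"
    and sigma: "\<And>n \<omega>. n \<in> admissible k A \<Longrightarrow> \<omega> \<in> space (M n) \<Longrightarrow>
          \<sigma> n \<omega> = perm_product k (\<lambda>i. s i n \<omega>)"
    and case_cond: "k > 2 \<or> \<not> A 1 \<union> A 2 \<subseteq> {1, 2}"
  shows "\<forall>l\<ge>1. weakly_converges (product_topology (\<lambda>_. euclidean) {1..l})
           (\<lambda>n. cycle_count_law (M n) n l (\<sigma> n)) (poisson_product l)
           (inf sequentially (principal (admissible k A)))"
proof (intro allI impI)
  fix l :: nat
  define F where "F = inf sequentially (principal (admissible k A))"
  have F: "F \<le> sequentially" by (simp add: F_def)
  have adm: "\<forall>\<^sub>F n in F. n \<in> admissible k A" by (simp add: F_def eventually_inf_principal)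
  define U where "U = (\<lambda>i n. uniform_mean (perms_with_cycles n (A i)))"
  have ne: "\<forall>\<^sub>F n in F. perms_with_cycles n (A i) \<noteq> {}" if "i \<in> {1..k}" for i
    using adm by eventually_elim (use that in \<open>auto simp: admissible_def\<close>)
  have tame: "tame_means F (U i)" if i: "i \<in> {1..k}" for i
  proof -
    obtain d where "d \<in> A i" "d \<noteq> 1" using A_nonempty[OF i] A_not_one[OF i] by blast
    moreover from this have "d \<ge> 2" using A_pos[OF i] by (cases d) auto
    ultimately show ?thesis unfolding U_def by (intro uniform_mean_tame[OF F ne[OF i]])
  qed
  have scarce: "scarce_means F (U i)" if i: "i \<in> {1..k}" and large: "\<not> A i \<subseteq> {1, 2}" for i
  proof -
    obtain d where "d \<in> A i" "d \<noteq> 1" "d \<noteq> 2" using large by blast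
    moreover from this have "d \<ge> 3" using A_pos[OF i] by force
    ultimately show ?thesis unfolding U_def by (intro uniform_mean_scarce[OF F ne[OF i]])
  qed
  define T where "T = (\<lambda>n. iterated_mean (\<lambda>i. U i n) [2..<Suc k])"
  define L where "L = (\<lambda>n. iterated_mean (\<lambda>i. U i n) [1..<Suc k])"
  have L: "L = (\<lambda>n. mean_product (U 1 n) (T n))"
  proof -
    have "[1..<Suc k] = 1 # [2..<Suc k]"
      using upt_conv_Cons[of 1 "Suc k"] k_ge_2 by (simp add: numeral_2_eq_2 del: upt_Suc)
    then show ?thesis by (simp only: L_def T_def iterated_mean_simps(2))
  qed
  have T: "tame_means F T" "k > 2 \<Longrightarrow> scarce_means F T"
    unfolding T_def by (rule iterated_mean_tame[OF F]; use tame k_ge_2 in auto)+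
  \<comment> \<open>For \<open>k = 2\<close> the scarce factor may be either of the two; for \<open>k > 2\<close> it is the product of all but the first.\<close>
  have one_scarce: "scarce_means F (U 1) \<or> scarce_means F T"
  proof (cases "k > 2")
    case False
    then have "k = 2" using k_ge_2 by simp
    then have "T = U 2" by (simp add: T_def iterated_mean_simps(3) upt_rec)
    moreover have "\<not> A 1 \<subseteq> {1, 2} \<or> \<not> A 2 \<subseteq> {1, 2}" using case_cond False by blast
    moreover have "1 \<in> {1..k}" "2 \<in> {1..k}" using k_ge_2 by auto
    ultimately show ?thesis using scarce by metis
  qed (use T in simp)
  have "1 \<in> {1..k}" using k_ge_2 by simp
  note tame1 = tame[OF this]
  have means: "\<forall>\<^sub>F n in F. class_mean n (L n)"
    using tame_meansD(1)[OF tame1] tame_meansD(1)[OF T(1)]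
    unfolding L by eventually_elim (rule class_mean_product)
  have emb: "((\<lambda>n. L n (\<lambda>p. real (card (cycle_embeddings n p js)))) \<longlongrightarrow> 1) F" for js
    unfolding L
    by (rule mean_product_embeddings_tendsto_1[OF F tame1 T(1) one_scarce finite_cycle_index bij_betw_rotation])
  show "weakly_converges (product_topology (\<lambda>_. euclidean) {1..l})
           (\<lambda>n. cycle_count_law (M n) n l (\<sigma> n)) (poisson_product l)
           (inf sequentially (principal (admissible k A)))"
    unfolding weakly_converges_def F_def[symmetric]
  proof (intro allI impI, elim conjE)
    fix f :: "(nat \<Rightarrow> nat) \<Rightarrow> real"
    assume "bounded (f ` topspace (product_topology (\<lambda>_. euclidean) {1..l}))"
    then have "bounded (f ` ({1..l} \<rightarrow>\<^sub>E UNIV))" by simp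
    then obtain K where K: "\<And>v. v \<in> {1..l} \<rightarrow>\<^sub>E UNIV \<Longrightarrow> \<bar>f v\<bar> \<le> K"
      unfolding bounded_iff by auto
    have "((\<lambda>n. L n (\<lambda>p. f (\<lambda>j\<in>{1..l}. num_cycles n j p))) \<longlongrightarrow> (\<integral>v. f v \<partial>poisson_product l)) F"
      by (rule bounded_mean_limit[OF means cycle_counts_pointwise_limit[OF means emb] K])
    moreover have "\<forall>\<^sub>F n in F. L n (\<lambda>p. f (\<lambda>j\<in>{1..l}. num_cycles n j p)) =
        (\<integral>x. f x \<partial>cycle_count_law (M n) n l (\<sigma> n))"
      using adm
    proof eventually_elim
      case (elim n)
      have "k \<ge> 1" using k_ge_2 by simp
      from integral_cycle_count_law[OF prob[OF elim] this indep[OF elim] uniform[OF elim] sigma[OF elim], where f = f and l = l]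
      show ?case unfolding L_def U_def by simp
    qed
    ultimately show "((\<lambda>n. \<integral>x. f x \<partial>cycle_count_law (M n) n l (\<sigma> n)) \<longlongrightarrow> (\<integral>v. f v \<partial>poisson_product l)) F"
      by (rule Lim_transform_eventually)
  qed
qed

end
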